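(* Let $M=T^2$ be a torus with a fixed complex structure and $z$ a holomorphic coordinate on its universal cover as in the context. (1) For a conformal immersion $f:M\to S^4$ with Hopf differential $\kappa$, the $\bar\partial$-problem $\bar b_z=2\langle\sigma,\kappa\rangle$ with $\sigma=\mathrm{Re}\,J\kappa$ has a solution $b:M\to\mathbb C$ (where $\bar b_z=\partial_z(\bar b)$) if and only if the normal bundle of $f$ has degree zero; the solution is unique once normalized by $\int_M b=0$. (2) If $f(t):M\to S^4$ is a smooth one-parameter family of conformal immersions evolving by the Davey--Stewartson flow, i.e. with normal variation $\sigma=\mathrm{Re}\,J\kappa$ (and $\int_M b=0$) for all $t$, then the Willmore energy $W(f(t))$ is independent of $t$.
   Context: Let $\mathbb R^{5,1}$ carry the Lorentzian form $\langle v,v\rangle=-v_0^2+\sum_{k=1}^{5}v_k^2$ (extended complex bilinearly), with forward light cone $\mathcal L_+$; identify $S^4$ with the projectivized light cone via $x\leftrightarrow[1:x]$. On the torus $M=T^2$ fix a nowhere vanishing holomorphic vector field $X$ and let $z$ be the holomorphic coordinate on the universal cover for which $\frac{\partial}{\partial z}$ is the $(1,0)$-part of $X$; $\partial_z,\partial_{\bar z}$ and $|dz|^2$ are globally defined on $M$, and integrals over $M$ are with respect to the area measure of $|dz|^2$. For a conformal immersion $f:M\to S^4$ there is a unique normalized lift $\psi:M\to\mathcal L_+$ such that $\psi(p)$ spans the null line $f(p)$ and $|d\psi|^2=|dz|^2$. Let $V=\mathrm{span}\{\psi,d\psi,\psi_{z\bar z}\}$, a rank $4$ subbundle of $M\times\mathbb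 R^{5,1}$ of signature $(3,1)$. The bundle $V^\perp$ is an oriented rank $2$ Euclidean bundle isometric to the normal bundle of $f$; it carries the connection $D$ obtained by projecting the derivative to $V^\perp$ and the $D$-parallel orthogonal complex structure $J$ given by $90$-degree rotation, extended complex linearly to $V^\perp\otimes\mathbb C$. The degree of the normal bundle is its degree as a complex line bundle with respect to $J$. The equation $\psi_{zz}+\frac c2\psi=\kappa$ defines the Schwarzian derivative $c$ (a complex valued function) and the Hopf differential $\kappa\in\Gamma(V^\perp\otimes\mathbb C)$. The Willmore energy is $W(f)=\int_M|\kappa|^2$, $|\kappa|^2=\langle\kappa,\bar\kappa\rangle$. For a smooth family $f(t)$ of conformal immersions with normalized lifts $\psi(t)$ one has $$\psi_t=a\psi+b\psi_z+\bar b\psi_{\bar z}+\sigma$$ with $a$ real valued, $b$ complex valued and $\sigma\in\Gamma(V^\perp)$, the normal variation; conformality is equivalent to $\bar b_z=2\langle\sigma,\kappa\rangle$ and $a=-\mathrm{Re}\,b_z$. Here $\mathrm{Re}\,J\kappa=\frac12(J\kappa+J\bar\kappa)$. *)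

theory Defs
  imports "HOL-Analysis.Analysis"
begin

section \<open>Smooth maps\<close>

text \<open>
  For open \<open>S\<close> in a Euclidean space, \<open>Ck_on k f S\<close> says that \<open>f\<close> is of class \<open>C^k\<close> on \<open>S\<close>.
\<close>

primrec Ck_on :: "nat \<Rightarrow> ('a::euclidean_space \<Rightarrow> 'b::real_normed_vector) \<Rightarrow> 'a set \<Rightarrow> bool" where
  "Ck_on 0 f S \<longleftrightarrow> continuous_on S f"
| "Ck_on (Suc k) f S \<longleftrightarrow>
     (\<forall>x\<in>S. f differentiable (at x)) \<and> (\<forall>v. Ck_on k (\<lambda>x. frechet_derivative f (at x) v) S)"

definition smooth_on :: "'a::euclidean_space set \<Rightarrow> ('a \<Rightarrow> 'b::real_normed_vector) \<Rightarrow> bool" where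
  "smooth_on S f \<longleftrightarrow> (\<forall>k. Ck_on k f S)"


section \<open>The torus\<close>

text \<open>
  The coordinate \<open>z\<close> identifies the universal cover of \<open>M\<close> with the complex plane, hence \<open>M\<close> with
  the quotient of the plane by the lattice spanned by two real-linearly independent periods.
  Maps on \<open>M\<close> are doubly periodic maps on the plane, and an integral over \<open>M\<close> is an integral over a
  fundamental parallelogram; \<open>lborel\<close> on \<open>complex\<close> is the area measure of \<open>|dz|^2\<close>.
\<close>

definition on_torus :: "complex \<Rightarrow> complex \<Rightarrow> (complex \<Rightarrow> 'b) \<Rightarrow> bool" where
  "on_torus \<omega>1 \<omega>2 f \<longleftrightarrow> (\<forall>p. f (p + \<omega>1) = f p \<and> f (p + \<omega>2) = f p)"

definition smooth_on_torus :: "complex \<Rightarrow> complex \<Rightarrow> (complex \<Rightarrow> 'b::real_normed_vector) \<Rightarrow> bool" where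
  "smooth_on_torus \<omega>1 \<omega>2 f \<longleftrightarrow> smooth_on UNIV f \<and> on_torus \<omega>1 \<omega>2 f"

definition fund_parallelogram :: "complex \<Rightarrow> complex \<Rightarrow> complex set" where
  "fund_parallelogram \<omega>1 \<omega>2 = {s *\<^sub>R \<omega>1 + t *\<^sub>R \<omega>2 | s t. 0 \<le> s \<and> s \<le> 1 \<and> 0 \<le> t \<and> t \<le> 1}"

definition torus_integral ::
  "complex \<Rightarrow> complex \<Rightarrow> (complex \<Rightarrow> 'b::{banach, second_countable_topology}) \<Rightarrow> 'b" where
  "torus_integral \<omega>1 \<omega>2 g = (LINT p:fund_parallelogram \<omega>1 \<omega>2|lborel. g p)"

definition dx :: "(complex \<Rightarrow> 'b::real_normed_vector) \<Rightarrow> complex \<Rightarrow> 'b" where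
  "dx f p = frechet_derivative f (at p) 1"

definition dy :: "(complex \<Rightarrow> 'b::real_normed_vector) \<Rightarrow> complex \<Rightarrow> 'b" where
  "dy f p = frechet_derivative f (at p) \<i>"

definition dz :: "(complex \<Rightarrow> complex) \<Rightarrow> complex \<Rightarrow> complex" where
  "dz g p = (dx g p - \<i> * dy g p) / 2"

definition dzbar :: "(complex \<Rightarrow> complex) \<Rightarrow> complex \<Rightarrow> complex" where
  "dzbar g p = (dx g p + \<i> * dy g p) / 2"


section \<open>Lorentz space and its complexification\<close>

text \<open>The index \<open>None\<close> is the timelike one, \<open>Some k\<close> are the spacelike ones.\<close>

type_synonym lor_real = "real ^ (5 option)"
type_synonym lor_complex = "complex ^ (5 option)"

definition lor :: "'a::comm_ring_1 ^ (5 option) \<Rightarrow> 'a ^ (5 option) \<Rightarrow> 'a" where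
  "lor v w = - (v $ None * w $ None) + (\<Sum>k\<in>UNIV. v $ Some k * w $ Some k)"

definition cvec :: "lor_real \<Rightarrow> lor_complex" where
  "cvec v = (\<chi> i. complex_of_real (v $ i))"

definition vcnj :: "lor_complex \<Rightarrow> lor_complex" where
  "vcnj v = (\<chi> i. cnj (v $ i))"

definition vRe :: "lor_complex \<Rightarrow> lor_real" where
  "vRe v = (\<chi> i. Re (v $ i))"

definition vIm :: "lor_complex \<Rightarrow> lor_real" where
  "vIm v = (\<chi> i. Im (v $ i))"

definition vdz :: "(complex \<Rightarrow> lor_complex) \<Rightarrow> complex \<Rightarrow> lor_complex" where
  "vdz F p = (\<chi> i. dz (\<lambda>q. F q $ i) p)"

definition vdzbar :: "(complex \<Rightarrow> lor_complex) \<Rightarrow> complex \<Rightarrow> lor_complex" where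
  "vdzbar F p = (\<chi> i. dzbar (\<lambda>q. F q $ i) p)"

definition light_cone :: "lor_real set" where
  "light_cone = {v. lor v v = 0 \<and> v $ None > 0}"

definition null_vec :: "real ^ 5 \<Rightarrow> lor_real" where
  "null_vec x = (\<chi> i. case i of None \<Rightarrow> 1 | Some k \<Rightarrow> x $ k)"


section \<open>Conformal immersions and their normalized lifts\<close>

text \<open>The conformal factor is positive, so such a map is automatically an immersion.\<close>

definition conformal_immersion :: "complex \<Rightarrow> complex \<Rightarrow> (complex \<Rightarrow> real ^ 5) \<Rightarrow> bool" where
  "conformal_immersion \<omega>1 \<omega>2 f \<longleftrightarrow>
     smooth_on_torus \<omega>1 \<omega>2 f \<and> range f \<subseteq> sphere 0 1 \<and>
     (\<forall>p. \<exists>r>0. \<forall>v w. frechet_derivative f (at p) v \<bullet> frechet_derivative f (at p) w = r * (v \<bullet> w))"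

text \<open>
  The lift is taken on the universal cover; by uniqueness it is periodic when \<open>f\<close> is.
\<close>

definition is_normalized_lift :: "(complex \<Rightarrow> real ^ 5) \<Rightarrow> (complex \<Rightarrow> lor_real) \<Rightarrow> bool" where
  "is_normalized_lift f \<psi> \<longleftrightarrow>
     smooth_on UNIV \<psi> \<and>
     (\<forall>p. \<psi> p \<in> light_cone \<and> span {\<psi> p} = span {null_vec (f p)} \<and>
          (\<forall>v. lor (frechet_derivative \<psi> (at p) v) (frechet_derivative \<psi> (at p) v) = (cmod v)\<^sup>2))"

definition nlift :: "(complex \<Rightarrow> real ^ 5) \<Rightarrow> complex \<Rightarrow> lor_real" where
  "nlift f = (THE \<psi>. is_normalized_lift f \<psi>)"

definition clift :: "(complex \<Rightarrow> real ^ 5) \<Rightarrow> complex \<Rightarrow> lor_complex" where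
  "clift f p = cvec (nlift f p)"

text \<open>The mixed derivative of \<open>\<psi>\<close> with respect to \<open>z\<close> and its conjugate is real.\<close>

definition mixed_deriv :: "(complex \<Rightarrow> real ^ 5) \<Rightarrow> complex \<Rightarrow> lor_real" where
  "mixed_deriv f p = vRe (vdzbar (vdz (clift f)) p)"

definition V_fib :: "(complex \<Rightarrow> real ^ 5) \<Rightarrow> complex \<Rightarrow> lor_real set" where
  "V_fib f p = span ({nlift f p} \<union> range (frechet_derivative (nlift f) (at p)) \<union> {mixed_deriv f p})"

definition V_perp :: "(complex \<Rightarrow> real ^ 5) \<Rightarrow> complex \<Rightarrow> lor_real set" where
  "V_perp f p = {v. \<forall>w\<in>V_fib f p. lor v w = 0}"

definition V_perp_complex :: "(complex \<Rightarrow> real ^ 5) \<Rightarrow> complex \<Rightarrow> lor_complex set" where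
  "V_perp_complex f p = {v. vRe v \<in> V_perp f p \<and> vIm v \<in> V_perp f p}"

definition perp_proj :: "(complex \<Rightarrow> real ^ 5) \<Rightarrow> complex \<Rightarrow> lor_real \<Rightarrow> lor_real" where
  "perp_proj f p v = (THE n. n \<in> V_perp f p \<and> v - n \<in> V_fib f p)"


section \<open>Schwarzian, Hopf differential and Willmore energy\<close>

definition schwarzian :: "(complex \<Rightarrow> real ^ 5) \<Rightarrow> complex \<Rightarrow> complex" where
  "schwarzian f p = (THE c. vdz (vdz (clift f)) p + (c / 2) *s clift f p \<in> V_perp_complex f p)"

definition hopf :: "(complex \<Rightarrow> real ^ 5) \<Rightarrow> complex \<Rightarrow> lor_complex" where
  "hopf f p = vdz (vdz (clift f)) p + (schwarzian f p / 2) *s clift f p"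

definition willmore :: "complex \<Rightarrow> complex \<Rightarrow> (complex \<Rightarrow> real ^ 5) \<Rightarrow> real" where
  "willmore \<omega>1 \<omega>2 f = torus_integral \<omega>1 \<omega>2 (\<lambda>p. Re (lor (hopf f p) (vcnj (hopf f p))))"


section \<open>Orientation and degree of the normal bundle\<close>

text \<open>
  Subtracting the multiple of \<open>null_vec (f p)\<close> with the same timelike component is an isometry of
  the fibre of \<open>V_perp\<close> onto the normal space of \<open>f\<close> in the tangent space of the sphere.
\<close>

definition to_normal :: "(complex \<Rightarrow> real ^ 5) \<Rightarrow> complex \<Rightarrow> lor_real \<Rightarrow> real ^ 5" where
  "to_normal f p v = (\<chi> k. v $ Some k - v $ None * f p $ k)"

text \<open>
  A pair of normal vectors is positively oriented if, preceded by the outward normal \<open>f p\<close> of the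
  sphere and the oriented tangent frame of the surface, it is a positive basis of the ambient
  5-space. The complex structure is the rotation by a positive right angle.
\<close>

definition rotJ :: "(complex \<Rightarrow> real ^ 5) \<Rightarrow> complex \<Rightarrow> lor_real \<Rightarrow> lor_real" where
  "rotJ f p v = (THE w. w \<in> V_perp f p \<and> lor w w = lor v v \<and> lor v w = 0 \<and>
     (v \<noteq> 0 \<longrightarrow>
       det (vector [f p, dx f p, dy f p, to_normal f p v, to_normal f p w] :: real ^ 5 ^ 5) > 0))"

definition rotJ_complex :: "(complex \<Rightarrow> real ^ 5) \<Rightarrow> complex \<Rightarrow> lor_complex \<Rightarrow> lor_complex" where
  "rotJ_complex f p v = cvec (rotJ f p (vRe v)) + \<i> *s cvec (rotJ f p (vIm v))"

definition perp_section :: "(complex \<Rightarrow> real ^ 5) \<Rightarrow> (complex \<Rightarrow> lor_real) \<Rightarrow> bool" where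
  "perp_section f s \<longleftrightarrow> smooth_on UNIV s \<and> (\<forall>p. s p \<in> V_perp f p)"

definition normal_conn ::
  "(complex \<Rightarrow> real ^ 5) \<Rightarrow> complex \<Rightarrow> (complex \<Rightarrow> lor_real) \<Rightarrow> complex \<Rightarrow> lor_real" where
  "normal_conn f v s p = perp_proj f p (frechet_derivative s (at p) v)"

text \<open>
  The curvature of \<open>D\<close> commutes with \<open>J\<close> and is skew, so on \<open>(\<partial>\<^sub>x, \<partial>\<^sub>y)\<close> it is a real multiple of \<open>J\<close>.
  It is tensorial, so it may be computed with sections over the universal cover.
\<close>

definition normal_curvature :: "(complex \<Rightarrow> real ^ 5) \<Rightarrow> complex \<Rightarrow> real" where
  "normal_curvature f p = (THE k. \<forall>s. perp_section f s \<longrightarrow>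
     normal_conn f 1 (normal_conn f \<i> s) p - normal_conn f \<i> (normal_conn f 1 s) p
       = k *\<^sub>R rotJ f p (s p))"

text \<open>
  The degree of a complex line bundle is the integral of its first Chern form \<open>i/(2\<pi>) F\<close>, where \<open>F\<close>
  is the curvature of a complex linear connection. As \<open>D J = 0\<close>, the connection \<open>D\<close> is one; with \<open>J\<close>
  as multiplication by \<open>i\<close> its curvature is \<open>F = i k dx\<and>dy\<close> for \<open>k = normal_curvature\<close>.
\<close>

definition normal_degree :: "complex \<Rightarrow> complex \<Rightarrow> (complex \<Rightarrow> real ^ 5) \<Rightarrow> real" where
  "normal_degree \<omega>1 \<omega>2 f = - torus_integral \<omega>1 \<omega>2 (normal_curvature f) / (2 * pi)"


section \<open>The Davey--Stewartson flow\<close>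

definition ds_variation :: "(complex \<Rightarrow> real ^ 5) \<Rightarrow> complex \<Rightarrow> lor_real" where
  "ds_variation f p = vRe (rotJ_complex f p (hopf f p))"

definition dbar_solution :: "complex \<Rightarrow> complex \<Rightarrow> (complex \<Rightarrow> real ^ 5) \<Rightarrow> (complex \<Rightarrow> complex) \<Rightarrow> bool" where
  "dbar_solution \<omega>1 \<omega>2 f b \<longleftrightarrow> smooth_on_torus \<omega>1 \<omega>2 b \<and>
     (\<forall>p. dz (\<lambda>q. cnj (b q)) p = 2 * lor (cvec (ds_variation f p)) (hopf f p))"

definition smooth_family ::
  "complex \<Rightarrow> complex \<Rightarrow> real set \<Rightarrow> (real \<Rightarrow> complex \<Rightarrow> real ^ 5) \<Rightarrow> bool" where
  "smooth_family \<omega>1 \<omega>2 I F \<longleftrightarrow> smooth_on (I \<times> UNIV) (\<lambda>(t, p). F t p) \<and>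
     (\<forall>t\<in>I. conformal_immersion \<omega>1 \<omega>2 (F t))"

definition ds_flow ::
  "complex \<Rightarrow> complex \<Rightarrow> real set \<Rightarrow> (real \<Rightarrow> complex \<Rightarrow> real ^ 5) \<Rightarrow> bool" where
  "ds_flow \<omega>1 \<omega>2 I F \<longleftrightarrow> smooth_family \<omega>1 \<omega>2 I F \<and>
     (\<forall>t\<in>I. \<exists>(a :: complex \<Rightarrow> real) (b :: complex \<Rightarrow> complex).
        smooth_on_torus \<omega>1 \<omega>2 a \<and> smooth_on_torus \<omega>1 \<omega>2 b \<and> torus_integral \<omega>1 \<omega>2 b = 0 \<and>
        (\<forall>p. cvec (vector_derivative (\<lambda>\<tau>. nlift (F \<tau>) p) (at t)) =
               complex_of_real (a p) *s clift (F t) p + b p *s vdz (clift (F t)) p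
               + cnj (b p) *s vdzbar (clift (F t)) p + cvec (ds_variation (F t) p)))"

end

theory Submission
  imports Defs
begin

text \<open>
  Both parts rest on the normalized lift \<open>\<psi>\<close>, which for a conformal immersion \<open>f\<close> is the explicit
  multiple \<open>|f\<^sub>x|\<^sup>-\<^sup>1 (1, f)\<close> of the null vector of \<open>f\<close>, so that everything depends smoothly on \<open>f\<close>. All scalar products
  of low derivatives of \<open>\<psi>\<close> follow by differentiating \<open>\<langle>\<psi>, \<psi>\<rangle> = \<langle>\<psi>\<^sub>z, \<psi>\<^sub>z\<rangle> = 0\<close> and
  \<open>2 \<langle>\<psi>\<^sub>z, \<psi>\<^sub>z\<^sub>b\<rangle> = 1\<close>, where the index \<open>zb\<close> stands for the conjugate of \<open>z\<close> (\<open>gram1\<close> to \<open>gram4\<close>). The rotation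
  \<open>J\<close> is a vector product in \<open>\<real>\<^sup>5\<close> (\<open>rotJ_eq\<close>), hence smooth, and it is parallel because it is isometric
  and skew on a bundle of rank two (\<open>J_parallel\<close>).

  For the first part, with \<open>\<sigma> = Re J \<kappa> = J Re \<kappa>\<close> the right-hand side \<open>2 \<langle>\<sigma>, \<kappa>\<rangle>\<close> is
  \<open>2 i \<langle>J Re \<kappa>, Im \<kappa>\<rangle>\<close>, and by the Ricci equation (\<open>curvature_eq\<close>) the curvature of the normal bundle is
  \<open>8 \<langle>J Re \<kappa>, Im \<kappa>\<rangle>\<close>. So the integral of the right-hand side is a nonzero multiple of the degree. An
  equation \<open>u\<^sub>z = g\<close> on the torus with smooth \<open>g\<close> is solvable iff \<open>g\<close> has mean zero, and \<open>u\<close> is then unique up to a constant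
  (\<open>mean_dz_eq_0\<close>, \<open>dz_solvable\<close>, \<open>dz_eq_0_imp_const\<close>): on Fourier coefficients \<open>\<partial>\<^sub>z\<close> is multiplication by a
  symbol that is bounded away from 0 except at the constant term.

  For the second part, the Willmore density is \<open>|\<kappa>|\<^sup>2 = \<langle>\<psi>\<^sub>z\<^sub>z\<^sub>b, \<psi>\<^sub>z\<^sub>z\<^sub>b\<rangle>\<close> (\<open>lor_\<kappa>_cnj\<close>), which is quadratic in \<open>\<psi>\<close>.
  Its variation is \<open>\<langle>\<psi>\<^sub>t, EL\<rangle>\<close> up to divergences, where \<open>EL\<close> is the fourth derivative of \<open>\<psi>\<close> corrected
  by multiplier terms for the constraints on \<open>\<psi>\<close>; it is orthogonal to \<open>\<psi>\<close>, \<open>\<psi>\<^sub>z\<close> and \<open>\<psi>\<^sub>z\<^sub>b\<close>, so that only the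
  normal variation counts (\<open>first_variation\<close>). For normal \<open>s\<close> one has
  \<open>\<langle>s, EL\<rangle> = \<langle>s, \<kappa>\<^sub>z\<^sub>b\<^sub>z\<^sub>b\<rangle> + cnj c / 2 \<langle>s, \<kappa>\<rangle>\<close>, and for \<open>s = J \<kappa>\<close> this is the divergence \<open>\<langle>J \<kappa>, \<kappa>\<^sub>z\<^sub>b\<rangle>\<^sub>z\<^sub>b\<close>, as \<open>J\<close> is
  skew and parallel. Since \<open>EL\<close> is real, \<open>\<sigma> = Re J \<kappa>\<close> pairs with it to the real part of a divergence
  (\<open>lor_variation_EL\<close>), and the derivative of the energy vanishes (\<open>willmore_constant\<close>).
\<close>


section \<open>Calculus of smooth maps\<close>

definition dir :: "'a::real_normed_vector \<Rightarrow> ('a \<Rightarrow> 'b::real_normed_vector) \<Rightarrow> 'a \<Rightarrow> 'b" where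
  "dir v f x = frechet_derivative f (at x) v"

lemma dx_dir: "dx f = dir 1 f" and dy_dir: "dy f = dir \<i> f"
  by (auto simp: fun_eq_iff dx_def dy_def dir_def)

lemma dirI: "(f has_derivative f') (at x) \<Longrightarrow> dir v f x = f' v"
  by (simp add: dir_def frechet_derivative_at[symmetric])

lemma dir_works: "f differentiable (at x) \<Longrightarrow> (f has_derivative (\<lambda>v. dir v f x)) (at x)"
  unfolding dir_def using frechet_derivative_works by blast

lemma dir_add_dir: "f differentiable (at x) \<Longrightarrow> dir (u + v) f x = dir u f x + dir v f x"
  and dir_scaleR_dir: "f differentiable (at x) \<Longrightarrow> dir (c *\<^sub>R v) f x = c *\<^sub>R dir v f x"
  unfolding dir_def by (simp_all add: linear_frechet_derivative linear_add linear_cmul)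

lemma dir_const: "dir v (\<lambda>x. c) x = 0"
  by (simp add: dir_def)

lemma dir_cong_open:
  assumes "f differentiable (at x)" "open S" "x \<in> S" "\<And>y. y \<in> S \<Longrightarrow> f y = g y"
  shows "dir v f x = dir v g x"
  unfolding dir_def using frechet_derivative_transform_within_open[OF assms] by simp

lemma differentiable_cong_open:
  assumes "f differentiable (at x)" "open S" "x \<in> S" "\<And>y. y \<in> S \<Longrightarrow> f y = g y"
  shows "g differentiable (at x)"
  using assms has_derivative_transform_within_open unfolding differentiable_def by blast

lemma dir_bounded_linear:
  assumes "bounded_linear L" "f differentiable (at x)"
  shows "dir v (\<lambda>x. L (f x)) x = L (dir v f x)"
  by (rule dirI) (rule bounded_linear.has_derivative[OF assms(1) dir_works[OF assms(2)]])

lemma differentiable_bounded_linear: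
  assumes "bounded_linear L" "f differentiable (at x)"
  shows "(\<lambda>x. L (f x)) differentiable (at x)"
  using bounded_linear.has_derivative[OF assms(1) dir_works[OF assms(2)]] differentiable_def by blast

lemma dir_add:
  assumes "f differentiable (at x)" "g differentiable (at x)"
  shows "dir v (\<lambda>x. f x + g x) x = dir v f x + dir v g x"
  by (rule dirI) (intro has_derivative_add dir_works assms)

lemma dir_bilinear:
  assumes "bounded_bilinear p" "f differentiable (at x)" "g differentiable (at x)"
  shows "dir v (\<lambda>x. p (f x) (g x)) x = p (f x) (dir v g x) + p (dir v f x) (g x)"
  by (rule dirI) (intro bounded_bilinear.FDERIV[OF assms(1)] dir_works assms)

lemma differentiable_bilinear:
  assumes "bounded_bilinear p" "f differentiable (at x)" "g differentiable (at x)"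
  shows "(\<lambda>x. p (f x) (g x)) differentiable (at x)"
  using bounded_bilinear.FDERIV[OF assms(1) dir_works[OF assms(2)] dir_works[OF assms(3)]]
  by (auto simp: differentiable_def)

lemma Ck_on_Suc_dir:
  "Ck_on (Suc k) f S \<longleftrightarrow> (\<forall>x\<in>S. f differentiable (at x)) \<and> (\<forall>v. Ck_on k (dir v f) S)"
  by (simp add: dir_def[abs_def])

declare Ck_on.simps(2)[simp del]

lemma Ck_on_cong:
  assumes "open S" "\<And>x. x \<in> S \<Longrightarrow> f x = g x" "Ck_on k f S"
  shows "Ck_on k g S"
  using assms(2,3)
proof (induction k arbitrary: f g)
  case 0
  then show ?case by (auto cong: continuous_on_cong)
next
  case (Suc k)
  have d: "f differentiable (at x)" if "x \<in> S" for x
    using Suc.prems(2) that by (auto simp: Ck_on_Suc_dir)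
  show ?case
    unfolding Ck_on_Suc_dir
  proof (intro conjI ballI allI)
    fix x assume "x \<in> S"
    then show "g differentiable (at x)"
      using differentiable_cong_open[OF d assms(1)] Suc.prems(1) by auto
  next
    fix v
    show "Ck_on k (dir v g) S"
    proof (rule Suc.IH)
      show "Ck_on k (dir v f) S" using Suc.prems(2) by (simp add: Ck_on_Suc_dir)
      show "dir v f x = dir v g x" if "x \<in> S" for x
        using dir_cong_open[OF d[OF that] assms(1) that] Suc.prems(1) by auto
    qed
  qed
qed

lemma Ck_on_Suc_imp: "Ck_on (Suc k) f S \<Longrightarrow> Ck_on k f S"
proof (induction k arbitrary: f)
  case 0
  then show ?case
    by (auto simp: Ck_on_Suc_dir intro!: continuous_at_imp_continuous_on differentiable_imp_continuous_within)
next
  case (Suc k)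
  show ?case
    using Suc.prems Suc.IH unfolding Ck_on_Suc_dir[of "Suc k"] Ck_on_Suc_dir[of "k"] by blast
qed

lemma smooth_on_iff:
  "smooth_on S f \<longleftrightarrow> (\<forall>x\<in>S. f differentiable (at x)) \<and> (\<forall>v. smooth_on S (dir v f))"
proof
  assume "smooth_on S f"
  then show "(\<forall>x\<in>S. f differentiable (at x)) \<and> (\<forall>v. smooth_on S (dir v f))"
    unfolding smooth_on_def using Ck_on_Suc_dir by blast
next
  assume "(\<forall>x\<in>S. f differentiable (at x)) \<and> (\<forall>v. smooth_on S (dir v f))"
  then show "smooth_on S f"
    unfolding smooth_on_def using Ck_on_Suc_dir Ck_on_Suc_imp by blast
qed

lemma smooth_on_differentiable: "smooth_on S f \<Longrightarrow> x \<in> S \<Longrightarrow> f differentiable (at x)"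
  and smooth_on_dir: "smooth_on S f \<Longrightarrow> smooth_on S (dir v f)"
  using smooth_on_iff by blast+

lemma smooth_on_continuous: "smooth_on S f \<Longrightarrow> continuous_on S f"
  unfolding smooth_on_def by (metis Ck_on.simps(1))

lemma smooth_on_cong:
  assumes "smooth_on S f" "open S" "\<And>x. x \<in> S \<Longrightarrow> f x = g x"
  shows "smooth_on S g"
  using assms Ck_on_cong unfolding smooth_on_def by blast

text \<open>
  A class of maps that contains its directional derivatives consists of smooth maps. This replaces
  an induction on the order of differentiability whenever the derivatives have a closed form.
\<close>

lemma smooth_on_coinduct:
  assumes "open S" "\<Phi> f"
    and "\<And>f x. \<Phi> f \<Longrightarrow> x \<in> S \<Longrightarrow> f differentiable (at x)"
    and "\<And>f v. \<Phi> f \<Longrightarrow> \<exists>g. \<Phi> g \<and> (\<forall>x\<in>S. dir v f x = g x)"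
  shows "smooth_on S f"
  unfolding smooth_on_def
proof
  fix k show "Ck_on k f S"
    using assms(2)
  proof (induction k arbitrary: f)
    case 0
    then show ?case
      using assms(3)
      by (auto intro!: continuous_at_imp_continuous_on differentiable_imp_continuous_within)
  next
    case (Suc k)
    have "Ck_on k (dir v f) S" for v
    proof -
      obtain g where g: "\<Phi> g" "\<forall>x\<in>S. dir v f x = g x" using assms(4) Suc.prems by blast
      show ?thesis using Suc.IH[OF g(1)] Ck_on_cong[OF assms(1), of g "dir v f"] g(2) by auto
    qed
    then show ?case using Suc.prems assms(3) by (auto simp: Ck_on_Suc_dir)
  qed
qed

lemma Ck_on_const: "Ck_on k (\<lambda>x. c) S"
proof (induction k arbitrary: c)
  case (Suc k)
  have "dir v (\<lambda>x. c) = (\<lambda>x. 0)" for v :: 'a by (auto simp: dir_const)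
  then show ?case using Suc by (auto simp: Ck_on_Suc_dir)
qed auto

lemma Ck_on_add:
  assumes "open S" "Ck_on k f S" "Ck_on k g S"
  shows "Ck_on k (\<lambda>x. f x + g x) S"
  using assms(2,3)
proof (induction k arbitrary: f g)
  case 0 then show ?case by (auto intro: continuous_on_add)
next
  case (Suc k)
  show ?case
    unfolding Ck_on_Suc_dir
  proof (intro conjI ballI allI)
    show "(\<lambda>x. f x + g x) differentiable at x" if "x \<in> S" for x
      using Suc.prems that by (auto simp: Ck_on_Suc_dir)
    show "Ck_on k (dir v (\<lambda>x. f x + g x)) S" for v
      by (rule Ck_on_cong[OF assms(1), of "\<lambda>x. dir v f x + dir v g x"])
        (use Suc in \<open>auto simp: Ck_on_Suc_dir dir_add\<close>)
  qed
qed

lemma Ck_on_bilinear: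
  assumes "open S" "bounded_bilinear p" "Ck_on k f S" "Ck_on k g S"
  shows "Ck_on k (\<lambda>x. p (f x) (g x)) S"
  using assms(3,4)
proof (induction k arbitrary: f g)
  case 0 then show ?case using bounded_bilinear.continuous_on[OF assms(2)] by auto
next
  case (Suc k)
  note le = Suc.prems[THEN Ck_on_Suc_imp]
  show ?case
    unfolding Ck_on_Suc_dir
  proof (intro conjI ballI allI)
    show "(\<lambda>x. p (f x) (g x)) differentiable at x" if "x \<in> S" for x
      using Suc.prems that assms(2) by (auto simp: Ck_on_Suc_dir intro: differentiable_bilinear)
    show "Ck_on k (dir v (\<lambda>x. p (f x) (g x))) S" for v
      by (rule Ck_on_cong[OF assms(1), of "\<lambda>x. p (f x) (dir v g x) + p (dir v f x) (g x)"])
        (use Suc le assms in \<open>auto simp: Ck_on_Suc_dir dir_bilinear intro!: Ck_on_add Suc.IH\<close>)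
  qed
qed

lemma smooth_on_const [intro, simp]: "smooth_on S (\<lambda>x. c)"
  by (simp add: smooth_on_def Ck_on_const)

lemma smooth_on_add: "open S \<Longrightarrow> smooth_on S f \<Longrightarrow> smooth_on S g \<Longrightarrow> smooth_on S (\<lambda>x. f x + g x)"
  by (simp add: smooth_on_def Ck_on_add)

lemma smooth_on_bilinear:
  "open S \<Longrightarrow> bounded_bilinear p \<Longrightarrow> smooth_on S f \<Longrightarrow> smooth_on S g \<Longrightarrow>
    smooth_on S (\<lambda>x. p (f x) (g x))"
  by (simp add: smooth_on_def Ck_on_bilinear)

lemma smooth_on_sum:
  "finite A \<Longrightarrow> open S \<Longrightarrow> (\<And>i. i \<in> A \<Longrightarrow> smooth_on S (f i)) \<Longrightarrow> smooth_on S (\<lambda>x. \<Sum>i\<in>A. f i x)"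
  by (induct rule: finite_induct) (auto intro: smooth_on_add)

lemma smooth_on_mult:
  fixes f g :: "'a::euclidean_space \<Rightarrow> 'b::real_normed_algebra"
  shows "open S \<Longrightarrow> smooth_on S f \<Longrightarrow> smooth_on S g \<Longrightarrow> smooth_on S (\<lambda>x. f x * g x)"
  by (rule smooth_on_bilinear[OF _ bounded_bilinear_mult])

lemma smooth_on_prod:
  fixes f :: "'i \<Rightarrow> 'a::euclidean_space \<Rightarrow> 'b::{real_normed_algebra,comm_ring_1}"
  shows "finite A \<Longrightarrow> open S \<Longrightarrow> (\<And>i. i \<in> A \<Longrightarrow> smooth_on S (f i)) \<Longrightarrow>
    smooth_on S (\<lambda>x. \<Prod>i\<in>A. f i x)"
  by (induct rule: finite_induct) (auto intro: smooth_on_mult)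

lemma smooth_on_bounded_linear:
  assumes "open S" "bounded_linear L" "smooth_on S f"
  shows "smooth_on S (\<lambda>x. L (f x))"
proof (rule smooth_on_coinduct[where \<Phi> = "\<lambda>h. \<exists>f. smooth_on S f \<and> h = (\<lambda>x. L (f x))"])
  fix h v assume "\<exists>f. smooth_on S f \<and> h = (\<lambda>x. L (f x))"
  then obtain f where "smooth_on S f" "h = (\<lambda>x. L (f x))" by blast
  then have "smooth_on S (dir v f)" "\<forall>x\<in>S. dir v h x = L (dir v f x)"
    using assms dir_bounded_linear smooth_on_iff by blast+
  then show "\<exists>g. (\<exists>f. smooth_on S f \<and> g = (\<lambda>x. L (f x))) \<and> (\<forall>x\<in>S. dir v h x = g x)" by blast
next
  fix h x assume "\<exists>f. smooth_on S f \<and> h = (\<lambda>x. L (f x))" "x \<in> S"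
  then show "h differentiable at x"
    using assms(2) differentiable_bounded_linear smooth_on_differentiable by blast
qed (use assms in auto)

lemma smooth_on_minus: "open S \<Longrightarrow> smooth_on S f \<Longrightarrow> smooth_on S (\<lambda>x. - f x)"
  by (rule smooth_on_bounded_linear[where L = uminus]) (auto simp: bounded_linear_minus)

lemma smooth_on_diff: "open S \<Longrightarrow> smooth_on S f \<Longrightarrow> smooth_on S g \<Longrightarrow> smooth_on S (\<lambda>x. f x - g x)"
  using smooth_on_add[of S f "\<lambda>x. - g x"] smooth_on_minus[of S g] by simp

lemma smooth_on_scaleR:
  "open S \<Longrightarrow> smooth_on S f \<Longrightarrow> smooth_on S g \<Longrightarrow> smooth_on S (\<lambda>x. f x *\<^sub>R g x)"
  by (rule smooth_on_bilinear[OF _ bounded_bilinear_scaleR])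

text \<open>Slices, translates and changes of linear coordinates are compositions with affine maps.\<close>

lemma dir_affine:
  assumes "bounded_linear L" "f differentiable (at (a + L x))"
  shows "dir v (\<lambda>x. f (a + L x)) x = dir (L v) f (a + L x)"
    and "(\<lambda>x. f (a + L x)) differentiable (at x)"
proof -
  have "((\<lambda>x. a + L x) has_derivative L) (at x)"
    by (auto intro!: derivative_eq_intros bounded_linear_imp_has_derivative assms)
  from has_derivative_compose[OF this dir_works[OF assms(2)]]
  have "((\<lambda>x. f (a + L x)) has_derivative (\<lambda>v. dir (L v) f (a + L x))) (at x)" .
  then show "dir v (\<lambda>x. f (a + L x)) x = dir (L v) f (a + L x)"
    "(\<lambda>x. f (a + L x)) differentiable (at x)"
    by (auto simp: dirI differentiable_def)
qed

lemma smooth_on_affine: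
  assumes "bounded_linear L" "smooth_on S f" "open T" "\<And>x. x \<in> T \<Longrightarrow> a + L x \<in> S"
  shows "smooth_on T (\<lambda>x. f (a + L x))"
proof (rule smooth_on_coinduct[where \<Phi> = "\<lambda>h. \<exists>f. smooth_on S f \<and> h = (\<lambda>x. f (a + L x))"])
  fix h v assume "\<exists>f. smooth_on S f \<and> h = (\<lambda>x. f (a + L x))"
  then obtain f where f: "smooth_on S f" "h = (\<lambda>x. f (a + L x))" by blast
  then have "smooth_on S (dir (L v) f)" "\<forall>x\<in>T. dir v h x = dir (L v) f (a + L x)"
    using assms smooth_on_iff[of S f] by (auto simp: dir_affine)
  then show "\<exists>g. (\<exists>f. smooth_on S f \<and> g = (\<lambda>x. f (a + L x))) \<and> (\<forall>x\<in>T. dir v h x = g x)" by blast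
next
  fix h x assume "\<exists>f. smooth_on S f \<and> h = (\<lambda>x. f (a + L x))" "x \<in> T"
  then show "h differentiable at x"
    using assms dir_affine(2) smooth_on_differentiable by blast
qed (use assms in auto)

text \<open>
  Only square roots and reciprocals are needed, but the derivative of a real power is another real
  power, so that all exponents can be treated in one induction.
\<close>

lemma smooth_on_powr:
  fixes g :: "'a::euclidean_space \<Rightarrow> real"
  assumes "open S" "smooth_on S g" "\<And>x. x \<in> S \<Longrightarrow> g x > 0"
  shows "smooth_on S (\<lambda>x. g x powr a)"
proof -
  have d: "((\<lambda>x. g x powr a) has_derivative (\<lambda>v. (a * g x powr (a - 1)) * dir v g x)) (at x)"
    if "x \<in> S" for x a
  proof -
    have "g differentiable (at x)" "0 < g x" using smooth_on_differentiable assms that by auto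
    from has_derivative_powr[OF dir_works[OF this(1)] has_derivative_const this(2), of a]
    have "((\<lambda>x. g x powr a) has_derivative
        (\<lambda>h. g x powr a * (0 * ln (g x) + dir h g x * a / g x))) (at x)" by simp
    then show ?thesis
      by (rule has_derivative_eq_rhs) (use \<open>0 < g x\<close> in \<open>simp add: fun_eq_iff powr_diff mult_ac\<close>)
  qed
  have "Ck_on k (\<lambda>x. g x powr a) S" for k
  proof (induction k arbitrary: a)
    case 0
    then show ?case
      using d by (auto intro!: continuous_at_imp_continuous_on has_derivative_continuous)
  next
    case (Suc k)
    show ?case
      unfolding Ck_on_Suc_dir
    proof (intro conjI ballI allI)
      show "(\<lambda>x. g x powr a) differentiable at x" if "x \<in> S" for x
        using d[OF that] differentiable_def by blast
      have "Ck_on k (dir v g) S" for v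
        using assms(2) smooth_on_iff smooth_on_def by blast
      then have 1: "Ck_on k (\<lambda>x. (a * g x powr (a - 1)) * dir v g x) S" for v
        by (rule Ck_on_bilinear[OF assms(1) bounded_bilinear_mult
              Ck_on_bilinear[OF assms(1) bounded_bilinear_mult Ck_on_const Suc.IH]])
      have 2: "a * g x powr (a - 1) * dir v g x = dir v (\<lambda>x. g x powr a) x" if "x \<in> S" for x v
        using dirI[OF d[OF that]] by simp
      show "Ck_on k (dir v (\<lambda>x. g x powr a)) S" for v
        by (rule Ck_on_cong[OF assms(1) 2 1])
    qed
  qed
  then show ?thesis by (simp add: smooth_on_def)
qed

lemma smooth_on_inverse:
  fixes g :: "'a::euclidean_space \<Rightarrow> real"
  assumes "open S" "smooth_on S g" "\<And>x. x \<in> S \<Longrightarrow> g x > 0"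
  shows "smooth_on S (\<lambda>x. inverse (g x))"
  by (rule smooth_on_cong[OF smooth_on_powr[OF assms, of "-1"] assms(1)])
    (use assms in \<open>auto simp: powr_minus less_imp_le\<close>)

lemma smooth_on_vec_nth: "open S \<Longrightarrow> smooth_on S f \<Longrightarrow> smooth_on S (\<lambda>x. f x $ i)"
  by (rule smooth_on_bounded_linear[OF _ bounded_linear_vec_nth])

lemma smooth_on_vec_lambda:
  fixes f :: "'i::finite \<Rightarrow> 'a::euclidean_space \<Rightarrow> 'b::euclidean_space"
  assumes "open S" "\<And>i. smooth_on S (f i)"
  shows "smooth_on S (\<lambda>x. \<chi> i. f i x)"
proof -
  have "bounded_linear (axis i :: 'b \<Rightarrow> 'b ^ 'i)" for i
    by (intro linear_conv_bounded_linear[THEN iffD1] linearI) (auto simp: axis_def vec_eq_iff)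
  then have "smooth_on S (\<lambda>x. \<Sum>i\<in>UNIV. axis i (f i x))"
    by (rule smooth_on_sum[OF finite assms(1) smooth_on_bounded_linear[OF assms(1) _ assms(2)]])
  moreover have "(\<Sum>i\<in>UNIV. axis i (f i x)) = (\<chi> i. f i x)" for x
    by (auto simp: vec_eq_iff axis_def sum.delta')
  ultimately show ?thesis by simp
qed

lemma dir_vec_nth: "f differentiable (at x) \<Longrightarrow> dir v (\<lambda>x. f x $ i) x = dir v f x $ i"
  by (rule dir_bounded_linear[OF bounded_linear_vec_nth])

text \<open>Both iterated derivatives are limits of the same second difference quotient.\<close>

lemma dir_commute_real:
  fixes f :: "'a::euclidean_space \<Rightarrow> real"
  assumes S: "open S" "x \<in> S" and f: "smooth_on S f"
  shows "dir u (dir v f) x = dir v (dir u f) x"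
proof (rule ccontr)
  define A where "A u v = dir u (dir v f)" for u v
  assume "dir u (dir v f) x \<noteq> dir v (dir u f) x"
  then have e: "\<bar>A u v x - A v u x\<bar> / 2 > 0" (is "?e > 0") by (simp add: A_def)
  have "isCont (A u v) x" for u v
    using smooth_on_continuous[OF smooth_on_dir[OF smooth_on_dir[OF f]]] S
    by (auto simp: A_def continuous_on_eq_continuous_at)
  then have "\<forall>\<^sub>F y in at x. dist (A u v y) (A u v x) < ?e" for u v
    unfolding isCont_def using e tendstoD by blast
  then have "\<forall>\<^sub>F y in nhds x. dist (A u v y) (A u v x) < ?e" "\<forall>\<^sub>F y in nhds x. dist (A v u y) (A v u x) < ?e"
    using e by (simp_all add: eventually_nhds_conv_at)
  moreover have "\<forall>\<^sub>F y in nhds x. y \<in> S" using S by (simp add: eventually_nhds_in_open)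
  ultimately have "\<forall>\<^sub>F y in nhds x. dist (A u v y) (A u v x) < ?e \<and> dist (A v u y) (A v u x) < ?e \<and> y \<in> S"
    by eventually_elim auto
  then obtain d where d: "d > 0"
    "\<And>y. dist y x < d \<Longrightarrow> dist (A u v y) (A u v x) < ?e \<and> dist (A v u y) (A v u x) < ?e \<and> y \<in> S"
    unfolding eventually_nhds_metric by blast
  \<comment> \<open>The parallelogram spanned by \<open>h u\<close> and \<open>h v\<close> has to stay in the ball of radius \<open>d\<close>.\<close>
  define h where "h = d / (2 * (norm u + norm v + 1))"
  have h: "h > 0" using d by (auto simp: h_def add_nonneg_pos)
  have near: "dist (x + s *\<^sub>R u + t *\<^sub>R v) x < d" if "0 \<le> s" "s \<le> h" "0 \<le> t" "t \<le> h" for s t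
  proof -
    have "dist (x + s *\<^sub>R u + t *\<^sub>R v) x \<le> norm (s *\<^sub>R u) + norm (t *\<^sub>R v)"
      using norm_triangle_ineq[of "s *\<^sub>R u" "t *\<^sub>R v"] by (simp add: dist_norm add.assoc)
    also have "\<dots> \<le> h * norm u + h * norm v"
      using that by (simp add: add_mono mult_right_mono)
    also have "\<dots> = d / 2 * ((norm u + norm v) / (norm u + norm v + 1))"
      by (simp add: h_def add_divide_distrib distrib_left)
    also have "\<dots> \<le> d / 2 * 1"
      using d by (intro mult_left_mono) (auto simp: divide_le_eq_1 add_nonneg_pos)
    also have "\<dots> < d" using d by simp
    finally show ?thesis .
  qed
  have key: "\<exists>s t. 0 \<le> s \<and> s \<le> h \<and> 0 \<le> t \<and> t \<le> h \<and>
      f (x + h *\<^sub>R u + h *\<^sub>R v) - f (x + h *\<^sub>R u) - f (x + h *\<^sub>R v) + f x = h * h * A v u (x + s *\<^sub>R u + t *\<^sub>R v)"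
    if near: "\<And>s t. 0 \<le> s \<Longrightarrow> s \<le> h \<Longrightarrow> 0 \<le> t \<Longrightarrow> t \<le> h \<Longrightarrow> x + s *\<^sub>R u + t *\<^sub>R v \<in> S" for u v
  proof -
    have du: "((\<lambda>s. g (x + s *\<^sub>R u + t *\<^sub>R v)) has_derivative (\<lambda>r. r * dir u g (x + s *\<^sub>R u + t *\<^sub>R v))) (at s)"
      if "smooth_on S g" "0 \<le> s" "s \<le> h" "0 \<le> t" "t \<le> h" for s t g
    proof -
      have "((\<lambda>s. x + s *\<^sub>R u + t *\<^sub>R v) has_derivative (\<lambda>r. r *\<^sub>R u)) (at s)"
        by (auto intro!: derivative_eq_intros)
      moreover have g: "g differentiable (at (x + s *\<^sub>R u + t *\<^sub>R v))"
        using near that smooth_on_differentiable by blast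
      ultimately have "((\<lambda>s. g (x + s *\<^sub>R u + t *\<^sub>R v)) has_derivative (\<lambda>r. dir (r *\<^sub>R u) g (x + s *\<^sub>R u + t *\<^sub>R v))) (at s)"
        using has_derivative_compose dir_works by blast
      then show ?thesis by (simp add: dir_scaleR_dir g)
    qed
    have dv: "((\<lambda>t. g (x + s *\<^sub>R u + t *\<^sub>R v)) has_derivative (\<lambda>r. r * dir v g (x + s *\<^sub>R u + t *\<^sub>R v))) (at t)"
      if "smooth_on S g" "0 \<le> s" "s \<le> h" "0 \<le> t" "t \<le> h" for s t g
    proof -
      have "((\<lambda>t. x + s *\<^sub>R u + t *\<^sub>R v) has_derivative (\<lambda>r. r *\<^sub>R v)) (at t)"
        by (auto intro!: derivative_eq_intros)
      moreover have g: "g differentiable (at (x + s *\<^sub>R u + t *\<^sub>R v))"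
        using near that smooth_on_differentiable by blast
      ultimately have "((\<lambda>t. g (x + s *\<^sub>R u + t *\<^sub>R v)) has_derivative (\<lambda>r. dir (r *\<^sub>R v) g (x + s *\<^sub>R u + t *\<^sub>R v))) (at t)"
        using has_derivative_compose dir_works by blast
      then show ?thesis by (simp add: dir_scaleR_dir g)
    qed
    define \<phi> where "\<phi> s = f (x + s *\<^sub>R u + h *\<^sub>R v) - f (x + s *\<^sub>R u + 0 *\<^sub>R v)" for s
    have D\<phi>: "(\<phi> has_derivative (\<lambda>r. r * (dir u f (x + s *\<^sub>R u + h *\<^sub>R v) - dir u f (x + s *\<^sub>R u + 0 *\<^sub>R v)))) (at s)"
      if "0 \<le> s" "s \<le> h" for s
      unfolding \<phi>_def using has_derivative_diff[OF du[OF f that, of h] du[OF f that, of 0]] h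
      by (simp add: algebra_simps)
    obtain s where s: "0 < s" "s < h"
      "\<phi> h - \<phi> 0 = (h - 0) * (dir u f (x + s *\<^sub>R u + h *\<^sub>R v) - dir u f (x + s *\<^sub>R u + 0 *\<^sub>R v))"
      by (rule mvt[OF h, of \<phi>, OF _ D\<phi>])
        (auto intro!: continuous_at_imp_continuous_on has_derivative_continuous D\<phi>)
    have D\<psi>: "((\<lambda>t. dir u f (x + s *\<^sub>R u + t *\<^sub>R v)) has_derivative (\<lambda>r. r * A v u (x + s *\<^sub>R u + t *\<^sub>R v))) (at t)"
      if "0 \<le> t" "t \<le> h" for t
      unfolding A_def using dv[OF smooth_on_dir[OF f], of s t] s that by auto
    obtain t where t: "0 < t" "t < h"
      "dir u f (x + s *\<^sub>R u + h *\<^sub>R v) - dir u f (x + s *\<^sub>R u + 0 *\<^sub>R v) = (h - 0) * A v u (x + s *\<^sub>R u + t *\<^sub>R v)"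
      by (rule mvt[OF h, of "\<lambda>t. dir u f (x + s *\<^sub>R u + t *\<^sub>R v)", OF _ D\<psi>])
        (auto intro!: continuous_at_imp_continuous_on has_derivative_continuous D\<psi>)
    show ?thesis
      using s t by (intro exI[of _ s] exI[of _ t]) (auto simp: \<phi>_def algebra_simps)
  qed
  obtain s t where st: "0 \<le> s" "s \<le> h" "0 \<le> t" "t \<le> h"
    "f (x + h *\<^sub>R u + h *\<^sub>R v) - f (x + h *\<^sub>R u) - f (x + h *\<^sub>R v) + f x = h * h * A v u (x + s *\<^sub>R u + t *\<^sub>R v)"
    using key[of u v] near d(2) by blast
  have "x + t *\<^sub>R v + s *\<^sub>R u \<in> S" if "0 \<le> s" "s \<le> h" "0 \<le> t" "t \<le> h" for s t
    using near[OF that] d(2) by (simp add: add_ac)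
  then obtain s' t' where st': "0 \<le> s'" "s' \<le> h" "0 \<le> t'" "t' \<le> h"
    "f (x + h *\<^sub>R v + h *\<^sub>R u) - f (x + h *\<^sub>R v) - f (x + h *\<^sub>R u) + f x = h * h * A u v (x + s' *\<^sub>R v + t' *\<^sub>R u)"
    using key[of v u] by blast
  have "A v u (x + s *\<^sub>R u + t *\<^sub>R v) = A u v (x + t' *\<^sub>R u + s' *\<^sub>R v)"
    using st(5) st'(5) h by (simp add: algebra_simps)
  moreover have "dist (A v u (x + s *\<^sub>R u + t *\<^sub>R v)) (A v u x) < ?e" "dist (A u v (x + t' *\<^sub>R u + s' *\<^sub>R v)) (A u v x) < ?e"
    using d(2) near st st' by blast+
  moreover have "dist (A u v x) (A v u x) \<le> dist p (A u v x) + dist p (A v u x)" for p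
    by (metis dist_commute dist_triangle)
  ultimately show False
    using dist_real_def[of "A u v x" "A v u x"] by (smt (verit) field_sum_of_halves)
qed

lemma dir_commute:
  fixes f :: "'a::euclidean_space \<Rightarrow> 'b::euclidean_space"
  assumes S: "open S" "x \<in> S" and f: "smooth_on S f"
  shows "dir u (dir v f) x = dir v (dir u f) x"
proof (rule euclidean_eqI)
  fix b :: 'b assume "b \<in> Basis"
  note bl = bounded_linear_inner_left[of b]
  have *: "dir u (dir v f) x \<bullet> b = dir u (dir v (\<lambda>x. f x \<bullet> b)) x" for u v
  proof -
    have "dir u (dir v f) x \<bullet> b = dir u (\<lambda>x. dir v f x \<bullet> b) x"
      using dir_bounded_linear[OF bl smooth_on_differentiable[OF smooth_on_dir[OF f] S(2)]] by simp
    also have "\<dots> = dir u (dir v (\<lambda>x. f x \<bullet> b)) x"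
    proof (rule dir_cong_open[OF _ S])
      show "(\<lambda>x. dir v f x \<bullet> b) differentiable at x"
        by (rule differentiable_bounded_linear[OF bl smooth_on_differentiable[OF smooth_on_dir[OF f] S(2)]])
      show "dir v f y \<bullet> b = dir v (\<lambda>x. f x \<bullet> b) y" if "y \<in> S" for y
        using dir_bounded_linear[OF bl smooth_on_differentiable[OF f that]] by simp
    qed
    finally show ?thesis .
  qed
  show "dir u (dir v f) x \<bullet> b = dir v (dir u f) x \<bullet> b"
    unfolding * by (rule dir_commute_real[OF S smooth_on_bounded_linear[OF S(1) bl f]])
qed


section \<open>Integration over the torus\<close>

lemma measurable_Complex [measurable]: "(\<lambda>(x, y). Complex x y) \<in> borel_measurable (borel \<Otimes>\<^sub>M borel)"
  unfolding borel_prod split_beta Complex_eq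
  by (intro borel_measurable_continuous_onI continuous_intros)

lemma lborel_complex: "(lborel :: complex measure) = distr (lborel \<Otimes>\<^sub>M lborel) borel (\<lambda>(x, y). Complex x y)"
proof -
  have m: "(\<lambda>(x, y). Complex x y) \<in> borel_measurable (lborel \<Otimes>\<^sub>M lborel :: (real \<times> real) measure)"
    by measurable
  show ?thesis
  proof (rule lborel_eqI)
    fix l u :: complex assume "\<And>b. b \<in> Basis \<Longrightarrow> l \<bullet> b \<le> u \<bullet> b"
    then have le: "Re l \<le> Re u" "Im l \<le> Im u" by (force simp: Basis_complex_def)+
    have "emeasure (distr (lborel \<Otimes>\<^sub>M lborel) borel (\<lambda>(x, y). Complex x y)) (box l u) =
        emeasure (lborel \<Otimes>\<^sub>M lborel) (box (Re l, Im l) (Re u, Im u))"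
      by (subst emeasure_distr[OF m])
        (auto intro!: arg_cong2[where f = emeasure] simp: box_def Basis_complex_def Basis_prod_def lborel_prod)
    also have "\<dots> = (\<Prod>b\<in>Basis. (u - l) \<bullet> b)"
      unfolding lborel_prod
      by (subst emeasure_lborel_box)
        (use le in \<open>auto simp: Basis_complex_def Basis_prod_def ennreal_mult' [symmetric] prod.union_disjoint\<close>)
    finally show "emeasure (distr (lborel \<Otimes>\<^sub>M lborel) borel (\<lambda>(x, y). Complex x y)) (box l u) =
        (\<Prod>b\<in>Basis. (u - l) \<bullet> b)" .
  qed simp
qed

lemma nn_integral_lborel_complex:
  assumes [measurable]: "f \<in> borel_measurable borel"
  shows "(\<integral>\<^sup>+z. f z \<partial>lborel) = (\<integral>\<^sup>+x. \<integral>\<^sup>+y. f (Complex x y) \<partial>lborel \<partial>lborel)"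
    and "(\<integral>\<^sup>+z. f z \<partial>lborel) = (\<integral>\<^sup>+y. \<integral>\<^sup>+x. f (Complex x y) \<partial>lborel \<partial>lborel)"
proof -
  have m[measurable]: "(\<lambda>(x, y). Complex x y) \<in> borel_measurable (lborel \<Otimes>\<^sub>M lborel :: (real \<times> real) measure)"
    by measurable
  have f: "(\<lambda>(x, y). f (Complex x y)) \<in> borel_measurable (lborel \<Otimes>\<^sub>M lborel)"
    using measurable_compose[OF m assms] by (simp add: split_beta')
  have "(\<integral>\<^sup>+z. f z \<partial>lborel) = (\<integral>\<^sup>+z. (case z of (x, y) \<Rightarrow> f (Complex x y)) \<partial>(lborel \<Otimes>\<^sub>M lborel))"
    unfolding lborel_complex by (subst nn_integral_distr[OF m]) (auto intro!: nn_integral_cong)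
  then show "(\<integral>\<^sup>+z. f z \<partial>lborel) = (\<integral>\<^sup>+x. \<integral>\<^sup>+y. f (Complex x y) \<partial>lborel \<partial>lborel)"
    "(\<integral>\<^sup>+z. f z \<partial>lborel) = (\<integral>\<^sup>+y. \<integral>\<^sup>+x. f (Complex x y) \<partial>lborel \<partial>lborel)"
    using lborel.nn_integral_fst[OF f] lborel_pair.nn_integral_snd[OF f] by simp_all
qed

text \<open>Two shears and two rescalings of a coordinate axis map the parallelogram to the unit square.\<close>

lemma nn_integral_parallelogram_aux:
  assumes [measurable]: "f \<in> borel_measurable borel" and a: "a \<noteq> 0" and d: "a * d - b * c \<noteq> 0"
  shows "(\<integral>\<^sup>+z. f z \<partial>lborel) =
    ennreal \<bar>a * d - b * c\<bar> * (\<integral>\<^sup>+t. \<integral>\<^sup>+s. f (Complex (s * a + t * c) (s * b + t * d)) \<partial>lborel \<partial>lborel)"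
proof -
  have [measurable]: "(\<lambda>(x, y). Complex x y) \<in> borel_measurable (borel \<Otimes>\<^sub>M borel :: (real \<times> real) measure)"
    by measurable
  define \<delta> where "\<delta> = (a * d - b * c) / a"
  have \<delta>: "\<delta> \<noteq> 0" using a d by (simp add: \<delta>_def)
  have m[measurable]: "(\<lambda>(x, y). Complex x y) \<in> borel_measurable (lborel \<Otimes>\<^sub>M lborel :: (real \<times> real) measure)"
    by measurable
  have "(\<integral>\<^sup>+z. f z \<partial>lborel) = (\<integral>\<^sup>+x. \<integral>\<^sup>+y. f (Complex x y) \<partial>lborel \<partial>lborel)"
    by (rule nn_integral_lborel_complex) fact
  also have "\<dots> = (\<integral>\<^sup>+x. ennreal \<bar>\<delta>\<bar> * (\<integral>\<^sup>+t. f (Complex x (x * b / a + \<delta> * t)) \<partial>lborel) \<partial>lborel)"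
    by (intro nn_integral_cong nn_integral_real_affine \<delta>) measurable
  also have "\<dots> = ennreal \<bar>\<delta>\<bar> * (\<integral>\<^sup>+x. \<integral>\<^sup>+t. f (Complex x (x * b / a + \<delta> * t)) \<partial>lborel \<partial>lborel)"
    by (rule nn_integral_cmult) measurable
  also have "(\<integral>\<^sup>+x. \<integral>\<^sup>+t. f (Complex x (x * b / a + \<delta> * t)) \<partial>lborel \<partial>lborel) =
      (\<integral>\<^sup>+t. \<integral>\<^sup>+x. f (Complex x (x * b / a + \<delta> * t)) \<partial>lborel \<partial>lborel)"
    by (rule lborel_pair.Fubini'[symmetric]) measurable
  also have "\<dots> = (\<integral>\<^sup>+t. ennreal \<bar>a\<bar> * (\<integral>\<^sup>+s. f (Complex (t * c + a * s) ((t * c + a * s) * b / a + \<delta> * t)) \<partial>lborel) \<partial>lborel)"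
    by (intro nn_integral_cong nn_integral_real_affine a) measurable
  also have "\<dots> = ennreal \<bar>a\<bar> * (\<integral>\<^sup>+t. \<integral>\<^sup>+s. f (Complex (t * c + a * s) ((t * c + a * s) * b / a + \<delta> * t)) \<partial>lborel \<partial>lborel)"
    by (rule nn_integral_cmult) measurable
  also have "(\<lambda>t s. f (Complex (t * c + a * s) ((t * c + a * s) * b / a + \<delta> * t))) =
      (\<lambda>t s. f (Complex (s * a + t * c) (s * b + t * d)))"
    using a by (intro ext arg_cong[where f = f]) (simp add: complex_eq_iff \<delta>_def field_simps)
  finally show ?thesis
    using a by (simp add: \<delta>_def mult.assoc[symmetric] ennreal_mult'[symmetric] abs_divide)
qed

locale torus =
  fixes \<omega>1 \<omega>2 :: complex
  assumes indep: "Im (\<omega>2 / \<omega>1) \<noteq> 0"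
begin

text \<open>
  \<open>\<Delta>\<close> is the signed area of the parallelogram, \<open>Tor\<close> parametrizes it by the unit square, and \<open>A\<close> and
  \<open>B\<close> are the real coordinates with respect to the two periods.
\<close>

definition \<Delta> :: real where "\<Delta> = Im (cnj \<omega>1 * \<omega>2)"

lemma \<Delta>: "\<Delta> \<noteq> 0"
proof -
  have "\<omega>2 / \<omega>1 = cnj \<omega>1 * \<omega>2 / of_real ((cmod \<omega>1)\<^sup>2)"
    by (cases "\<omega>1 = 0") (auto simp: complex_norm_square field_simps simp del: of_real_power)
  then show ?thesis using indep by (auto simp: \<Delta>_def)
qed

definition Tor :: "real \<times> real \<Rightarrow> complex" where "Tor x = fst x *\<^sub>R \<omega>1 + snd x *\<^sub>R \<omega>2"
definition A :: "complex \<Rightarrow> real" where "A p = - Im (cnj \<omega>2 * p) / \<Delta>"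
definition B :: "complex \<Rightarrow> real" where "B p = Im (cnj \<omega>1 * p) / \<Delta>"

lemma Tor_AB [simp]: "Tor (A p, B p) = p"
  using \<Delta> by (simp add: Tor_def A_def B_def complex_eq_iff field_simps) (simp add: \<Delta>_def algebra_simps)

lemma AB_Tor [simp]: "A (Tor x) = fst x" "B (Tor x) = snd x"
  using \<Delta> by (simp_all add: Tor_def A_def B_def) (simp_all add: \<Delta>_def field_simps)

lemma inj_Tor: "inj Tor"
  by (rule injI) (metis AB_Tor prod.expand)

lemma bounded_linear_Tor: "bounded_linear Tor"
  unfolding Tor_def by (intro bounded_linear_add bounded_linear_scaleR_const bounded_linear_fst bounded_linear_snd)

lemma bounded_linear_AB: "bounded_linear A" "bounded_linear B"
  unfolding A_def B_def divide_inverse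
  by (intro bounded_linear_mult_const bounded_linear_minus bounded_linear_compose[OF bounded_linear_Im]
    bounded_linear_mult_right)+

lemma measurable_Tor [measurable]: "Tor \<in> borel_measurable (borel \<Otimes>\<^sub>M borel)" "Tor \<in> borel_measurable borel"
  unfolding borel_prod
  by (intro borel_measurable_continuous_onI linear_continuous_on bounded_linear_Tor)+

lemma lborel_parallelogram:
  assumes [measurable]: "f \<in> borel_measurable borel"
  shows "(\<integral>\<^sup>+z. f z \<partial>lborel) = ennreal \<bar>\<Delta>\<bar> * (\<integral>\<^sup>+x. f (Tor x) \<partial>lborel)"
proof -
  have f: "(\<lambda>x. f (Tor x)) \<in> borel_measurable (lborel \<Otimes>\<^sub>M lborel)" by measurable
  have eq: "f (Tor (s, t)) = f (Complex (s * Re \<omega>1 + t * Re \<omega>2) (s * Im \<omega>1 + t * Im \<omega>2))" for s t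
    by (rule arg_cong[where f = f]) (simp add: Tor_def complex_eq_iff)
  have "\<omega>1 \<noteq> 0" "\<omega>2 \<noteq> 0" using indep by auto
  show ?thesis
  proof (cases "Re \<omega>1 = 0")
    case False
    have "(\<integral>\<^sup>+z. f z \<partial>lborel) = ennreal \<bar>\<Delta>\<bar> * (\<integral>\<^sup>+t. \<integral>\<^sup>+s. f (Tor (s, t)) \<partial>lborel \<partial>lborel)"
      unfolding eq using nn_integral_parallelogram_aux[OF assms False, of "Im \<omega>2" "Im \<omega>1" "Re \<omega>2"] \<Delta>
      by (simp add: \<Delta>_def algebra_simps)
    then show ?thesis
      using lborel_pair.nn_integral_snd[OF f[unfolded split_beta']] by (simp add: lborel_prod)
  next
    case True
    then have "Re \<omega>2 \<noteq> 0" using \<Delta> by (auto simp: \<Delta>_def)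
    have "(\<integral>\<^sup>+z. f z \<partial>lborel) = ennreal \<bar>\<Delta>\<bar> * (\<integral>\<^sup>+s. \<integral>\<^sup>+t. f (Tor (s, t)) \<partial>lborel \<partial>lborel)"
      unfolding eq using nn_integral_parallelogram_aux[OF assms \<open>Re \<omega>2 \<noteq> 0\<close>, of "Im \<omega>1" "Im \<omega>2" "Re \<omega>1"] \<Delta>
      by (simp add: \<Delta>_def algebra_simps abs_minus_commute)
    then show ?thesis
      using lborel.nn_integral_fst[OF f] by (simp add: lborel_prod)
  qed
qed

lemma lborel_eq_distr_Tor: "(lborel :: complex measure) = density (distr lborel borel Tor) (\<lambda>_. \<bar>\<Delta>\<bar>)"
proof (rule measure_eqI)
  fix X :: "complex set" assume "X \<in> sets lborel"
  then have X[measurable]: "X \<in> sets borel" by simp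
  have "emeasure lborel X = ennreal \<bar>\<Delta>\<bar> * (\<integral>\<^sup>+x. indicator X (Tor x) \<partial>lborel)"
    using lborel_parallelogram[of "indicator X"] by simp
  also have "\<dots> = ennreal \<bar>\<Delta>\<bar> * emeasure (distr lborel borel Tor) X"
    by (subst nn_integral_distr[of Tor lborel borel, symmetric]) auto
  finally show "emeasure lborel X = emeasure (density (distr lborel borel Tor) (\<lambda>_. \<bar>\<Delta>\<bar>)) X"
    by (simp add: emeasure_density nn_integral_cmult)
qed simp

abbreviation unit_square :: "(real \<times> real) set" where "unit_square \<equiv> cbox (0, 0) (1, 1)"

text \<open>
  The average over the torus. It differs from the integral by the factor \<open>\<bar>\<Delta>\<bar>\<close> and is easier to
  handle because the domain is a box.
\<close>

definition mean :: "(complex \<Rightarrow> 'b::euclidean_space) \<Rightarrow> 'b" where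
  "mean g = integral unit_square (\<lambda>x. g (Tor x))"

lemma continuous_on_Tor: "continuous_on UNIV g \<Longrightarrow> continuous_on S (\<lambda>x. g (Tor x))"
  by (rule continuous_on_compose2[of UNIV g])
    (auto intro: linear_continuous_on bounded_linear_Tor)

lemma torus_integral_eq_mean:
  fixes g :: "complex \<Rightarrow> 'b::euclidean_space"
  assumes g: "continuous_on UNIV g"
  shows "torus_integral \<omega>1 \<omega>2 g = \<bar>\<Delta>\<bar> *\<^sub>R mean g"
proof -
  let ?P = "fund_parallelogram \<omega>1 \<omega>2"
  have P: "?P = Tor ` unit_square"
    by (force simp: fund_parallelogram_def Tor_def image_iff)
  have "compact ?P" unfolding P
    by (intro compact_continuous_image compact_cbox linear_continuous_on bounded_linear_Tor)
  then have Pm[measurable]: "?P \<in> sets borel" by (simp add: compact_imp_closed)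
  have gm[measurable]: "g \<in> borel_measurable borel" by (rule borel_measurable_continuous_onI[OF g])
  have ind: "indicator ?P (Tor x) = (indicator unit_square x :: real)" for x
    using inj_image_mem_iff[OF inj_Tor, of x unit_square] by (simp add: P indicator_def)
  have "torus_integral \<omega>1 \<omega>2 g = (\<integral>z. indicator ?P z *\<^sub>R g z \<partial>density (distr lborel borel Tor) (\<lambda>_. \<bar>\<Delta>\<bar>))"
    unfolding torus_integral_def set_lebesgue_integral_def using lborel_eq_distr_Tor by simp
  also have "\<dots> = (\<integral>x. \<bar>\<Delta>\<bar> *\<^sub>R (indicator ?P (Tor x) *\<^sub>R g (Tor x)) \<partial>lborel)"
    by (subst integral_density) (auto simp: integral_distr)
  also have "\<dots> = \<bar>\<Delta>\<bar> *\<^sub>R (LINT x:unit_square|lborel. g (Tor x))"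
    unfolding ind set_lebesgue_integral_def by (rule integral_scaleR_right)
  also have "(LINT x:unit_square|lborel. g (Tor x)) = mean g"
    unfolding mean_def
    by (intro set_borel_integral_eq_integral)
      (auto simp: set_integrable_def intro!: borel_integrable_compact continuous_on_Tor g)
  finally show ?thesis .
qed

abbreviation per :: "(complex \<Rightarrow> 'b::real_normed_vector) \<Rightarrow> bool" where
  "per \<equiv> smooth_on_torus \<omega>1 \<omega>2"

lemma per_smooth: "per g \<Longrightarrow> smooth_on UNIV g"
  and per_on_torus: "per g \<Longrightarrow> on_torus \<omega>1 \<omega>2 g"
  and perI: "smooth_on UNIV g \<Longrightarrow> on_torus \<omega>1 \<omega>2 g \<Longrightarrow> per g"
  by (auto simp: smooth_on_torus_def)

lemma per_differentiable: "per g \<Longrightarrow> g differentiable (at p)"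
  using per_smooth smooth_on_differentiable by blast

lemma per_continuous: "per g \<Longrightarrow> continuous_on UNIV g"
  by (simp add: per_smooth smooth_on_continuous)

lemma on_torus_dir:
  assumes "smooth_on UNIV g" "on_torus \<omega>1 \<omega>2 g"
  shows "on_torus \<omega>1 \<omega>2 (dir v g)"
proof -
  have "dir v g (p + w) = dir v g p" if "\<And>p. g (p + w) = g p" for p w
  proof -
    have "dir v (\<lambda>p. g (w + p)) p = dir v g (w + p)"
      by (rule dir_affine(1)[OF bounded_linear_ident smooth_on_differentiable[OF assms(1) UNIV_I]])
    then show ?thesis by (simp add: that add.commute[of w])
  qed
  then show ?thesis using assms(2) by (auto simp: on_torus_def)
qed

lemma per_dir: "per g \<Longrightarrow> per (dir v g)"
  using on_torus_dir by (auto simp: smooth_on_torus_def smooth_on_dir)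

lemma per_const [simp]: "per (\<lambda>p. c)"
  by (simp add: smooth_on_torus_def on_torus_def)

lemma per_bilinear: "bounded_bilinear b \<Longrightarrow> per f \<Longrightarrow> per g \<Longrightarrow> per (\<lambda>p. b (f p) (g p))"
  by (simp add: smooth_on_torus_def on_torus_def smooth_on_bilinear)

lemma per_linear: "bounded_linear L \<Longrightarrow> per f \<Longrightarrow> per (\<lambda>p. L (f p))"
  by (simp add: smooth_on_torus_def on_torus_def smooth_on_bounded_linear)

lemma per_add: "per f \<Longrightarrow> per g \<Longrightarrow> per (\<lambda>p. f p + g p)"
  and per_diff: "per f \<Longrightarrow> per g \<Longrightarrow> per (\<lambda>p. f p - g p)"
  by (simp_all add: smooth_on_torus_def on_torus_def smooth_on_add smooth_on_diff)

lemma per_mult: "per f \<Longrightarrow> per g \<Longrightarrow> per (\<lambda>p. f p * (g p :: 'a::real_normed_algebra))"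
  by (rule per_bilinear[OF bounded_bilinear_mult])

lemma per_cnj: "per f \<Longrightarrow> per (\<lambda>p. cnj (f p))"
  by (rule per_linear[OF bounded_linear_cnj])

lemma dz_dir: "dz g p = (dir 1 g p - \<i> * dir \<i> g p) / 2"
  and dzbar_dir: "dzbar g p = (dir 1 g p + \<i> * dir \<i> g p) / 2"
  by (simp_all add: dz_def dzbar_def dx_dir dy_dir)

lemma per_dz: "per g \<Longrightarrow> per (dz g)" and per_dzbar: "per g \<Longrightarrow> per (dzbar g)"
  unfolding dz_dir[abs_def] dzbar_dir[abs_def] divide_inverse
  by (intro per_mult per_diff per_add per_const per_dir; assumption)+

lemma integrable_Tor:
  fixes g :: "complex \<Rightarrow> 'b::euclidean_space"
  shows "continuous_on UNIV g \<Longrightarrow> (\<lambda>x. g (Tor x)) integrable_on unit_square"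
  by (intro integrable_continuous continuous_on_Tor)

lemma mean_add:
  "continuous_on UNIV f \<Longrightarrow> continuous_on UNIV g \<Longrightarrow> mean (\<lambda>p. f p + g p) = mean f + mean g"
  unfolding mean_def by (rule integral_add) (auto intro: integrable_Tor)

lemma mean_linear:
  assumes "bounded_linear L" "continuous_on UNIV f"
  shows "mean (\<lambda>p. L (f p)) = L (mean f)"
  using integral_linear[OF integrable_Tor[OF assms(2)] assms(1)] by (simp add: mean_def o_def)

lemma mean_cmult:
  fixes f :: "complex \<Rightarrow> complex"
  shows "continuous_on UNIV f \<Longrightarrow> mean (\<lambda>p. c * f p) = c * mean f"
  by (rule mean_linear[OF bounded_linear_mult_right])

lemma mean_diff:
  "continuous_on UNIV f \<Longrightarrow> continuous_on UNIV g \<Longrightarrow> mean (\<lambda>p. f p - g p) = mean f - mean g"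
  unfolding mean_def by (rule integral_diff) (auto intro: integrable_Tor)

lemma mean_const [simp]: "mean (\<lambda>p. c) = c"
  by (simp add: mean_def content_Pair)

lemma mean_sum:
  assumes "finite X" "\<And>i. i \<in> X \<Longrightarrow> continuous_on UNIV (f i)"
  shows "mean (\<lambda>p. \<Sum>i\<in>X. f i p) = (\<Sum>i\<in>X. mean (f i))"
  unfolding mean_def by (rule integral_sum) (use assms in \<open>auto intro: integrable_Tor\<close>)

lemma mean_bound:
  assumes "continuous_on UNIV f" "\<And>p. norm (f p) \<le> e"
  shows "norm (mean f) \<le> e"
proof -
  have "norm (mean f) \<le> e * measure lborel unit_square"
    unfolding mean_def
    by (rule has_integral_bound[OF _ integrable_integral[OF integrable_Tor]])
      (use assms order_trans[OF norm_ge_zero assms(2)] in auto)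
  then show ?thesis by (simp add: content_Pair)
qed

text \<open>Stokes' theorem on the torus, for constant vector fields.\<close>

lemma mean_dir_eq_0:
  fixes g :: "complex \<Rightarrow> 'b::euclidean_space"
  assumes g: "per g"
  shows "mean (dir v g) = 0"
proof -
  note dg = dir_works[OF per_differentiable[OF g]]
  have cont: "continuous_on UNIV (dir w g)" for w by (intro per_continuous per_dir g)
  have T: "((\<lambda>s. Tor (a + s * b, c + s * d)) has_derivative (\<lambda>h. h *\<^sub>R Tor (b, d))) (at s within X)"
    for a b c d s X
    unfolding Tor_def by (auto intro!: derivative_eq_intros simp: algebra_simps)
  have ftc: "((\<lambda>s. dir (Tor (b, d)) g (Tor (a + s * b, c + s * d))) has_integral
      g (Tor (a + 1 * b, c + 1 * d)) - g (Tor (a + 0 * b, c + 0 * d))) {0..1}" for a b c d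
  proof (rule fundamental_theorem_of_calculus)
    fix s :: real
    have "((\<lambda>s. g (Tor (a + s * b, c + s * d))) has_derivative
        (\<lambda>h. dir (h *\<^sub>R Tor (b, d)) g (Tor (a + s * b, c + s * d)))) (at s within {0..1})"
      by (rule has_derivative_compose[OF T dg])
    then show "((\<lambda>s. g (Tor (a + s * b, c + s * d))) has_vector_derivative
        dir (Tor (b, d)) g (Tor (a + s * b, c + s * d))) (at s within {0..1})"
      by (simp add: has_vector_derivative_def dir_scaleR_dir per_differentiable[OF g])
  qed simp
  have T1: "Tor (0, 0) = 0" "Tor (1, 0) = \<omega>1" "Tor (0, 1) = \<omega>2" "Tor (1, t) = Tor (0, t) + \<omega>1" "Tor (s, 1) = Tor (s, 0) + \<omega>2" for s t
    by (simp_all add: Tor_def)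
  have p: "g (p + \<omega>1) = g p" "g (p + \<omega>2) = g p" for p
    using per_on_torus[OF g] by (auto simp: on_torus_def)
  have "mean (dir \<omega>1 g) = integral {0..1} (\<lambda>s. integral {0..1} (\<lambda>t. dir \<omega>1 g (Tor (s, t))))"
    unfolding mean_def using integral_prod_continuous[OF continuous_on_Tor[OF cont[of \<omega>1]], of 0 0 1 1]
    by (simp add: cbox_interval)
  also have "\<dots> = integral {0..1} (\<lambda>t. integral {0..1} (\<lambda>s. dir \<omega>1 g (Tor (s, t))))"
    using integral_swap_continuous[of 0 0 1 1 "\<lambda>s t. dir \<omega>1 g (Tor (s, t))"] continuous_on_Tor[OF cont[of \<omega>1]]
    by (simp add: cbox_interval split_beta')
  also have "\<dots> = integral {0..1::real} (\<lambda>t. 0)"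
  proof (rule integral_cong)
    fix t show "integral {0..1} (\<lambda>s. dir \<omega>1 g (Tor (s, t))) = 0"
      using integral_unique[OF ftc[of 1 0 0 t]] by (simp add: T1 p)
  qed
  finally have 1: "mean (dir \<omega>1 g) = 0" by simp
  have "mean (dir \<omega>2 g) = integral {0..1} (\<lambda>s. integral {0..1} (\<lambda>t. dir \<omega>2 g (Tor (s, t))))"
    unfolding mean_def using integral_prod_continuous[OF continuous_on_Tor[OF cont[of \<omega>2]], of 0 0 1 1]
    by (simp add: cbox_interval)
  also have "\<dots> = integral {0..1::real} (\<lambda>t. 0)"
  proof (rule integral_cong)
    fix s show "integral {0..1} (\<lambda>t. dir \<omega>2 g (Tor (s, t))) = 0"
      using integral_unique[OF ftc[of 0 1 s 0]] by (simp add: T1 p)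
  qed
  finally have 2: "mean (dir \<omega>2 g) = 0" by simp
  have "v = A v *\<^sub>R \<omega>1 + B v *\<^sub>R \<omega>2" using Tor_AB[of v] by (simp only: Tor_def fst_conv snd_conv)
  then have "dir v g p = A v *\<^sub>R dir \<omega>1 g p + B v *\<^sub>R dir \<omega>2 g p" for p
    using dir_add_dir dir_scaleR_dir per_differentiable[OF g] by metis
  then have "dir v g = (\<lambda>p. A v *\<^sub>R dir \<omega>1 g p + B v *\<^sub>R dir \<omega>2 g p)" by auto
  then show ?thesis
    using mean_linear[OF bounded_linear_scaleR_right cont[of \<omega>1], of "A v"]
      mean_linear[OF bounded_linear_scaleR_right cont[of \<omega>2], of "B v"]
    by (simp add: mean_add continuous_on_scaleR cont 1 2)
qed

lemma mean_dz_eq_0: "per g \<Longrightarrow> mean (dz g) = 0" and mean_dzbar_eq_0: "per g \<Longrightarrow> mean (dzbar g) = 0"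
proof -
  assume g: "per g"
  have c: "continuous_on UNIV (dir v g)" for v by (intro per_continuous per_dir g)
  have "dz g = (\<lambda>p. (1 / 2) * dir 1 g p - (\<i> / 2) * dir \<i> g p)"
    "dzbar g = (\<lambda>p. (1 / 2) * dir 1 g p + (\<i> / 2) * dir \<i> g p)"
    by (auto simp: fun_eq_iff dz_dir dzbar_dir field_simps)
  then show "mean (dz g) = 0" "mean (dzbar g) = 0"
    by (simp_all only: mean_add mean_diff mean_cmult c continuous_intros mean_dir_eq_0[OF g])
      simp_all
qed


section \<open>Fourier coefficients\<close>

text \<open>
  The characters of the torus; \<open>frq\<close> is the logarithm and hence also the logarithmic derivative.
\<close>

definition frq :: "int \<Rightarrow> int \<Rightarrow> complex \<Rightarrow> complex" where
  "frq m n p = \<i> * of_real (2 * pi * (of_int m * A p + of_int n * B p))"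

definition chr :: "int \<Rightarrow> int \<Rightarrow> complex \<Rightarrow> complex" where
  "chr m n p = exp (frq m n p)"

lemma bounded_linear_frq: "bounded_linear (frq m n)"
  unfolding frq_def
  by (intro bounded_linear_const_mult bounded_linear_of_real[THEN bounded_linear_compose]
    bounded_linear_add bounded_linear_AB)

lemma frq_omega: "frq m n \<omega>1 = 2 * pi * \<i> * of_int m" "frq m n \<omega>2 = 2 * pi * \<i> * of_int n"
proof -
  have "Tor (1, 0) = \<omega>1" "Tor (0, 1) = \<omega>2" by (simp_all add: Tor_def)
  then show "frq m n \<omega>1 = 2 * pi * \<i> * of_int m" "frq m n \<omega>2 = 2 * pi * \<i> * of_int n"
    using AB_Tor[of "(1, 0)"] AB_Tor[of "(0, 1)"] by (simp_all add: frq_def)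
qed

lemma chr_deriv: "(chr m n has_derivative (\<lambda>v. frq m n v * chr m n p)) (at p)"
  unfolding chr_def[abs_def]
  using has_derivative_compose[OF bounded_linear_imp_has_derivative[OF bounded_linear_frq]
      DERIV_exp[THEN has_field_derivative_imp_has_derivative]]
  by (simp add: mult.commute)

lemma per_chr: "per (chr m n)"
proof (rule perI)
  show "smooth_on UNIV (chr m n)"
  proof (rule smooth_on_coinduct[where \<Phi> = "\<lambda>f. \<exists>c. f = (\<lambda>p. c * chr m n p)"])
    show "\<exists>c. chr m n = (\<lambda>p. c * chr m n p)" by (rule exI[of _ 1]) simp
    fix f assume "\<exists>c. f = (\<lambda>p. c * chr m n p)"
    then obtain c where f: "f = (\<lambda>p. c * chr m n p)" by blast
    have D: "(f has_derivative (\<lambda>v. c * (frq m n v * chr m n p))) (at p)" for p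
      unfolding f by (rule has_derivative_mult_right[OF chr_deriv])
    then show "f differentiable at p" for p using differentiable_def by blast
    show "\<exists>g. (\<exists>c. g = (\<lambda>p. c * chr m n p)) \<and> (\<forall>x\<in>UNIV. dir v f x = g x)" for v
      by (rule exI[of _ "\<lambda>p. (c * frq m n v) * chr m n p"]) (auto simp: dirI[OF D])
  qed simp
  have "chr m n (p + \<omega>1) = chr m n p" "chr m n (p + \<omega>2) = chr m n p" for p
  proof -
    have "exp (frq m n \<omega>1) = 1" "exp (frq m n \<omega>2) = 1"
      unfolding frq_omega exp_eq_1 by (auto intro: exI[of _ m] exI[of _ n])
    then show "chr m n (p + \<omega>1) = chr m n p" "chr m n (p + \<omega>2) = chr m n p"
      using bounded_linear.linear[OF bounded_linear_frq]
      by (simp_all add: chr_def linear_add exp_add)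
  qed
  then show "on_torus \<omega>1 \<omega>2 (chr m n)" by (simp add: on_torus_def)
qed

lemma chr_mult: "chr m n p * chr k l p = chr (m + k) (n + l) p"
  by (simp add: chr_def frq_def exp_add[symmetric] algebra_simps)

lemma chr_0 [simp]: "chr 0 0 = (\<lambda>p. 1)"
  by (simp add: fun_eq_iff chr_def frq_def)

lemma norm_chr [simp]: "norm (chr m n p) = 1"
  by (simp add: chr_def frq_def)

lemma cnj_chr: "cnj (chr m n p) = chr (- m) (- n) p"
  by (simp add: chr_def frq_def exp_cnj algebra_simps)

definition fcoeff :: "(complex \<Rightarrow> complex) \<Rightarrow> int \<Rightarrow> int \<Rightarrow> complex" where
  "fcoeff g m n = mean (\<lambda>p. g p * chr (- m) (- n) p)"

lemma continuous_chr: "continuous_on S (chr m n)"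
  using per_continuous[OF per_chr] continuous_on_subset by blast

lemma fcoeff_dir:
  assumes g: "per g"
  shows "fcoeff (dir v g) m n = frq m n v * fcoeff g m n"
proof -
  have "dir v (\<lambda>p. g p * chr (- m) (- n) p) = (\<lambda>p. dir v g p * chr (- m) (- n) p - frq m n v * (g p * chr (- m) (- n) p))"
    by (auto simp: fun_eq_iff dir_bilinear[OF bounded_bilinear_mult] per_differentiable g per_chr dirI[OF chr_deriv]
      frq_def algebra_simps)
  then have "0 = mean (\<lambda>p. dir v g p * chr (- m) (- n) p - frq m n v * (g p * chr (- m) (- n) p))"
    using mean_dir_eq_0[OF per_mult[OF g per_chr], of v "-m" "-n"] by simp
  also have "\<dots> = fcoeff (dir v g) m n - frq m n v * fcoeff g m n"
    unfolding fcoeff_def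
    by (subst mean_diff) (auto intro!: mean_cmult continuous_intros per_continuous[OF g] continuous_chr per_continuous[OF per_dir[OF g]])
  finally show ?thesis by simp
qed

lemma fcoeff_diff:
  "continuous_on UNIV f \<Longrightarrow> continuous_on UNIV g \<Longrightarrow> fcoeff (\<lambda>p. f p - g p) m n = fcoeff f m n - fcoeff g m n"
  unfolding fcoeff_def left_diff_distrib by (rule mean_diff) (intro continuous_intros continuous_chr; assumption)+

lemma fcoeff_cmult: "continuous_on UNIV f \<Longrightarrow> fcoeff (\<lambda>p. c * f p) m n = c * fcoeff f m n"
  unfolding fcoeff_def mult.assoc by (rule mean_cmult) (intro continuous_intros continuous_chr; assumption)

lemma mean_chr: "mean (chr m n) = (if m = 0 \<and> n = 0 then 1 else 0)"
proof (cases "m = 0 \<and> n = 0")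
  case False
  have "frq m n v * mean (chr m n) = 0" for v
    using mean_dir_eq_0[OF per_chr, of v m n] mean_cmult[OF continuous_chr, of "frq m n v" m n]
    by (simp add: dirI[OF chr_deriv, abs_def])
  from this[of \<omega>1] this[of \<omega>2] False show ?thesis by (auto simp: frq_omega)
qed (simp add: chr_0)

section \<open>Completeness of the characters\<close>

lemma on_torus_int:
  assumes "on_torus \<omega>1 \<omega>2 f"
  shows "f (p + of_int m * \<omega>1 + of_int n * \<omega>2) = f p"
proof -
  have *: "f (p + of_int m * w) = f p" if w: "\<And>q. f (q + w) = f q" for p m w
  proof (induction m rule: int_induct[of _ 0])
    case (step1 i)
    then show ?case using w[of "p + of_int i * w"] by (simp add: algebra_simps)
  next
    case (step2 i)
    then show ?case using w[of "p + of_int (i - 1) * w"] by (simp add: algebra_simps)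
  qed simp
  show ?thesis using assms by (simp add: * on_torus_def)
qed

lemma AB_decomp: "p = of_real (A p) * \<omega>1 + of_real (B p) * \<omega>2"
  using Tor_AB[of p] by (simp add: Tor_def scaleR_conv_of_real)

text \<open>
  The embedding of the torus into \<open>\<complex>\<^sup>2\<close> as a product of two unit circles.
\<close>

definition circ :: "complex \<Rightarrow> complex \<times> complex" where
  "circ p = (chr 1 0 p, chr 0 1 p)"

lemma circ_eq_imp:
  assumes "circ p = circ q" "on_torus \<omega>1 \<omega>2 f"
  shows "f p = f q"
proof -
  have "exp (2 * of_real pi * of_real (A p) * \<i>) = exp (2 * of_real pi * of_real (A q) * \<i>)"
    "exp (2 * of_real pi * of_real (B p) * \<i>) = exp (2 * of_real pi * of_real (B q) * \<i>)"
    using assms(1) by (simp_all add: circ_def chr_def frq_def mult_ac)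
  moreover have "\<exists>m::int. a = b + of_int m"
    if ab: "exp (2 * of_real pi * of_real a * \<i>) = exp (2 * of_real pi * of_real b * \<i>)" for a b :: real
  proof -
    obtain m :: int where "2 * of_real pi * of_real a * \<i> = 2 * of_real pi * of_real b * \<i> + of_real (of_int (2 * m) * pi) * \<i>"
      using ab unfolding exp_eq by blast
    from arg_cong[OF this, of Im] have "pi * (a - b - of_int m) = 0" by (simp add: algebra_simps)
    then have "a = b + of_int m" by simp
    then show ?thesis by blast
  qed
  ultimately obtain m n :: int where "A p = A q + of_int m" "B p = B q + of_int n" by blast
  then have "p = q + of_int m * \<omega>1 + of_int n * \<omega>2"
    using AB_decomp[of p] AB_decomp[of q] by (simp add: algebra_simps)
  then show ?thesis using on_torus_int[OF assms(2)] by simp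
qed

lemma on_torus_square:
  assumes "on_torus \<omega>1 \<omega>2 f"
  obtains q where "q \<in> Tor ` unit_square" "f p = f q"
proof -
  define q where "q = Tor (frac (A p), frac (B p))"
  have "p = q + of_int \<lfloor>A p\<rfloor> * \<omega>1 + of_int \<lfloor>B p\<rfloor> * \<omega>2"
    by (subst AB_decomp[of p]) (simp add: q_def Tor_def frac_def scaleR_conv_of_real algebra_simps)
  then have "f p = f q" using on_torus_int[OF assms] by metis
  moreover have "q \<in> Tor ` unit_square"
    unfolding q_def by (intro imageI) (auto simp: frac_ge_0 less_imp_le frac_lt_1)
  ultimately show ?thesis using that by blast
qed

lemma compact_square: "compact (Tor ` unit_square)"
  by (intro compact_continuous_image compact_cbox linear_continuous_on bounded_linear_Tor)

lemma on_torus_bounded: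
  fixes g :: "complex \<Rightarrow> 'b::real_normed_vector"
  assumes "continuous_on UNIV g" "on_torus \<omega>1 \<omega>2 g"
  obtains C where "C \<ge> 0" "\<And>p. norm (g p) \<le> C"
proof -
  have "bounded (g ` Tor ` unit_square)"
    by (rule compact_imp_bounded[OF compact_continuous_image[OF continuous_on_subset[OF assms(1)] compact_square]]) simp
  then obtain C where C: "\<And>q. q \<in> Tor ` unit_square \<Longrightarrow> norm (g q) \<le> C"
    unfolding bounded_iff by blast
  have "norm (g p) \<le> C" for p
    using on_torus_square[OF assms(2), of p] C by metis
  then show ?thesis using that order_trans[OF norm_ge_zero] by blast
qed

text \<open>
  A continuous function on the torus is a continuous function of \<open>circ\<close>, as the torus is compact.
  The Stone--Weierstrass theorem therefore approximates it by polynomials in the real and imaginary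
  parts of the two basic characters.
\<close>

lemma torus_Stone_Weierstrass:
  fixes f :: "complex \<Rightarrow> real"
  assumes f: "continuous_on UNIV f" "on_torus \<omega>1 \<omega>2 f" and e: "e > 0"
  obtains q where "real_polynomial_function q" "\<And>p. \<bar>f p - q (circ p)\<bar> < e"
proof -
  define S where "S = range circ"
  define h where "h x = f (SOME p. circ p = x)" for x
  have h: "h (circ p) = f p" for p
    unfolding h_def by (rule circ_eq_imp[OF _ f(2)]) (rule someI, rule refl)
  have cc: "continuous_on UNIV circ"
    unfolding circ_def by (intro continuous_intros continuous_chr)
  have image: "circ ` (f -` X) = circ ` (f -` X \<inter> Tor ` unit_square)" for X
  proof
    show "circ ` (f -` X) \<subseteq> circ ` (f -` X \<inter> Tor ` unit_square)"
    proof
      fix x assume "x \<in> circ ` (f -` X)"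
      then obtain p where p: "f p \<in> X" "x = circ p" by blast
      have "on_torus \<omega>1 \<omega>2 (\<lambda>p. (f p, circ p))"
        using f(2) per_on_torus[OF per_chr] by (simp add: on_torus_def circ_def)
      then obtain q where "q \<in> Tor ` unit_square" "(f p, circ p) = (f q, circ q)"
        by (rule on_torus_square)
      then show "x \<in> circ ` (f -` X \<inter> Tor ` unit_square)" using p by auto
    qed
  qed auto
  have closed: "closed (circ ` (f -` X))" if "closed X" for X
    unfolding image
    by (intro compact_imp_closed compact_continuous_image[OF continuous_on_subset[OF cc]]
        closed_Int_compact[OF closed_vimage[OF that f(1)] compact_square]) simp
  have "compact S"
  proof -
    have "S = circ ` (f -` UNIV \<inter> Tor ` unit_square)" unfolding S_def using image[of UNIV] by simp
    then show ?thesis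
      using compact_continuous_image[OF continuous_on_subset[OF cc] compact_square] by simp
  qed
  moreover have "continuous_on S h"
    unfolding continuous_on_closed_vimage[OF compact_imp_closed[OF \<open>compact S\<close>]]
  proof (intro allI impI)
    fix X :: "real set" assume "closed X"
    have "h -` X \<inter> S = circ ` (f -` X)" by (auto simp: S_def h)
    then show "closed (h -` X \<inter> S)" using closed[OF \<open>closed X\<close>] by simp
  qed
  ultimately obtain q where "real_polynomial_function q" "\<And>x. x \<in> S \<Longrightarrow> \<bar>h x - q x\<bar> < e"
    using Stone_Weierstrass_real_polynomial_function[OF _ _ e] by blast
  then show ?thesis using that h by (metis S_def rangeI)
qed

text \<open>
  The functions \<open>k\<close> for which \<open>g k\<close> has vanishing Fourier coefficients are stable under
  multiplication by characters, hence by polynomials in them, and so every continuous function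
  is orthogonal to \<open>g\<close>.
\<close>

lemma fcoeff_eq_0_imp:
  assumes g: "continuous_on UNIV g" "on_torus \<omega>1 \<omega>2 g" and 0: "\<And>m n. fcoeff g m n = 0"
  shows "g p = 0"
proof -
  define X where "X k \<longleftrightarrow> continuous_on UNIV k \<and> (\<forall>m n. mean (\<lambda>p. g p * k p * chr m n p) = 0)" for k :: "complex \<Rightarrow> complex"
  have X1: "X (\<lambda>p. 1)"
    unfolding X_def using 0 by (auto simp: fcoeff_def) (metis minus_minus)
  have Xadd: "X (\<lambda>p. c * k p + d * l p)" if "X k" "X l" for k l c d
  proof -
    have "mean (\<lambda>p. g p * (c * k p + d * l p) * chr m n p) =
        mean (\<lambda>p. c * (g p * k p * chr m n p) + d * (g p * l p * chr m n p))" for m n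
      by (simp add: algebra_simps)
    also have "\<dots> m n = c * mean (\<lambda>p. g p * k p * chr m n p) + d * mean (\<lambda>p. g p * l p * chr m n p)" for m n
      using that g unfolding X_def
      by (subst mean_add, (intro continuous_intros continuous_chr; simp)+,
        subst (1 2) mean_cmult) (auto intro!: continuous_intros continuous_chr)
    finally show ?thesis using that unfolding X_def by (auto intro!: continuous_intros)
  qed
  have Xchr: "X (\<lambda>p. chr a b p * k p)" if "X k" for k a b
  proof -
    have "(\<lambda>p. g p * (chr a b p * k p) * chr m n p) = (\<lambda>p. g p * k p * chr (a + m) (b + n) p)" for m n
      by (simp add: fun_eq_iff chr_mult[symmetric] mult_ac)
    then show ?thesis using that unfolding X_def by (auto intro!: continuous_intros continuous_chr)
  qed
  have XRe: "X (\<lambda>p. of_real (Re (chr a b p)) * k p)" and XIm: "X (\<lambda>p. of_real (Im (chr a b p)) * k p)" if "X k" for k a b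
  proof -
    have r: "of_real (Re (chr a b p)) = (chr a b p + chr (- a) (- b) p) / 2"
      "of_real (Im (chr a b p)) = (chr a b p - chr (- a) (- b) p) / (2 * \<i>)" for p
      unfolding cnj_chr[symmetric] by (auto simp: complex_eq_iff)
    have "(\<lambda>p. of_real (Re (chr a b p)) * k p) = (\<lambda>p. (1 / 2) * (chr a b p * k p) + (1 / 2) * (chr (- a) (- b) p * k p))"
      "(\<lambda>p. of_real (Im (chr a b p)) * k p) = (\<lambda>p. (1 / (2 * \<i>)) * (chr a b p * k p) + (- 1 / (2 * \<i>)) * (chr (- a) (- b) p * k p))"
      by (rule ext, subst r, simp add: field_simps)+
    then show "X (\<lambda>p. of_real (Re (chr a b p)) * k p)" "X (\<lambda>p. of_real (Im (chr a b p)) * k p)"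
      by (simp_all only: Xadd Xchr that)
  qed
  have Xpoly: "\<forall>k. X k \<longrightarrow> X (\<lambda>p. of_real (q (circ p)) * k p)" if "real_polynomial_function q" for q
    using that
  proof induction
    case (linear q)
    show ?case
    proof (intro allI impI)
      fix k assume k: "X k"
      have "q (z, w) = Re z * q (1, 0) + Im z * q (\<i>, 0) + Re w * q (0, 1) + Im w * q (0, \<i>)" for z w
      proof -
        note lin = bounded_linear.linear[OF linear]
        have eq: "(z, w) = Re z *\<^sub>R (1, 0) + Im z *\<^sub>R (\<i>, 0) + Re w *\<^sub>R (0, 1) + Im w *\<^sub>R (0, \<i>)"
          by (auto simp: complex_eq_iff)
        show ?thesis by (subst eq) (simp only: linear_add[OF lin] linear_cmul[OF lin] real_scaleR_def)
      qed
      from this[of "chr 1 0 p" "chr 0 1 p" for p] have "(\<lambda>p. of_real (q (circ p)) * k p) =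
        (\<lambda>p. 1 * (of_real (q (1, 0)) * (of_real (Re (chr 1 0 p)) * k p) + of_real (q (\<i>, 0)) * (of_real (Im (chr 1 0 p)) * k p)) +
          1 * (of_real (q (0, 1)) * (of_real (Re (chr 0 1 p)) * k p) + of_real (q (0, \<i>)) * (of_real (Im (chr 0 1 p)) * k p)))"
        by (simp add: circ_def fun_eq_iff algebra_simps)
      then show "X (\<lambda>p. of_real (q (circ p)) * k p)" by (simp only: Xadd XRe XIm k)
    qed
  next
    case (const c)
    show ?case using Xadd[of _ _ "of_real c" 0] by simp
  next
    case (add q r)
    show ?case
    proof (intro allI impI)
      fix k assume "X k"
      then show "X (\<lambda>p. of_real (q (circ p) + r (circ p)) * k p)"
        using Xadd[of "\<lambda>p. of_real (q (circ p)) * k p" "\<lambda>p. of_real (r (circ p)) * k p" 1 1] add.IH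
        by (simp add: distrib_right)
    qed
  next
    case (mult q r)
    then show ?case by (simp add: mult.assoc)
  qed
  obtain C where C: "C \<ge> 0" "\<And>p. norm (g p) \<le> C" using on_torus_bounded[OF g] by blast
  have orth: "mean (\<lambda>p. g p * of_real (f p)) = 0"
    if f: "continuous_on UNIV f" "on_torus \<omega>1 \<omega>2 f" for f
  proof (rule ccontr)
    assume "mean (\<lambda>p. g p * of_real (f p)) \<noteq> 0" (is "?m \<noteq> 0")
    define e where "e = norm ?m / (C + 1)"
    have "e > 0" using \<open>?m \<noteq> 0\<close> C by (simp add: e_def)
    then obtain q where q: "real_polynomial_function q" "\<And>p. \<bar>f p - q (circ p)\<bar> < e"
      using torus_Stone_Weierstrass[OF f] by blast
    have Xq: "X (\<lambda>p. of_real (q (circ p)))" using Xpoly[OF q(1)] X1 by force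
    then have cq: "continuous_on UNIV (\<lambda>p. complex_of_real (q (circ p)))" by (simp add: X_def)
    have "mean (\<lambda>p. g p * of_real (q (circ p))) = 0"
      using Xq[unfolded X_def, THEN conjunct2, rule_format, of 0 0] by simp
    then have "?m = mean (\<lambda>p. g p * of_real (f p) - g p * of_real (q (circ p)))"
      by (subst mean_diff) (auto intro!: continuous_intros g f cq)
    also have "norm \<dots> \<le> C * e"
    proof (rule mean_bound)
      show "continuous_on UNIV (\<lambda>p. g p * of_real (f p) - g p * of_real (q (circ p)))"
        by (intro continuous_intros g f cq)
      fix p
      have "norm (g p * of_real (f p) - g p * of_real (q (circ p))) = norm (g p) * \<bar>f p - q (circ p)\<bar>"
        by (simp add: norm_mult right_diff_distrib[symmetric] of_real_diff[symmetric] del: of_real_diff)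
      also have "\<dots> \<le> C * e" using C q(2)[of p] by (intro mult_mono) auto
      finally show "norm (g p * of_real (f p) - g p * of_real (q (circ p))) \<le> C * e" .
    qed
    also have "C * e < norm ?m"
    proof -
      have "norm ?m = (C + 1) * e" using C by (simp add: e_def)
      then show ?thesis using \<open>e > 0\<close> by (simp add: algebra_simps)
    qed
    finally show False by simp
  qed
  have sq0: "f q = 0" if f: "continuous_on UNIV f" "on_torus \<omega>1 \<omega>2 f" and m: "mean (\<lambda>p. f p * f p) = 0"
    and q: "q \<in> Tor ` unit_square" for f :: "complex \<Rightarrow> real" and q
  proof -
    obtain x where x: "q = Tor x" "x \<in> unit_square" using q by blast
    have c: "continuous_on UNIV (\<lambda>p. f p * f p)" by (intro continuous_intros f)
    have "f (Tor x) * f (Tor x) = 0"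
    proof (rule has_integral_0_cbox_imp_0[of "(0, 0)" "(1, 1)" "\<lambda>x. f (Tor x) * f (Tor x)"])
      show "((\<lambda>x. f (Tor x) * f (Tor x)) has_integral 0) unit_square"
        using integrable_integral[OF integrable_Tor[OF c]] m by (simp add: mean_def)
      show "box (0, 0) (1, 1) \<noteq> ({} :: (real \<times> real) set)"
        by (auto simp: box_ne_empty Basis_prod_def)
    qed (use x continuous_on_Tor[OF c] in auto)
    then show ?thesis using x by simp
  qed
  obtain q where q: "q \<in> Tor ` unit_square" "g p = g q" using on_torus_square[OF g(2)] by blast
  have cont: "continuous_on UNIV (\<lambda>p. Re (g p))" "continuous_on UNIV (\<lambda>p. Im (g p))"
    by (intro continuous_intros g)+
  have per: "on_torus \<omega>1 \<omega>2 (\<lambda>p. Re (g p))" "on_torus \<omega>1 \<omega>2 (\<lambda>p. Im (g p))"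
    using g(2) by (simp_all add: on_torus_def)
  have "continuous_on UNIV (\<lambda>p. g p * of_real (Re (g p)))" "continuous_on UNIV (\<lambda>p. g p * of_real (Im (g p)))"
    by (intro continuous_intros g)+
  then have "mean (\<lambda>p. Re (g p * of_real (Re (g p)))) = 0" "mean (\<lambda>p. Im (g p * of_real (Im (g p)))) = 0"
    using orth[OF cont(1) per(1)] orth[OF cont(2) per(2)]
    by (simp_all only: mean_linear[OF bounded_linear_Re] mean_linear[OF bounded_linear_Im]) simp_all
  then have "Re (g q) = 0" "Im (g q) = 0"
    using sq0[OF cont(1) per(1) _ q(1)] sq0[OF cont(2) per(2) _ q(1)] by simp_all
  then show ?thesis using q by (simp add: complex_eq_iff)
qed

section \<open>Rapidly convergent Fourier series\<close>

text \<open>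
  An enumeration of the characters turns double series into ordinary ones. A coefficient sequence
  decays rapidly if it is dominated by all powers of the summable weight \<open>wgt\<close>; the frequencies grow at most
  like its reciprocal, so that rapid decay survives termwise differentiation.
\<close>

definition idx :: "nat \<Rightarrow> int \<times> int" where
  "idx k = map_prod int_decode int_decode (prod_decode k)"

definition wgt :: "nat \<Rightarrow> real" where
  "wgt k = 1 / ((1 + (of_int (fst (idx k)))\<^sup>2) * (1 + (of_int (snd (idx k)))\<^sup>2))"

definition fr :: "nat \<Rightarrow> complex \<Rightarrow> complex" where "fr k = frq (fst (idx k)) (snd (idx k))"
definition ch :: "nat \<Rightarrow> complex \<Rightarrow> complex" where "ch k = chr (fst (idx k)) (snd (idx k))"

lemma idx_surj: obtains k where "idx k = (m, n)"
proof
  show "idx (prod_encode (int_encode m, int_encode n)) = (m, n)" by (simp add: idx_def)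
qed

lemma idx_inj: "idx k = idx l \<longleftrightarrow> k = l"
  unfolding idx_def
  by (metis inj_eq inj_int_decode inj_prod_decode prod.inj_map_strong injD prod.inj_map)

lemma wgt_pos: "0 < wgt k"
  unfolding wgt_def by (intro divide_pos_pos mult_pos_pos add_pos_nonneg) auto

lemma summable_wgt: "summable wgt"
proof -
  define u where "u a = 1 / (1 + (of_int (int_decode a) :: real)\<^sup>2)" for a
  have upos: "0 < u a" for a by (simp add: u_def add_pos_nonneg)
  have u0: "0 \<le> u a" for a by (simp add: upos less_imp_le)
  have ule: "u a \<le> 8 * inverse (of_nat (Suc a) ^ 2)" for a
  proof -
    have "int a \<le> 2 * \<bar>int_decode a\<bar>"
      by (cases "even a") (auto simp: int_decode_def sum_decode_def elim!: evenE oddE)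
    then have "real a \<le> 2 * \<bar>of_int (int_decode a)\<bar>" by linarith
    then have "(real a)\<^sup>2 \<le> (2 * \<bar>of_int (int_decode a)\<bar>)\<^sup>2" by (rule power_mono) simp
    then have "(real a)\<^sup>2 \<le> 4 * (of_int (int_decode a))\<^sup>2" by (simp add: power_mult_distrib)
    moreover have "(real (Suc a))\<^sup>2 \<le> 2 + 2 * (real a)\<^sup>2"
      using zero_le_power2[of "real a - 1"] by (simp add: power2_eq_square algebra_simps)
    ultimately have "(real (Suc a))\<^sup>2 \<le> 2 + 2 * (4 * (of_int (int_decode a))\<^sup>2)"
      by (meson add_left_mono mult_left_mono order_trans zero_le_numeral)
    then have "(real (Suc a))\<^sup>2 \<le> 8 * (1 + (of_int (int_decode a))\<^sup>2)" by (simp del: of_nat_Suc)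
    then show ?thesis by (simp add: u_def field_simps add_pos_nonneg)
  qed
  have "summable (\<lambda>a. inverse (of_nat (Suc a) ^ 2 :: real))"
    using inverse_power_summable[of 2, where 'a = real] by (subst summable_Suc_iff) simp
  then have su: "summable u"
    by (rule summable_comparison_test'[OF summable_mult[of _ 8], of _ 0])
      (use ule upos in \<open>auto simp: less_imp_le\<close>)
  have w: "wgt k = u (fst (prod_decode k)) * u (snd (prod_decode k))" for k
    by (simp add: wgt_def u_def idx_def)
  show ?thesis
  proof (rule summableI_nonneg_bounded)
    fix N
    have "(\<Sum>k<N. wgt k) = (\<Sum>x\<in>prod_decode ` {..<N}. u (fst x) * u (snd x))"
      by (subst sum.reindex) (auto simp: w inj_prod_decode)
    also have "\<dots> \<le> (\<Sum>x\<in>{..<N} \<times> {..<N}. u (fst x) * u (snd x))"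
    proof (rule sum_mono2)
      show "prod_decode ` {..<N} \<subseteq> {..<N} \<times> {..<N}"
      proof
        fix x assume "x \<in> prod_decode ` {..<N}"
        then have "prod_encode x < N" by auto
        then show "x \<in> {..<N} \<times> {..<N}"
          using le_prod_encode_1[of "fst x" "snd x"] le_prod_encode_2[of "snd x" "fst x"] by (cases x) auto
      qed
    qed (auto intro: mult_nonneg_nonneg less_imp_le upos)
    also have "\<dots> = (\<Sum>a<N. u a) * (\<Sum>b<N. u b)"
      by (simp add: sum_product sum.cartesian_product split_beta)
    also have "\<dots> \<le> suminf u * suminf u"
      by (intro mult_mono sum_le_suminf su) (auto intro!: sum_nonneg suminf_nonneg su u0)
    finally show "(\<Sum>k<N. wgt k) \<le> suminf u * suminf u" .
  qed (simp add: less_imp_le wgt_pos)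
qed

definition rapid :: "(nat \<Rightarrow> complex) \<Rightarrow> bool" where
  "rapid c \<longleftrightarrow> (\<forall>j. \<exists>C. \<forall>k. norm (c k) \<le> C * wgt k ^ j)"

definition fseries :: "(nat \<Rightarrow> complex) \<Rightarrow> complex \<Rightarrow> complex" where
  "fseries c p = (\<Sum>k. c k * ch k p)"

lemma rapidE:
  assumes "rapid c"
  obtains C where "C \<ge> 0" "\<And>k. norm (c k) \<le> C * wgt k ^ j"
proof -
  obtain C where C: "\<And>k. norm (c k) \<le> C * wgt k ^ j" using assms unfolding rapid_def by blast
  have "0 \<le> C * wgt 0 ^ j" using C[of 0] norm_ge_zero order_trans by blast
  then have "C \<ge> 0" using zero_less_power[OF wgt_pos[of 0], of j] by (auto simp: zero_le_mult_iff)
  then show ?thesis using that C by blast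
qed

lemma fr_bound: obtains K where "K \<ge> 0" "\<And>k v. norm (fr k v) * wgt k \<le> K * norm v"
proof -
  obtain KA KB where K: "\<And>v. norm (A v) \<le> norm v * KA" "\<And>v. norm (B v) \<le> norm v * KB" "KA > 0" "KB > 0"
    using bounded_linear.pos_bounded[OF bounded_linear_AB(1)] bounded_linear.pos_bounded[OF bounded_linear_AB(2)] by blast
  have "norm (fr k v) * wgt k \<le> (2 * pi * (KA + KB)) * norm v" for k v
  proof -
    obtain m n where mn: "idx k = (m, n)" by (cases "idx k")
    have le: "\<bar>x\<bar> \<le> 1 + x\<^sup>2" for x :: real
      using zero_le_power2[of "\<bar>x\<bar> - 1"] by (simp add: power2_eq_square algebra_simps abs_mult_self_eq)
    have le1: "\<bar>x\<bar> \<le> (1 + x\<^sup>2) * (1 + y\<^sup>2)" "\<bar>y\<bar> \<le> (1 + x\<^sup>2) * (1 + y\<^sup>2)" for x y :: real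
      using mult_mono[OF le[of x], of 1 "1 + y\<^sup>2"] mult_mono[OF _ le[of y], of 1 "1 + x\<^sup>2"] by simp_all
    let ?W = "(1 + (of_int m)\<^sup>2) * (1 + (of_int n :: real)\<^sup>2)"
    have W: "?W > 0" by (intro mult_pos_pos add_pos_nonneg) auto
    have "norm (fr k v) = 2 * pi * \<bar>of_int m * A v + of_int n * B v\<bar>"
      by (simp only: fr_def frq_def mn fst_conv snd_conv norm_mult norm_of_real norm_ii) (simp add: abs_mult)
    also have "\<dots> \<le> 2 * pi * (\<bar>of_int m\<bar> * \<bar>A v\<bar> + \<bar>of_int n\<bar> * \<bar>B v\<bar>)"
      by (intro mult_left_mono order_trans[OF abs_triangle_ineq]) (simp_all add: abs_mult)
    also have "\<dots> \<le> 2 * pi * (?W * (norm v * KA) + ?W * (norm v * KB))"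
      using K(1)[of v] K(2)[of v] by (intro mult_left_mono add_mono mult_mono le1) (use W in auto)
    finally have "norm (fr k v) \<le> (2 * pi * (KA + KB)) * norm v * ?W" by (simp add: algebra_simps)
    then show ?thesis using W by (simp add: wgt_def mn pos_divide_le_eq)
  qed
  then show ?thesis using that[of "2 * pi * (KA + KB)"] K by simp
qed

lemma rapid_fr: assumes "rapid c" shows "rapid (\<lambda>k. fr k v * c k)"
  unfolding rapid_def
proof
  fix j
  obtain K where K: "K \<ge> 0" "\<And>k v. norm (fr k v) * wgt k \<le> K * norm v" using fr_bound by blast
  obtain C where C: "C \<ge> 0" "\<And>k. norm (c k) \<le> C * wgt k ^ Suc j" using rapidE[OF assms] by blast
  have "norm (fr k v * c k) \<le> (K * norm v * C) * wgt k ^ j" for k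
  proof -
    have "norm (fr k v * c k) \<le> norm (fr k v) * (C * wgt k ^ Suc j)"
      unfolding norm_mult by (intro mult_left_mono C) simp
    also have "\<dots> = (norm (fr k v) * wgt k) * (C * wgt k ^ j)" by simp
    also have "\<dots> \<le> (K * norm v) * (C * wgt k ^ j)"
      by (intro mult_right_mono K) (use C wgt_pos[of k] in simp)
    finally show ?thesis by simp
  qed
  then show "\<exists>C. \<forall>k. norm (fr k v * c k) \<le> C * wgt k ^ j" by blast
qed

lemma rapid_summable: assumes "rapid c" shows "summable (\<lambda>k. norm (c k))"
proof -
  obtain C where C: "\<And>k. norm (c k) \<le> C * wgt k ^ 1" using rapidE[OF assms] by blast
  then show ?thesis
    by (intro summable_comparison_test'[OF summable_mult[OF summable_wgt, of C], of 0]) simp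
qed

lemma norm_ch [simp]: "norm (ch k p) = 1" by (simp add: ch_def)

lemma summable_fseries: assumes "rapid c" shows "summable (\<lambda>k. c k * ch k p)"
  by (rule summable_norm_cancel) (use rapid_summable[OF assms] in \<open>simp add: norm_mult\<close>)

lemma fseries_tail:
  assumes "rapid c"
  shows "norm (fseries c p - (\<Sum>i<n. c i * ch i p)) \<le> (\<Sum>i. norm (c (i + n)))"
proof -
  have "fseries c p - (\<Sum>i<n. c i * ch i p) = (\<Sum>i. c (i + n) * ch (i + n) p)"
    unfolding fseries_def using suminf_minus_initial_segment[OF summable_fseries[OF assms]] by metis
  also have "norm \<dots> \<le> (\<Sum>i. norm (c (i + n) * ch (i + n) p))"
    by (rule summable_norm)
      (use summable_ignore_initial_segment[OF rapid_summable[OF assms]] in \<open>simp add: norm_mult\<close>)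
  finally show ?thesis by (simp add: norm_mult)
qed

lemma fseries_deriv:
  assumes c: "rapid c"
  shows "(fseries c has_derivative (\<lambda>v. fseries (\<lambda>k. fr k v * c k) p)) (at p)"
proof -
  obtain K where K: "K \<ge> 0" "\<And>k v. norm (fr k v) * wgt k \<le> K * norm v" using fr_bound by blast
  obtain C where C: "C \<ge> 0" "\<And>k. norm (c k) \<le> C * wgt k ^ 2" using rapidE[OF c] by blast
  have bd: "norm (fr k v * c k) \<le> (K * C * wgt k) * norm v" for k v
  proof -
    have "norm (fr k v * c k) \<le> norm (fr k v) * (C * wgt k ^ 2)"
      unfolding norm_mult by (intro mult_left_mono C) simp
    also have "\<dots> = (norm (fr k v) * wgt k) * (C * wgt k)" by (simp add: power2_eq_square)
    also have "\<dots> \<le> (K * norm v) * (C * wgt k)"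
      by (intro mult_right_mono K) (use C wgt_pos[of k] in simp)
    finally show ?thesis by (simp add: mult_ac)
  qed
  have sb: "summable (\<lambda>k. K * C * wgt k)" by (rule summable_mult[OF summable_wgt])
  have "\<exists>g. \<forall>x\<in>UNIV. (\<lambda>n. c n * ch n x) sums g x \<and> (g has_derivative (\<lambda>v. fseries (\<lambda>k. fr k v * c k) x)) (at x within UNIV)"
  proof (rule has_derivative_series)
    show "((\<lambda>x. c n * ch n x) has_derivative (\<lambda>v. (fr n v * c n) * ch n x)) (at x within UNIV)" for n x
      using has_derivative_mult_right[OF chr_deriv, of "c n" "fst (idx n)" "snd (idx n)" x]
      by (simp add: ch_def[abs_def] fr_def mult_ac)
    show "(\<lambda>n. c n * ch n 0) sums fseries c 0"
      unfolding fseries_def by (rule summable_sums[OF summable_fseries[OF c]])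
    show "\<forall>\<^sub>F n in sequentially. \<forall>x\<in>UNIV. \<forall>h.
      norm ((\<Sum>i<n. fr i h * c i * ch i x) - fseries (\<lambda>k. fr k h * c k) x) \<le> e * norm h" if "e > 0" for e
    proof -
      obtain N where N: "\<And>n. n \<ge> N \<Longrightarrow> norm (\<Sum>i. K * C * wgt (i + n)) < e"
        using suminf_exist_split[OF \<open>e > 0\<close> sb] by blast
      have "norm ((\<Sum>i<n. fr i h * c i * ch i x) - fseries (\<lambda>k. fr k h * c k) x) \<le> e * norm h"
        if "n \<ge> N" for n x h
      proof -
        have "norm ((\<Sum>i<n. fr i h * c i * ch i x) - fseries (\<lambda>k. fr k h * c k) x) \<le>
            (\<Sum>i. norm (fr (i + n) h * c (i + n)))"
          using fseries_tail[OF rapid_fr[OF c]] by (subst norm_minus_commute) blast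
        also have "\<dots> \<le> (\<Sum>i. (K * C * wgt (i + n)) * norm h)"
          by (intro suminf_le bd summable_ignore_initial_segment[OF rapid_summable[OF rapid_fr[OF c]]]
              summable_mult2 summable_ignore_initial_segment[OF sb])
        also have "\<dots> = (\<Sum>i. K * C * wgt (i + n)) * norm h"
          by (rule suminf_mult2[symmetric, OF summable_ignore_initial_segment[OF sb]])
        also have "\<dots> \<le> e * norm h"
          using N[OF that] by (intro mult_right_mono) auto
        finally show ?thesis .
      qed
      then show ?thesis unfolding eventually_sequentially by blast
    qed
  qed auto
  then obtain g where g: "\<And>x. (\<lambda>n. c n * ch n x) sums g x"
    "\<And>x. (g has_derivative (\<lambda>v. fseries (\<lambda>k. fr k v * c k) x)) (at x)" by auto
  have "g = fseries c" using g(1) by (auto simp: fun_eq_iff fseries_def sums_iff)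
  then show ?thesis using g(2) by simp
qed

text \<open>
  Differentiation in direction \<open>v\<close> only replaces the coefficients \<open>c k\<close> by \<open>fr k v * c k\<close>.
\<close>

lemma per_fseries: assumes "rapid c" shows "per (fseries c)"
proof (rule perI)
  show "smooth_on UNIV (fseries c)"
  proof (rule smooth_on_coinduct[where \<Phi> = "\<lambda>f. \<exists>c. rapid c \<and> f = fseries c"])
    fix f assume "\<exists>c. rapid c \<and> f = fseries c"
    then obtain c where c: "rapid c" "f = fseries c" by blast
    show "f differentiable at p" for p using fseries_deriv[OF c(1)] c(2) differentiable_def by blast
    show "\<exists>g. (\<exists>c. rapid c \<and> g = fseries c) \<and> (\<forall>x\<in>UNIV. dir v f x = g x)" for v
      using dirI[OF fseries_deriv[OF c(1)]] rapid_fr[OF c(1)] c(2) by blast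
  qed (use assms in auto)
  show "on_torus \<omega>1 \<omega>2 (fseries c)"
    using per_on_torus[OF per_chr] by (simp add: on_torus_def fseries_def ch_def)
qed

lemma continuous_ch: "continuous_on UNIV (ch k)"
  unfolding ch_def by (rule continuous_chr)

text \<open>
  Coefficients depend continuously on the sup norm, and those of the partial sums are explicit.
\<close>

lemma fcoeff_fseries:
  assumes c: "rapid c"
  shows "fcoeff (fseries c) (fst (idx k)) (snd (idx k)) = c k"
proof -
  define m n where "m = fst (idx k)" and "n = snd (idx k)"
  have ch_chr: "mean (\<lambda>p. ch i p * chr (- m) (- n) p) = (if i = k then 1 else 0)" for i
  proof -
    have "fst (idx i) = m \<and> snd (idx i) = n \<longleftrightarrow> i = k"
      unfolding m_def n_def using idx_inj[of i k] by (auto simp: prod_eq_iff)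
    then show ?thesis by (simp add: ch_def chr_mult mean_chr)
  qed
  have "norm (fcoeff (fseries c) m n - c k) \<le> (\<Sum>i. norm (c (i + N)))" if N: "N > k" for N
  proof -
    let ?s = "\<lambda>p. \<Sum>i<N. c i * ch i p"
    have cont: "continuous_on UNIV (fseries c)" "continuous_on UNIV ?s"
      by (rule per_continuous[OF per_fseries[OF c]]) (intro continuous_intros continuous_ch)
    have "fcoeff ?s m n = (\<Sum>i<N. mean (\<lambda>p. c i * (ch i p * chr (- m) (- n) p)))"
      unfolding fcoeff_def sum_distrib_right mult.assoc
      by (rule mean_sum) (auto intro!: continuous_intros continuous_ch continuous_chr)
    also have "\<dots> = (\<Sum>i<N. c i * (if i = k then 1 else 0))"
      by (intro sum.cong refl, subst mean_cmult)
        (auto intro!: continuous_intros continuous_ch continuous_chr simp: ch_chr)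
    also have "\<dots> = c k" using N by (simp add: if_distrib cong: if_cong)
    finally have "fcoeff (fseries c) m n - c k = fcoeff (\<lambda>p. fseries c p - ?s p) m n"
      using fcoeff_diff[OF cont] by simp
    also have "norm \<dots> \<le> (\<Sum>i. norm (c (i + N)))"
      unfolding fcoeff_def
      by (rule mean_bound) (use fseries_tail[OF c] in \<open>auto intro!: continuous_intros cont continuous_chr simp: norm_mult\<close>)
    finally show ?thesis .
  qed
  then have bound: "norm (fcoeff (fseries c) m n - c k) \<le> (\<Sum>i. norm (c (i + N)))" if "N > k" for N
    using that by blast
  have "norm (fcoeff (fseries c) m n - c k) \<le> 0 + e" if "e > 0" for e
  proof -
    obtain N where N: "\<And>n. n \<ge> N \<Longrightarrow> norm (\<Sum>i. norm (c (i + n))) < e"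
      using suminf_exist_split[OF \<open>e > 0\<close> rapid_summable[OF c]] by blast
    show ?thesis
      using bound[of "max N (Suc k)"] N[of "max N (Suc k)"] by (simp add: less_max_iff_disj)
  qed
  then have "norm (fcoeff (fseries c) m n - c k) \<le> 0" by (rule field_le_epsilon)
  then show ?thesis by (simp add: m_def n_def)
qed

text \<open>
  Integration by parts: the operators \<open>1 - \<partial>\<^sup>2 / (4 \<pi>\<^sup>2)\<close> along the two periods multiply the
  coefficients by \<open>1 + m\<^sup>2\<close> and \<open>1 + n\<^sup>2\<close>, and the coefficients of a periodic function are bounded.
\<close>

lemma rapid_fcoeff:
  assumes "per g"
  shows "rapid (\<lambda>k. fcoeff g (fst (idx k)) (snd (idx k)))"
proof -
  have "\<exists>C. \<forall>k. norm (fcoeff g (fst (idx k)) (snd (idx k))) \<le> C * wgt k ^ j" for j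
    using assms
  proof (induction j arbitrary: g)
    case 0
    obtain C where "\<And>p. norm (g p) \<le> C" using on_torus_bounded per_continuous per_on_torus 0 by metis
    then have "norm (fcoeff g m n) \<le> C" for m n
      unfolding fcoeff_def
      by (intro mean_bound) (auto intro!: continuous_intros per_continuous[OF 0] continuous_chr simp: norm_mult)
    then show ?case by auto
  next
    case (Suc j)
    \<comment> \<open>The constant is chosen such that \<open>(2 \<pi> \<i> m)\<^sup>2\<close> becomes \<open>- m\<^sup>2\<close>.\<close>
    define Q where "Q w g p = g p - of_real (1 / (4 * pi\<^sup>2)) * dir w (dir w g) p" for w and g :: "complex \<Rightarrow> complex" and p
    have perQ: "per (Q w g)" if "per g" for w g
      unfolding Q_def by (intro per_diff per_mult per_const per_dir that)
    have fcQ: "fcoeff (Q w g) m n = (1 - of_real (1 / (4 * pi\<^sup>2)) * (frq m n w)\<^sup>2) * fcoeff g m n" if "per g" for w g m n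
    proof -
      have 1: "continuous_on UNIV (dir w (dir w g))" by (intro per_continuous per_dir that)
      have "fcoeff (Q w g) m n = fcoeff g m n - of_real (1 / (4 * pi\<^sup>2)) * fcoeff (dir w (dir w g)) m n"
        unfolding Q_def fcoeff_cmult[OF 1, symmetric]
        by (rule fcoeff_diff) (intro continuous_intros 1 per_continuous[OF that])+
      then show ?thesis
        by (simp only: fcoeff_dir that per_dir) (simp add: power2_eq_square algebra_simps)
    qed
    have f1: "1 - of_real (1 / (4 * pi\<^sup>2)) * (frq m n \<omega>1)\<^sup>2 = of_real (1 + (of_int m)\<^sup>2)"
      "1 - of_real (1 / (4 * pi\<^sup>2)) * (frq m n \<omega>2)\<^sup>2 = of_real (1 + (of_int n)\<^sup>2)" for m n
      by (simp_all add: frq_omega power_mult_distrib)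
    obtain C where C: "\<And>k. norm (fcoeff (Q \<omega>1 (Q \<omega>2 g)) (fst (idx k)) (snd (idx k))) \<le> C * wgt k ^ j"
      using Suc.IH[OF perQ[OF perQ[OF Suc.prems]]] by blast
    have "norm (fcoeff g (fst (idx k)) (snd (idx k))) \<le> C * wgt k ^ Suc j" for k
    proof -
      have "fcoeff (Q \<omega>1 (Q \<omega>2 g)) (fst (idx k)) (snd (idx k)) =
          of_real (1 / wgt k) * fcoeff g (fst (idx k)) (snd (idx k))"
        by (simp only: fcQ perQ Suc.prems f1 wgt_def) simp
      then have "(1 / wgt k) * norm (fcoeff g (fst (idx k)) (snd (idx k))) \<le> C * wgt k ^ j"
        using C[of k] wgt_pos[of k] by (simp add: norm_divide)
      then show ?thesis using wgt_pos[of k] by (simp add: field_simps)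
    qed
    then show ?case by blast
  qed
  then show ?thesis by (simp add: rapid_def)
qed

section \<open>The inhomogeneous Cauchy--Riemann equation\<close>

definition symb :: "int \<Rightarrow> int \<Rightarrow> complex" where
  "symb m n = (frq m n 1 - \<i> * frq m n \<i>) / 2"

lemma fcoeff_dz: assumes "per g" shows "fcoeff (dz g) m n = symb m n * fcoeff g m n"
proof -
  have c: "continuous_on UNIV (dir v g)" for v by (intro per_continuous per_dir assms)
  have "dz g = (\<lambda>p. (1 / 2) * dir 1 g p - (\<i> / 2) * dir \<i> g p)"
    by (auto simp: fun_eq_iff dz_dir field_simps)
  then have "fcoeff (dz g) m n = (1 / 2) * fcoeff (dir 1 g) m n - (\<i> / 2) * fcoeff (dir \<i> g) m n"
    by (simp only: fcoeff_diff fcoeff_cmult c continuous_intros)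
  then show ?thesis by (simp add: fcoeff_dir[OF assms] symb_def field_simps)
qed

text \<open>
  The symbol of \<open>\<partial>\<^sub>z\<close> determines the real covector \<open>frq m n / \<i>\<close>, which takes the values
  \<open>2\<pi>m\<close> and \<open>2\<pi>n\<close> on the periods; so it is bounded away from 0 unless both vanish.
\<close>

lemma symb_bound:
  obtains \<delta> where "\<delta> > 0" "\<And>m n. (m, n) \<noteq> (0, 0) \<Longrightarrow> norm (symb m n) \<ge> \<delta>"
proof -
  have le: "\<bar>Im (frq m n v)\<bar> \<le> 2 * norm v * norm (symb m n)" for m n v
  proof -
    have lin: "frq m n v = Re v *\<^sub>R frq m n 1 + Im v *\<^sub>R frq m n \<i>"
    proof -
      note lin = bounded_linear.linear[OF bounded_linear_frq]
      have "frq m n (Re v *\<^sub>R 1 + Im v *\<^sub>R \<i>) = Re v *\<^sub>R frq m n 1 + Im v *\<^sub>R frq m n \<i>"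
        by (simp only: linear_add[OF lin] linear_cmul[OF lin])
      moreover have "Re v *\<^sub>R 1 + Im v *\<^sub>R \<i> = v" by (simp add: complex_eq_iff)
      ultimately show ?thesis by simp
    qed
    have re0: "Re (frq m n w) = 0" for w by (simp add: frq_def)
    have "Im (frq m n v) = Im (2 * (v * symb m n))"
      unfolding lin symb_def using re0[of 1] re0[of \<i>] by (simp add: field_simps)
    also have "\<bar>\<dots>\<bar> \<le> norm (2 * (v * symb m n))" by (rule abs_Im_le_cmod)
    finally show ?thesis by (simp add: norm_mult)
  qed
  have pos: "norm \<omega>1 > 0" "norm \<omega>2 > 0" using indep by auto
  define \<delta> where "\<delta> = pi / (norm \<omega>1 + norm \<omega>2)"
  have "norm (symb m n) \<ge> \<delta>" if "(m, n) \<noteq> (0, 0)" for m n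
  proof -
    have key: "\<delta> \<le> norm (symb m n)"
      if "1 \<le> \<bar>of_int i :: real\<bar>" "2 * pi * \<bar>of_int i\<bar> \<le> 2 * norm w * norm (symb m n)" "norm w \<le> norm \<omega>1 + norm \<omega>2" for i :: int and w
    proof -
      have "pi * 1 \<le> pi * \<bar>of_int i\<bar>" by (intro mult_left_mono that) simp
      also have "\<dots> \<le> norm w * norm (symb m n)" using that(2) by simp
      also have "\<dots> \<le> (norm \<omega>1 + norm \<omega>2) * norm (symb m n)" by (intro mult_right_mono that) simp
      finally show ?thesis using add_pos_pos[OF pos] by (simp add: \<delta>_def pos_divide_le_eq mult.commute)
    qed
    from that consider "m \<noteq> 0" | "n \<noteq> 0" by auto
    then show ?thesis
    proof cases
      case 1
      then show ?thesis using key[of m \<omega>1] le[of m n \<omega>1] by (simp add: frq_omega abs_mult)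
    next
      case 2
      then show ?thesis using key[of n \<omega>2] le[of m n \<omega>2] by (simp add: frq_omega abs_mult)
    qed
  qed
  moreover have "\<delta> > 0" using pos by (simp add: \<delta>_def add_pos_pos)
  ultimately show ?thesis using that by blast
qed

text \<open>
  Dividing the coefficients of \<open>g\<close> by the symbol keeps their rapid decay. The quotient at the
  constant character is \<open>0 / 0 = 0\<close>, which is harmless as \<open>g\<close> has mean 0.
\<close>

theorem dz_solvable:
  assumes g: "per g" and 0: "mean g = 0"
  obtains u where "per u" "\<And>p. dz u p = g p"
proof -
  obtain \<delta> where \<delta>: "\<delta> > 0" "\<And>m n. (m, n) \<noteq> (0, 0) \<Longrightarrow> norm (symb m n) \<ge> \<delta>" using symb_bound by blast
  define G where "G k = fcoeff g (fst (idx k)) (snd (idx k))" for k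
  define S where "S k = symb (fst (idx k)) (snd (idx k))" for k
  have G: "rapid G" unfolding G_def by (rule rapid_fcoeff[OF g])
  have G0: "G k = 0" if "idx k = (0, 0)" for k
    using 0 that by (simp add: G_def fcoeff_def)
  have le: "norm (G k / S k) \<le> norm (G k) / \<delta>" for k
  proof (cases "idx k = (0, 0)")
    case False
    then have "norm (S k) \<ge> \<delta>" unfolding S_def by (intro \<delta>(2)) (auto simp: prod_eq_iff)
    then show ?thesis using \<delta>(1) by (simp add: norm_divide frac_le)
  qed (simp add: G0)
  have c: "rapid (\<lambda>k. G k / S k)"
    unfolding rapid_def
  proof
    fix j
    obtain C where C: "\<And>k. norm (G k) \<le> C * wgt k ^ j" using rapidE[OF G] by blast
    have "norm (G k / S k) \<le> (C / \<delta>) * wgt k ^ j" for k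
      using order_trans[OF le[of k] divide_right_mono[OF C[of k] less_imp_le[OF \<delta>(1)]]] by simp
    then show "\<exists>C. \<forall>k. norm (G k / S k) \<le> C * wgt k ^ j" by blast
  qed
  define u where "u = fseries (\<lambda>k. G k / S k)"
  have u: "per u" unfolding u_def by (rule per_fseries[OF c])
  have "dz u p - g p = 0" for p
  proof (rule fcoeff_eq_0_imp[of "\<lambda>p. dz u p - g p"])
    show "continuous_on UNIV (\<lambda>p. dz u p - g p)" "on_torus \<omega>1 \<omega>2 (\<lambda>p. dz u p - g p)"
      by (auto intro!: per_continuous per_on_torus per_diff per_dz u g)
    fix m n
    obtain k where k: "idx k = (m, n)" using idx_surj by blast
    have "fcoeff u m n = G k / S k"
      unfolding u_def using fcoeff_fseries[OF c, of k] k by simp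
    moreover have "S k * (G k / S k) = G k"
    proof (cases "(m, n) = (0, 0)")
      case False
      then have "norm (S k) \<ge> \<delta>" unfolding S_def k by (simp add: \<delta>(2))
      then show ?thesis using \<delta>(1) by auto
    qed (use G0 k in simp)
    ultimately show "fcoeff (\<lambda>p. dz u p - g p) m n = 0"
      using k by (simp add: fcoeff_diff per_continuous per_dz u g fcoeff_dz S_def G_def)
  qed
  then show ?thesis using that[OF u] by simp
qed

theorem dz_eq_0_imp_const:
  assumes u: "per u" and 0: "\<And>p. dz u p = 0"
  shows "u p = mean u"
proof -
  obtain \<delta> where \<delta>: "\<delta> > 0" "\<And>m n. (m, n) \<noteq> (0, 0) \<Longrightarrow> norm (symb m n) \<ge> \<delta>" using symb_bound by blast
  have "u p - mean u = 0"
  proof (rule fcoeff_eq_0_imp[of "\<lambda>p. u p - mean u"])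
    show "continuous_on UNIV (\<lambda>p. u p - mean u)" "on_torus \<omega>1 \<omega>2 (\<lambda>p. u p - mean u)"
      by (auto intro!: per_continuous per_on_torus per_diff u)
    fix m n
    have d: "fcoeff (\<lambda>p. u p - mean u) m n = fcoeff u m n - fcoeff (\<lambda>p. mean u) m n"
      by (rule fcoeff_diff) (auto intro: per_continuous u)
    have e: "fcoeff (\<lambda>p. mean u) m n = mean u * (if m = 0 \<and> n = 0 then 1 else 0)"
      unfolding fcoeff_def using mean_cmult[OF continuous_chr, of "mean u" "-m" "-n"] by (simp add: mean_chr)
    show "fcoeff (\<lambda>p. u p - mean u) m n = 0"
    proof (cases "(m, n) = (0, 0)")
      case True
      then show ?thesis using d e by (simp add: fcoeff_def)
    next
      case False
      have "dz u = (\<lambda>p. 0)" using 0 by auto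
      then have "symb m n * fcoeff u m n = 0"
        using fcoeff_dz[OF u, of m n] by (simp add: fcoeff_def)
      moreover have "symb m n \<noteq> 0" using \<delta>(2)[OF False] \<delta>(1) by auto
      ultimately show ?thesis using d e False by auto
    qed
  qed
  then show ?thesis by simp
qed

end


section \<open>The Lorentzian form and complex differentiation\<close>

lemma lor_commute: "lor v w = lor w v"
  by (simp add: lor_def mult.commute)

lemma lor_add_left: "lor (u + v) w = lor u w + lor v w"
  and lor_add_right: "lor w (u + v) = lor w u + lor w v"
  and lor_diff_left: "lor (u - v) w = lor u w - lor v w"
  and lor_diff_right: "lor w (u - v) = lor w u - lor w v"
  and lor_minus_left: "lor (- u) w = - lor u w"
  and lor_minus_right: "lor w (- u) = - lor w u"
  and lor_smult_left: "lor (c *s u) w = c * lor u w"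
  and lor_smult_right: "lor w (c *s u) = c * lor w u"
  and lor_zero_left: "lor 0 w = 0"
  and lor_zero_right: "lor w 0 = 0"
  by (simp_all add: lor_def algebra_simps sum.distrib sum_subtractf sum_negf sum_distrib_left)

lemmas lor_simps = lor_add_left lor_add_right lor_diff_left lor_diff_right lor_minus_left lor_minus_right
  lor_smult_left lor_smult_right lor_zero_left lor_zero_right

lemma lor_scaleR_left: "lor (c *\<^sub>R u) w = c *\<^sub>R lor u w"
  and lor_scaleR_right: "lor w (c *\<^sub>R u) = c *\<^sub>R lor w u"
  for u w :: "'a::{real_normed_algebra_1, comm_ring_1} ^ 5 option"
  by (simp_all add: lor_def scaleR_right_diff_distrib scaleR_right.sum)

lemma bounded_bilinear_lor:
  "bounded_bilinear (lor :: 'a::{real_normed_field, euclidean_space} ^ 5 option \<Rightarrow> _ \<Rightarrow> 'a)"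
  unfolding bilinear_conv_bounded_bilinear[symmetric] bilinear_def
  by (auto intro!: linearI simp: lor_simps lor_scaleR_left lor_scaleR_right)

lemma bounded_bilinear_smult: "bounded_bilinear ((*s) :: complex \<Rightarrow> complex ^ 'n::finite \<Rightarrow> _)"
  unfolding bilinear_conv_bounded_bilinear[symmetric] bilinear_def
  by (auto intro!: linearI simp: vec_eq_iff algebra_simps)

lemma bounded_linear_cvec: "bounded_linear cvec"
  and bounded_linear_vcnj: "bounded_linear vcnj"
  and bounded_linear_vRe: "bounded_linear vRe"
  and bounded_linear_vIm: "bounded_linear vIm"
  unfolding linear_conv_bounded_linear[symmetric]
  by (auto intro!: linearI simp: cvec_def vcnj_def vRe_def vIm_def vec_eq_iff, auto simp: scaleR_conv_of_real)

lemma vcnj_vcnj [simp]: "vcnj (vcnj v) = v"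
  and vcnj_cvec [simp]: "vcnj (cvec x) = cvec x"
  and vcnj_add: "vcnj (v + w) = vcnj v + vcnj w"
  and vcnj_smult: "vcnj (c *s v) = cnj c *s vcnj v"
  and vRe_cvec [simp]: "vRe (cvec x) = x"
  and vIm_cvec [simp]: "vIm (cvec x) = 0"
  by (auto simp: vcnj_def cvec_def vRe_def vIm_def vec_eq_iff)

lemma vec_Re_Im: "v = cvec (vRe v) + \<i> *s cvec (vIm v)"
  by (auto simp: vec_eq_iff cvec_def vRe_def vIm_def complex_eq_iff)

lemma lor_cvec: "lor (cvec v) (cvec w) = of_real (lor v w)"
  by (simp add: lor_def cvec_def)

lemma lor_vcnj: "lor (vcnj v) (vcnj w) = cnj (lor v w)"
  by (simp add: lor_def vcnj_def)

lemma lor_vRe: "lor (cvec (vRe v)) w = (lor v w + lor (vcnj v) w) / 2"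
proof -
  have "cvec (vRe v) = (1 / 2) *s (v + vcnj v)"
    by (auto simp: vec_eq_iff cvec_def vRe_def vcnj_def complex_eq_iff)
  then show ?thesis by (simp add: lor_simps)
qed

lemma vdz_dir: "F differentiable (at p) \<Longrightarrow> vdz F p = (1 / 2) *s (dir 1 F p - \<i> *s dir \<i> F p)"
  and vdzbar_dir: "F differentiable (at p) \<Longrightarrow> vdzbar F p = (1 / 2) *s (dir 1 F p + \<i> *s dir \<i> F p)"
  by (auto simp: vec_eq_iff vdz_def vdzbar_def dz_def dzbar_def dx_dir dy_dir dir_vec_nth)

abbreviation smooth :: "('a::euclidean_space \<Rightarrow> 'b::real_normed_vector) \<Rightarrow> bool" where
  "smooth \<equiv> smooth_on UNIV"

lemma smooth_differentiable: "smooth F \<Longrightarrow> F differentiable (at p)"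
  using smooth_on_differentiable by blast

lemma smooth_lor:
  "smooth F \<Longrightarrow> smooth G \<Longrightarrow> smooth (\<lambda>p. lor (F p) (G p :: 'a::{real_normed_field, euclidean_space} ^ 5 option))"
  by (rule smooth_on_bilinear[OF open_UNIV bounded_bilinear_lor])

lemma smooth_smult: "smooth h \<Longrightarrow> smooth F \<Longrightarrow> smooth (\<lambda>p. h p *s (F p :: complex ^ 'n))"
  by (rule smooth_on_bilinear[OF open_UNIV bounded_bilinear_smult])

lemma smooth_vdz: assumes "smooth F" shows "smooth (vdz F)"
proof -
  have "vdz F = (\<lambda>p. (1 / 2) *s (dir 1 F p - \<i> *s dir \<i> F p))"
    using vdz_dir[OF smooth_differentiable[OF assms]] by auto
  then show ?thesis using assms
    by (simp add: smooth_smult smooth_on_diff smooth_on_dir)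
qed

lemma smooth_vdzbar: assumes "smooth F" shows "smooth (vdzbar F)"
proof -
  have "vdzbar F = (\<lambda>p. (1 / 2) *s (dir 1 F p + \<i> *s dir \<i> F p))"
    using vdzbar_dir[OF smooth_differentiable[OF assms]] by auto
  then show ?thesis using assms
    by (simp add: smooth_smult smooth_on_add smooth_on_dir)
qed

lemma smooth_dzbar: assumes "smooth h" shows "smooth (dzbar h)"
proof -
  have "dzbar h = (\<lambda>p. (1 / 2) * (dir 1 h p + \<i> * dir \<i> h p))"
    by (auto simp: fun_eq_iff dzbar_def dx_dir dy_dir)
  then show ?thesis
    using assms by (simp only: smooth_on_mult smooth_on_const smooth_on_add smooth_on_dir open_UNIV)
qed

lemma smooth_vcnj: "smooth F \<Longrightarrow> smooth (\<lambda>p. vcnj (F p))"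
  and smooth_cvec: "smooth G \<Longrightarrow> smooth (\<lambda>p. cvec (G p))"
  and smooth_vRe: "smooth F \<Longrightarrow> smooth (\<lambda>p. vRe (F p))"
  and smooth_vIm: "smooth F \<Longrightarrow> smooth (\<lambda>p. vIm (F p))"
  and smooth_cnj: "smooth h \<Longrightarrow> smooth (\<lambda>p. cnj (h p))"
  by (rule smooth_on_bounded_linear[OF open_UNIV]; simp add: bounded_linear_cvec bounded_linear_vcnj
      bounded_linear_vRe bounded_linear_vIm bounded_linear_cnj)+

lemma dz_lor:
  assumes "smooth F" "smooth G"
  shows "dz (\<lambda>p. lor (F p) (G p)) p = lor (vdz F p) (G p) + lor (F p) (vdz G p)"
    and "dzbar (\<lambda>p. lor (F p) (G p)) p = lor (vdzbar F p) (G p) + lor (F p) (vdzbar G p)"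
  by (simp_all add: dz_def dzbar_def dx_dir dy_dir dir_bilinear[OF bounded_bilinear_lor]
      smooth_differentiable assms vdz_dir vdzbar_dir lor_simps field_simps)

lemma vdz_smult:
  assumes "smooth h" "smooth F"
  shows "vdz (\<lambda>p. h p *s F p) p = dz h p *s F p + h p *s vdz F p"
    and "vdzbar (\<lambda>p. h p *s F p) p = dzbar h p *s F p + h p *s vdzbar F p"
  using smooth_differentiable[OF smooth_smult[OF assms]]
  by (simp_all add: vdz_dir vdzbar_dir dz_def dzbar_def dx_dir dy_dir dir_bilinear[OF bounded_bilinear_smult]
      smooth_differentiable assms vec_eq_iff field_simps)

lemma vdz_add:
  assumes "smooth F" "smooth G"
  shows "vdz (\<lambda>p. F p + G p) p = vdz F p + vdz G p"
    and "vdzbar (\<lambda>p. F p + G p) p = vdzbar F p + vdzbar G p"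
  using smooth_differentiable[OF smooth_on_add[OF open_UNIV assms]]
  by (simp_all add: vdz_dir vdzbar_dir dir_add smooth_differentiable assms vec_eq_iff field_simps)

lemma dir_smult:
  "F differentiable (at p) \<Longrightarrow> dir v (\<lambda>p. c *s (F p :: complex ^ 'n)) p = c *s dir v F p"
  using dir_bilinear[OF bounded_bilinear_smult, of "\<lambda>p. c" p F v] by (simp add: dir_const)

lemma vdz_vdzbar:
  assumes "smooth F"
  shows "vdz (vdzbar F) p = vdzbar (vdz F) p"
proof -
  note s = assms smooth_on_dir[OF assms] smooth_on_dir[OF smooth_on_dir[OF assms]]
  note d = s[THEN smooth_differentiable]
  have b: "vdzbar F = (\<lambda>p. (1 / 2) *s (dir 1 F p + \<i> *s dir \<i> F p))"
    and a: "vdz F = (\<lambda>p. (1 / 2) *s (dir 1 F p + (-\<i>) *s dir \<i> F p))"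
    using vdzbar_dir[OF d(1)] vdz_dir[OF d(1)] by (auto simp: vec_eq_iff)
  have i: "(\<lambda>p. c *s dir v F p) differentiable (at q)" for c v q
    by (rule smooth_differentiable[OF smooth_smult[OF smooth_on_const s(2)]])
  have e: "(\<lambda>p. dir 1 F p + c *s dir \<i> F p) differentiable (at q)" for c q
    by (rule differentiable_add[OF d(2) i])
  have D: "dir v (\<lambda>p. (1 / 2) *s (dir 1 F p + c *s dir \<i> F p)) p = (1 / 2) *s (dir v (dir 1 F) p + c *s dir v (dir \<i> F) p)" for v c
    by (simp only: dir_smult e d(2) i dir_add)
  show ?thesis
    unfolding vdz_dir[OF smooth_differentiable[OF smooth_vdzbar[OF assms]]]
      vdzbar_dir[OF smooth_differentiable[OF smooth_vdz[OF assms]]]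
    unfolding a b D
    using dir_commute[OF open_UNIV UNIV_I assms, of 1 \<i> p] by (simp add: vec_eq_iff field_simps)
qed

lemma vdz_vcnj:
  assumes "smooth F"
  shows "vdz (\<lambda>p. vcnj (F p)) p = vcnj (vdzbar F p)"
    and "vdzbar (\<lambda>p. vcnj (F p)) p = vcnj (vdz F p)"
  using smooth_differentiable[OF assms] smooth_differentiable[OF smooth_vcnj[OF assms]]
  by (simp_all add: vdz_dir vdzbar_dir dir_bounded_linear[OF bounded_linear_vcnj])
    (simp_all add: vcnj_def vec_eq_iff)

lemma dz_cnj:
  assumes "smooth h"
  shows "dz (\<lambda>p. cnj (h p)) p = cnj (dzbar h p)" and "dzbar (\<lambda>p. cnj (h p)) p = cnj (dz h p)"
  by (simp_all add: dz_def dzbar_def dx_dir dy_dir dir_bounded_linear[OF bounded_linear_cnj] smooth_differentiable[OF assms])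

lemma dz_const [simp]: "dz (\<lambda>p. c) p = 0" "dzbar (\<lambda>p. c) p = 0"
  by (simp_all add: dz_def dzbar_def dx_dir dy_dir dir_const)

lemma dz_cmult:
  assumes "smooth h"
  shows "dz (\<lambda>p. c * h p) p = c * dz h p" "dzbar (\<lambda>p. c * h p) p = c * dzbar h p"
  by (simp_all add: dz_def dzbar_def dx_dir dy_dir field_simps
      dir_bounded_linear[OF bounded_linear_mult_right smooth_differentiable[OF assms]])

lemma lor_eq_const:
  assumes "smooth F" "smooth G" "\<And>p. lor (F p) (G p) = k"
  shows "lor (vdz F p) (G p) + lor (F p) (vdz G p) = 0"
    and "lor (vdzbar F p) (G p) + lor (F p) (vdzbar G p) = 0"
  using dz_lor[OF assms(1,2), of p] by (simp_all add: assms(3))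


section \<open>Identities for a normalized lift\<close>

text \<open>
  The letters after \<open>Y\<close> record the derivatives, \<open>z\<close> by \<open>1\<close> and its conjugate by \<open>2\<close>. \<open>Sc\<close> is the Schwarzian
  derivative, \<open>\<kappa>\<close> the Hopf differential, and \<open>L\<close> will turn out to be the Willmore density.
\<close>

locale lift =
  fixes Y :: "complex \<Rightarrow> lor_complex"
  assumes Y: "smooth Y" and Y_real: "vcnj (Y p) = Y p"
    and YY: "lor (Y p) (Y p) = 0"
    and Y11': "lor (vdz Y p) (vdz Y p) = 0"
    and Y12': "lor (vdz Y p) (vdzbar Y p) = 1 / 2"
begin

definition Y1 where "Y1 = vdz Y"
definition Y2 where "Y2 = vdzbar Y"
definition Y11 where "Y11 = vdz Y1"
definition Y12 where "Y12 = vdz Y2"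
definition Y22 where "Y22 = vdzbar Y2"
definition Y112 where "Y112 = vdz Y12"
definition Y122 where "Y122 = vdzbar Y12"
definition Y1122 where "Y1122 = vdz Y122"
definition L where "L p = lor (Y12 p) (Y12 p)"
definition Sc where "Sc p = 4 * lor (Y11 p) (Y12 p)"
definition \<kappa> where "\<kappa> p = Y11 p + (Sc p / 2) *s Y p"

lemma smooth_Y: "smooth Y1" "smooth Y2" "smooth Y11" "smooth Y12" "smooth Y22" "smooth Y112" "smooth Y122" "smooth Y1122"
  unfolding Y1_def Y2_def Y11_def Y12_def Y22_def Y112_def Y122_def Y1122_def
  by (intro smooth_vdz smooth_vdzbar Y)+

lemma smooth_LSc: "smooth L" "smooth Sc"
  unfolding L_def[abs_def] Sc_def[abs_def]
  by (intro smooth_on_mult open_UNIV smooth_on_const smooth_lor smooth_Y)+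

lemma vd: "vdz Y = Y1" "vdzbar Y = Y2" "vdz Y1 = Y11" "vdzbar Y1 = Y12" "vdz Y2 = Y12" "vdzbar Y2 = Y22"
  "vdzbar Y11 = Y112" "vdz Y12 = Y112" "vdzbar Y12 = Y122" "vdz Y22 = Y122"
  "vdzbar Y112 = Y1122" "vdz Y122 = Y1122"
proof -
  have c: "vdz (vdzbar F) = vdzbar (vdz F)" if "smooth F" for F using vdz_vdzbar[OF that] by auto
  show "vdz Y = Y1" "vdzbar Y = Y2" "vdz Y1 = Y11" "vdz Y2 = Y12" "vdzbar Y2 = Y22" "vdz Y12 = Y112" "vdzbar Y12 = Y122"
    "vdz Y122 = Y1122"
    by (simp_all only: Y1_def Y2_def Y11_def Y12_def Y22_def Y112_def Y122_def Y1122_def)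
  show 12: "vdzbar Y1 = Y12" by (simp add: Y12_def Y2_def Y1_def c[OF Y])
  show "vdzbar Y11 = Y112" unfolding Y11_def Y112_def 12[symmetric] using c[OF smooth_Y(1)] by simp
  show "vdz Y22 = Y122" unfolding Y22_def Y122_def Y12_def by (rule c[OF smooth_Y(2)])
  show "vdzbar Y112 = Y1122" unfolding Y112_def Y1122_def Y122_def using c[OF smooth_Y(4)] by simp
qed

lemma Y_conj: "vcnj (Y1 p) = Y2 p" "vcnj (Y11 p) = Y22 p" "vcnj (Y12 p) = Y12 p" "vcnj (Y112 p) = Y122 p" "vcnj (Y1122 p) = Y1122 p"
proof -
  have 0: "(\<lambda>p. vcnj (Y p)) = Y" using Y_real by auto
  have 1: "vcnj (Y1 p) = Y2 p" for p using vdz_vcnj(2)[OF Y, of p] by (simp add: 0 vd)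
  have e1: "(\<lambda>p. vcnj (Y1 p)) = Y2" using 1 by auto
  have 11: "vcnj (Y11 p) = Y22 p" for p using vdz_vcnj(2)[OF smooth_Y(1), of p] by (simp add: e1 vd)
  have 12: "vcnj (Y12 p) = Y12 p" for p using vdz_vcnj(1)[OF smooth_Y(1), of p] by (simp add: e1 vd)
  have e12: "(\<lambda>p. vcnj (Y12 p)) = Y12" using 12 by auto
  have 112: "vcnj (Y112 p) = Y122 p" for p using vdz_vcnj(2)[OF smooth_Y(4), of p] by (simp add: e12 vd)
  have e112: "(\<lambda>p. vcnj (Y112 p)) = Y122" using 112 by auto
  have "vcnj (Y1122 p) = Y1122 p" using vdz_vcnj(1)[OF smooth_Y(6), of p] by (simp add: e112 vd)
  then show "vcnj (Y1 p) = Y2 p" "vcnj (Y11 p) = Y22 p" "vcnj (Y12 p) = Y12 p" "vcnj (Y112 p) = Y122 p"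
    "vcnj (Y1122 p) = Y1122 p"
    using 1 11 12 112 by auto
qed

lemma L_real: "cnj (L p) = L p"
  unfolding L_def by (simp add: lor_vcnj[symmetric] Y_conj)

lemma gram1: "lor (Y p) (Y p) = 0" "lor (Y1 p) (Y1 p) = 0" "lor (Y1 p) (Y2 p) = 1 / 2" "lor (Y2 p) (Y2 p) = 0"
  "lor (Y1 p) (Y p) = 0" "lor (Y2 p) (Y p) = 0" "lor (Y2 p) (Y1 p) = 1 / 2"
proof -
  have YY': "lor (Y p) (Y p) = 0" and 11: "lor (Y1 p) (Y1 p) = 0" for p
    using YY Y11' by (simp_all add: Y1_def)
  show "lor (Y p) (Y p) = 0" "lor (Y1 p) (Y1 p) = 0" "lor (Y1 p) (Y2 p) = 1 / 2"
    "lor (Y2 p) (Y1 p) = 1 / 2"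
    using YY' 11 Y12' lor_commute[of "Y2 p"] by (simp_all add: Y1_def Y2_def)
  show "lor (Y2 p) (Y2 p) = 0" using lor_vcnj[of "Y1 p" "Y1 p"] by (simp add: 11 Y_conj)
  show "lor (Y1 p) (Y p) = 0" "lor (Y2 p) (Y p) = 0"
    using lor_eq_const[OF Y Y YY', of p] lor_commute[of "Y p"] by (simp_all add: vd)
qed

lemma gram2: "lor (Y11 p) (Y p) = 0" "lor (Y22 p) (Y p) = 0" "lor (Y12 p) (Y p) = - 1 / 2"
  "lor (Y11 p) (Y1 p) = 0" "lor (Y12 p) (Y1 p) = 0" "lor (Y12 p) (Y2 p) = 0" "lor (Y22 p) (Y2 p) = 0"
  "lor (Y11 p) (Y2 p) = 0" "lor (Y22 p) (Y1 p) = 0"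
proof -
  note c = lor_commute[of "Y1 p"] lor_commute[of "Y2 p"]
  show "lor (Y11 p) (Y p) = 0" "lor (Y22 p) (Y p) = 0" "lor (Y12 p) (Y p) = - 1 / 2"
    using lor_eq_const[OF smooth_Y(1) Y gram1(5), of p] lor_eq_const[OF smooth_Y(2) Y gram1(6), of p]
    by (simp_all add: vd gram1 eq_neg_iff_add_eq_0)
  show r: "lor (Y11 p) (Y1 p) = 0" "lor (Y12 p) (Y1 p) = 0" "lor (Y12 p) (Y2 p) = 0" "lor (Y22 p) (Y2 p) = 0"
    using lor_eq_const[OF smooth_Y(1) smooth_Y(1) gram1(2), of p] lor_eq_const[OF smooth_Y(2) smooth_Y(2) gram1(4), of p] c
    by (simp_all add: vd)
  show "lor (Y11 p) (Y2 p) = 0" "lor (Y22 p) (Y1 p) = 0"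
    using lor_eq_const[OF smooth_Y(1) smooth_Y(2) gram1(3), of p] r c by (simp_all add: vd)
qed

text \<open>
  Each product comes from differentiating one that is already known to be constant, which moves a
  derivative from one factor to the other.
\<close>

lemma gram3: "lor (Y122 p) (Y1 p) = - L p" "lor (Y112 p) (Y2 p) = - L p" "lor (Y11 p) (Y22 p) = L p"
  "lor (Y112 p) (Y p) = 0" "lor (Y1122 p) (Y p) = L p"
proof -
  have 1: "lor (Y122 p) (Y1 p) = - L p" and 2: "lor (Y112 p) (Y2 p) = - L p" for p
    using lor_eq_const[OF smooth_Y(4) smooth_Y(1) gram2(5), of p] lor_eq_const[OF smooth_Y(4) smooth_Y(2) gram2(6), of p]
    by (simp_all add: vd L_def eq_neg_iff_add_eq_0)
  show "lor (Y11 p) (Y22 p) = L p"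
    using lor_eq_const[OF smooth_Y(5) smooth_Y(1) gram2(9), of p] 1[of p] lor_commute[of "Y11 p"]
    by (simp add: vd)
  have 3: "lor (Y112 p) (Y p) = 0" for p
    using lor_eq_const[OF smooth_Y(4) Y gram2(3), of p] gram2(5)[of p] by (simp add: vd)
  show "lor (Y122 p) (Y1 p) = - L p" "lor (Y112 p) (Y2 p) = - L p" "lor (Y112 p) (Y p) = 0"
    using 1 2 3 by auto
  show "lor (Y1122 p) (Y p) = L p"
    using lor_eq_const[OF smooth_Y(6) Y 3, of p] 2[of p] by (simp add: vd)
qed

lemma gram4: "lor (Y1122 p) (Y1 p) = - dz L p / 2 - dzbar Sc p / 4"
  "lor (Y1122 p) (Y2 p) = - dzbar L p / 2 - dz (\<lambda>p. cnj (Sc p)) p / 4"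
proof -
  have "lor (Y1122 p) (Y1 p) + lor (Y122 p) (Y11 p) = - dz L p"
  proof -
    have "(\<lambda>p. lor (Y122 p) (Y1 p)) = (\<lambda>p. (-1) * L p)"
      using gram3(1) by auto
    then have "dz (\<lambda>p. lor (Y122 p) (Y1 p)) p = (-1) * dz L p"
      by (simp only: dz_cmult smooth_LSc)
    then show ?thesis by (simp add: dz_lor smooth_Y vd)
  qed
  moreover have "dz L p = 2 * lor (Y112 p) (Y12 p)"
    unfolding L_def[abs_def] using lor_commute[of "Y12 p"] by (simp add: dz_lor smooth_Y vd)
  moreover have "dzbar Sc p = 4 * (lor (Y112 p) (Y12 p) + lor (Y11 p) (Y122 p))"
  proof -
    have "Sc = (\<lambda>p. 4 * lor (Y11 p) (Y12 p))" by (auto simp: Sc_def)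
    then have "dzbar Sc p = 4 * dzbar (\<lambda>p. lor (Y11 p) (Y12 p)) p"
      by (simp only: dz_cmult smooth_lor smooth_Y)
    then show ?thesis by (simp add: dz_lor smooth_Y vd)
  qed
  ultimately show *: "lor (Y1122 p) (Y1 p) = - dz L p / 2 - dzbar Sc p / 4"
    using lor_commute[of "Y11 p" "Y122 p"] by (simp add: eq_diff_eq[symmetric] add_divide_distrib)
  have "lor (Y1122 p) (Y2 p) = cnj (lor (Y1122 p) (Y1 p))" by (simp add: lor_vcnj[symmetric] Y_conj)
  moreover have "(\<lambda>p. cnj (L p)) = L" using L_real by auto
  ultimately show "lor (Y1122 p) (Y2 p) = - dzbar L p / 2 - dz (\<lambda>p. cnj (Sc p)) p / 4"
    using dz_cnj(2)[OF smooth_LSc(1), of p] dz_cnj(1)[OF smooth_LSc(2), of p] by (simp add: *)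
qed

definition perp :: "complex \<Rightarrow> lor_complex \<Rightarrow> bool" where
  "perp p v \<longleftrightarrow> lor v (Y p) = 0 \<and> lor v (Y1 p) = 0 \<and> lor v (Y2 p) = 0 \<and> lor v (Y12 p) = 0"

lemma smooth_\<kappa>: "smooth \<kappa>"
proof -
  have "\<kappa> = (\<lambda>p. Y11 p + ((1 / 2) * Sc p) *s Y p)" by (auto simp: \<kappa>_def)
  then show ?thesis
    by (simp only: smooth_on_add open_UNIV smooth_Y smooth_smult smooth_on_mult smooth_on_const smooth_LSc Y)
qed

lemma perp_\<kappa>: "perp p (\<kappa> p)"
  using lor_commute[of "Y p"] by (simp add: perp_def \<kappa>_def lor_simps gram1 gram2 Sc_def)

lemma perp_scale: "perp p (Y11 p + (c / 2) *s Y p) \<longleftrightarrow> c = Sc p"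
  using lor_commute[of "Y p"] by (auto simp: perp_def lor_simps gram1 gram2 Sc_def)

text \<open>
  By \<open>gram3\<close> the squared norm of \<open>\<psi>\<^sub>z\<^sub>z\<close> equals that of the mixed derivative; the Schwarzian does not
  contribute, because \<open>\<psi>\<close> is orthogonal to \<open>\<psi>\<^sub>z\<^sub>z\<close> and its conjugate.
\<close>

lemma lor_\<kappa>_cnj: "lor (\<kappa> p) (vcnj (\<kappa> p)) = L p"
  using lor_commute[of "Y p" "Y22 p"]
  by (simp add: \<kappa>_def vcnj_add vcnj_smult Y_conj Y_real lor_simps gram1 gram2 gram3)

definition \<kappa>2 where "\<kappa>2 = vdzbar \<kappa>"
definition \<kappa>22 where "\<kappa>22 = vdzbar \<kappa>2"

lemma smooth_\<kappa>2: "smooth \<kappa>2" "smooth \<kappa>22"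
  unfolding \<kappa>2_def \<kappa>22_def by (intro smooth_vdzbar smooth_\<kappa>)+

lemma smooth_half_Sc: "smooth (\<lambda>p. Sc p / 2)"
  unfolding divide_inverse by (intro smooth_on_mult smooth_LSc open_UNIV smooth_on_const)

lemma \<kappa>2_eq: "\<kappa>2 p = Y112 p + dzbar (\<lambda>p. Sc p / 2) p *s Y p + (Sc p / 2) *s Y2 p"
  unfolding \<kappa>2_def \<kappa>_def[abs_def]
  by (simp add: vdz_add smooth_Y smooth_smult vdz_smult Y smooth_half_Sc vd)

lemma \<kappa>22_eq: "\<kappa>22 p = Y1122 p + dzbar (dzbar (\<lambda>p. Sc p / 2)) p *s Y p + (2 * dzbar (\<lambda>p. Sc p / 2) p) *s Y2 p + (Sc p / 2) *s Y22 p"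
proof -
  have "\<kappa>2 = (\<lambda>p. (Y112 p + dzbar (\<lambda>p. Sc p / 2) p *s Y p) + (Sc p / 2) *s Y2 p)" using \<kappa>2_eq by auto
  then show ?thesis
    unfolding \<kappa>22_def
    by (simp add: vdz_add smooth_on_add smooth_Y smooth_smult vdz_smult Y smooth_half_Sc smooth_dzbar vd)
      (simp add: vec_eq_iff algebra_simps)
qed

text \<open>
  Since \<open>\<kappa>\<close> is normal, its derivative can pair nontrivially only with the conjugate of \<open>\<psi>\<^sub>z\<close> and with
  the mixed derivative of \<open>\<psi>\<close>; the dual vectors of these are multiples of \<open>\<psi>\<^sub>z\<close> and \<open>\<psi>\<close>.
\<close>

lemma \<kappa>2_decomp:
  "perp p (\<kappa>2 p + (2 * L p) *s Y1 p + (2 * lor (\<kappa>2 p) (Y12 p)) *s Y p)"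
proof -
  note c = lor_commute[of "Y p"] lor_commute[of "Y1 p" "Y12 p"]
  have "lor (\<kappa>2 p) (Y p) = 0"
    using lor_eq_const(2)[OF smooth_\<kappa> Y, of 0 p] perp_\<kappa> by (simp add: vd perp_def \<kappa>2_def)
  moreover have "lor (\<kappa>2 p) (Y1 p) = 0"
    using lor_eq_const(2)[OF smooth_\<kappa> smooth_Y(1), of 0 p] perp_\<kappa> by (simp add: vd perp_def \<kappa>2_def)
  moreover have "lor (\<kappa>2 p) (Y2 p) = - L p"
  proof -
    have "lor (\<kappa> p) (Y22 p) = L p"
      using c by (simp add: \<kappa>_def lor_simps gram3 gram2)
    then show ?thesis
      using lor_eq_const(2)[OF smooth_\<kappa> smooth_Y(2), of 0 p] perp_\<kappa>
      by (simp add: vd perp_def \<kappa>2_def eq_neg_iff_add_eq_0)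
  qed
  ultimately show ?thesis
    using c by (simp add: perp_def lor_simps gram1 gram2)
qed

text \<open>
  The Euler--Lagrange expression of the Willmore energy under the constraints
  \<open>\<langle>\<psi>\<^sub>z, \<psi>\<^sub>z\<rangle> = 0\<close> and \<open>\<langle>\<psi>\<^sub>z, \<psi>\<^sub>z\<^sub>b\<rangle> = 1/2\<close>: the first summand is the unconstrained
  gradient, the others are the multiplier terms, chosen such that the sum is orthogonal
  to \<open>\<psi>, \<psi>\<^sub>z, \<psi>\<^sub>z\<^sub>b\<close>.
\<close>

definition EL where
  "EL p = Y1122 p + vdzbar (\<lambda>p. L p *s Y1 p) p + vdz (\<lambda>p. L p *s Y2 p) p
    + (1 / 2) *s (vdzbar (\<lambda>p. Sc p *s Y2 p) p + vdz (\<lambda>p. cnj (Sc p) *s Y1 p) p)"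

lemma EL_eq: "EL p = Y1122 p + (2 * L p) *s Y12 p + dzbar L p *s Y1 p + dz L p *s Y2 p
    + (1 / 2) *s (dzbar Sc p *s Y2 p + Sc p *s Y22 p + dz (\<lambda>p. cnj (Sc p)) p *s Y1 p + cnj (Sc p) *s Y11 p)"
  unfolding EL_def
  by (simp add: vdz_smult smooth_LSc smooth_cnj smooth_Y vd) (simp add: vec_eq_iff algebra_simps)

lemma EL_tangential: "lor (EL p) (Y p) = 0" "lor (EL p) (Y1 p) = 0" "lor (EL p) (Y2 p) = 0"
  unfolding EL_eq using lor_commute[of "Y p"]
  by (simp_all add: lor_simps gram1 gram2 gram3 gram4 field_simps)

lemma EL_real: "vcnj (EL p) = EL p"
proof -
  have l: "(\<lambda>p. cnj (L p)) = L" using L_real by auto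
  have "cnj (dz L p) = dzbar L p" "cnj (dzbar L p) = dz L p"
    using dz_cnj[OF smooth_LSc(1), of p] by (simp_all add: l)
  moreover have "cnj (dz (\<lambda>p. cnj (Sc p)) p) = dzbar Sc p" "cnj (dzbar Sc p) = dz (\<lambda>p. cnj (Sc p)) p"
    using dz_cnj[OF smooth_LSc(2), of p] by simp_all
  moreover have "vcnj (Y2 p) = Y1 p" "vcnj (Y22 p) = Y11 p"
    using Y_conj(1,2)[of p, symmetric] by simp_all
  ultimately show ?thesis
    unfolding EL_eq by (simp add: vcnj_add vcnj_smult Y_conj L_real)
qed

text \<open>
  The Schwarzian terms of \<open>EL\<close> and of the second derivative of \<open>\<kappa>\<close> differ by the conjugate term on
  the right.
\<close>

lemma lor_EL_perp:
  assumes "perp p s"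
  shows "lor s (EL p) = lor s (\<kappa>22 p) + cnj (Sc p) / 2 * lor s (\<kappa> p)"
  using assms by (simp add: EL_eq \<kappa>22_eq \<kappa>_def perp_def lor_simps field_simps)

text \<open>
  First variation of the Willmore density: up to divergences only the normal part of the
  variation \<open>H\<close> of the lift contributes.
\<close>

lemma first_variation:
  assumes H: "smooth H"
    and c1: "\<And>p. lor (vdz H p) (Y1 p) = 0" and c2: "\<And>p. lor (vdzbar H p) (Y2 p) = 0"
    and c12: "\<And>p. lor (vdz H p) (Y2 p) + lor (vdzbar H p) (Y1 p) = 0"
    and Hp: "H p = a *s Y p + b *s Y1 p + b' *s Y2 p + s"
  shows "lor (vdz (vdzbar H) p) (Y12 p) =
    lor s (EL p) + dz (\<lambda>p. lor (vdzbar H p) (Y12 p)) p - dzbar (\<lambda>p. lor (H p) (Y112 p)) p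
    - dzbar (\<lambda>p. lor (H p) (L p *s Y1 p)) p - dz (\<lambda>p. lor (H p) (L p *s Y2 p)) p
    - dzbar (\<lambda>p. lor (H p) (Sc p *s Y2 p)) p / 2 - dz (\<lambda>p. lor (H p) (cnj (Sc p) *s Y1 p)) p / 2"
proof -
  have sm: "smooth (\<lambda>p. L p *s Y1 p)" "smooth (\<lambda>p. L p *s Y2 p)" "smooth (\<lambda>p. Sc p *s Y2 p)" "smooth (\<lambda>p. cnj (Sc p) *s Y1 p)"
    by (intro smooth_smult smooth_LSc smooth_cnj smooth_Y)+
  have 1: "lor (H p) (EL p) = lor s (EL p)"
  proof -
    have c: "lor (H p) (EL p) = lor (EL p) (H p)" "lor s (EL p) = lor (EL p) s" by (rule lor_commute)+
    show ?thesis unfolding c unfolding Hp using EL_tangential[of p] by (simp add: lor_simps)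
  qed
  have 2: "dzbar (\<lambda>p. lor (H p) (L p *s Y1 p)) p + dz (\<lambda>p. lor (H p) (L p *s Y2 p)) p
    = lor (H p) (vdzbar (\<lambda>p. L p *s Y1 p) p + vdz (\<lambda>p. L p *s Y2 p) p)"
  proof -
    have "L p * lor (vdz H p) (Y2 p) + L p * lor (vdzbar H p) (Y1 p) = 0"
      using c12[of p] by (metis distrib_left mult_zero_right)
    then show ?thesis
      unfolding dz_lor(1)[OF H sm(2)] dz_lor(2)[OF H sm(1)] by (simp add: lor_smult_right lor_add_right)
        (metis add.assoc add.commute add_0)
  qed
  have 3: "dzbar (\<lambda>p. lor (H p) (Sc p *s Y2 p)) p = lor (H p) (vdzbar (\<lambda>p. Sc p *s Y2 p) p)"
    "dz (\<lambda>p. lor (H p) (cnj (Sc p) *s Y1 p)) p = lor (H p) (vdz (\<lambda>p. cnj (Sc p) *s Y1 p) p)"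
    using c1 c2 dz_lor(2)[OF H sm(3), of p] dz_lor(1)[OF H sm(4), of p] by (simp_all add: lor_smult_right)
  have 4: "dz (\<lambda>p. lor (vdzbar H p) (Y12 p)) p = lor (vdz (vdzbar H) p) (Y12 p) + lor (vdzbar H p) (Y112 p)"
    "dzbar (\<lambda>p. lor (H p) (Y112 p)) p = lor (vdzbar H p) (Y112 p) + lor (H p) (Y1122 p)"
    by (simp_all add: dz_lor H smooth_vdzbar smooth_Y vd)
  have 5: "lor (H p) (EL p) = lor (H p) (Y1122 p) + lor (H p) (vdzbar (\<lambda>p. L p *s Y1 p) p + vdz (\<lambda>p. L p *s Y2 p) p)
      + (lor (H p) (vdzbar (\<lambda>p. Sc p *s Y2 p) p) + lor (H p) (vdz (\<lambda>p. cnj (Sc p) *s Y1 p) p)) / 2"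
    by (simp add: EL_def lor_add_right lor_smult_right)
  have aux: "x = s + d1 - d2 - b1 - b2 - b3 / 2 - b4 / 2"
    if "h = s" "b1 + b2 = m" "b3 = n1" "b4 = n2" "d1 = x + c" "d2 = c + e" "h = e + m + (n1 + n2) / 2"
    for x s d1 d2 b1 b2 b3 b4 h m n1 n2 c e :: complex
    using that by (auto simp: add_divide_distrib)
  show ?thesis by (rule aux[OF 1 2 3 4 5])
qed

end


section \<open>The normalized lift of a conformal immersion\<close>

definition space_part :: "real ^ 5 \<Rightarrow> lor_real" where
  "space_part x = (\<chi> i. case i of None \<Rightarrow> 0 | Some k \<Rightarrow> x $ k)"

lemma lor_null_vec: "lor (null_vec x) (null_vec y) = x \<bullet> y - 1"
  and lor_null_vec_space: "lor (null_vec x) (space_part y) = x \<bullet> y"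
  and lor_space_null_vec: "lor (space_part y) (null_vec x) = y \<bullet> x"
  and lor_space_space: "lor (space_part x) (space_part y) = x \<bullet> y"
  by (simp_all add: lor_def null_vec_def space_part_def inner_vec_def)

lemma bounded_linear_space_part: "bounded_linear space_part"
  unfolding linear_conv_bounded_linear[symmetric]
  by (auto intro!: linearI simp: space_part_def vec_eq_iff split: option.splits)

lemma null_vec_eq: "null_vec x = axis None 1 + space_part x"
  by (auto simp: null_vec_def space_part_def axis_def vec_eq_iff split: option.splits)

lemma dir_null_vec:
  assumes "f differentiable (at p)"
  shows "dir v (\<lambda>p. null_vec (f p)) p = space_part (dir v f p)"
    and "(\<lambda>p. null_vec (f p)) differentiable (at p)"
proof -
  have "((\<lambda>p. null_vec (f p)) has_derivative (\<lambda>v. 0 + space_part (dir v f p))) (at p)"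
    unfolding null_vec_eq
    by (intro has_derivative_add has_derivative_const bounded_linear.has_derivative[OF bounded_linear_space_part] dir_works assms)
  then show "dir v (\<lambda>p. null_vec (f p)) p = space_part (dir v f p)" "(\<lambda>p. null_vec (f p)) differentiable (at p)"
    by (auto simp: dirI differentiable_def)
qed

lemma smooth_on_null_vec: "open S \<Longrightarrow> smooth_on S f \<Longrightarrow> smooth_on S (\<lambda>p. null_vec (f p))"
  unfolding null_vec_eq
  by (intro smooth_on_add smooth_on_const smooth_on_bounded_linear[OF _ bounded_linear_space_part])

locale conformal =
  fixes f :: "complex \<Rightarrow> real ^ 5"
  assumes smooth_f: "smooth f" and sphere: "f p \<bullet> f p = 1"
    and conf: "\<exists>r>0. \<forall>v w. dir v f p \<bullet> dir w f p = r * (v \<bullet> w)"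
begin

lemma diff_f: "f differentiable (at p)"
  by (rule smooth_differentiable[OF smooth_f])

definition rr :: "complex \<Rightarrow> real" where "rr p = dx f p \<bullet> dx f p"

lemma conf_rr: "dir v f p \<bullet> dir w f p = rr p * (v \<bullet> w)" and rr_pos: "rr p > 0"
proof -
  obtain r where r: "r > 0" "\<And>v w. dir v f p \<bullet> dir w f p = r * (v \<bullet> w)" using conf by blast
  have "rr p = r" using r(2)[of 1 1] by (simp add: rr_def dx_dir)
  then show "dir v f p \<bullet> dir w f p = rr p * (v \<bullet> w)" "rr p > 0" using r by auto
qed

lemma smooth_rr: "smooth rr"
  unfolding rr_def[abs_def] dx_dir
  by (rule smooth_on_bilinear[OF open_UNIV bounded_bilinear_inner]; rule smooth_on_dir[OF smooth_f])

definition \<rho> :: "complex \<Rightarrow> real" where "\<rho> p = rr p powr (- 1 / 2)"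

lemma rho_pos: "\<rho> p > 0" and rho_sq: "(\<rho> p)\<^sup>2 * rr p = 1"
proof -
  have "(\<rho> p)\<^sup>2 = rr p powr (-1)"
    unfolding \<rho>_def power2_eq_square powr_add[symmetric] by simp
  then show "(\<rho> p)\<^sup>2 * rr p = 1" using rr_pos[of p] by (simp add: powr_minus)
qed (use rr_pos[of p] in \<open>simp add: \<rho>_def\<close>)

lemma smooth_rho: "smooth \<rho>"
  unfolding \<rho>_def[abs_def] by (rule smooth_on_powr[OF open_UNIV smooth_rr]) (rule rr_pos)

lemma f_perp_df: "f p \<bullet> dir v f p = 0"
proof -
  have "dir v (\<lambda>p. f p \<bullet> f p) p = 2 * (f p \<bullet> dir v f p)"
    by (simp add: dir_bilinear[OF bounded_bilinear_inner] diff_f inner_commute)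
  then show ?thesis by (simp add: sphere dir_const)
qed

lemma scaled_null_vec:
  assumes "h differentiable (at p)"
  shows "dir v (\<lambda>p. h p *\<^sub>R null_vec (f p)) p = h p *\<^sub>R space_part (dir v f p) + dir v h p *\<^sub>R null_vec (f p)"
    and "lor (dir v (\<lambda>p. h p *\<^sub>R null_vec (f p)) p) (dir w (\<lambda>p. h p *\<^sub>R null_vec (f p)) p) = (h p)\<^sup>2 * rr p * (v \<bullet> w)"
proof -
  show 1: "dir v (\<lambda>p. h p *\<^sub>R null_vec (f p)) p = h p *\<^sub>R space_part (dir v f p) + dir v h p *\<^sub>R null_vec (f p)" for v
    by (simp add: dir_bilinear[OF bounded_bilinear_scaleR] assms dir_null_vec diff_f)
  show "lor (dir v (\<lambda>p. h p *\<^sub>R null_vec (f p)) p) (dir w (\<lambda>p. h p *\<^sub>R null_vec (f p)) p) = (h p)\<^sup>2 * rr p * (v \<bullet> w)"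
    unfolding 1 using f_perp_df[of p v] f_perp_df[of p w]
    by (simp add: lor_simps lor_scaleR_left lor_scaleR_right lor_null_vec lor_null_vec_space lor_space_null_vec
        lor_space_space sphere conf_rr inner_commute power2_eq_square)
qed

definition \<psi> :: "complex \<Rightarrow> lor_real" where "\<psi> p = \<rho> p *\<^sub>R null_vec (f p)"

lemma smooth_psi: "smooth \<psi>"
  unfolding \<psi>_def[abs_def]
  by (rule smooth_on_scaleR[OF open_UNIV smooth_rho smooth_on_null_vec[OF open_UNIV smooth_f]])

lemma psi_metric: "lor (dir v \<psi> p) (dir w \<psi> p) = v \<bullet> w"
  unfolding \<psi>_def[abs_def]
  by (simp add: scaled_null_vec(2) smooth_differentiable[OF smooth_rho] rho_sq)

lemma psi_null: "lor (\<psi> p) (\<psi> p) = 0"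
  by (simp add: \<psi>_def lor_scaleR_left lor_scaleR_right lor_null_vec sphere)

lemma is_normalized_lift_psi: "is_normalized_lift f \<psi>"
  unfolding is_normalized_lift_def
proof (intro conjI allI)
  fix p
  show "\<psi> p \<in> light_cone"
    using psi_null[of p] rho_pos[of p] by (simp add: light_cone_def \<psi>_def null_vec_def)
  show "span {\<psi> p} = span {null_vec (f p)}"
  proof -
    have "k *\<^sub>R null_vec (f p) = (k / \<rho> p) *\<^sub>R \<psi> p" for k
      using rho_pos[of p] by (simp add: \<psi>_def)
    moreover have "k *\<^sub>R \<psi> p = (k * \<rho> p) *\<^sub>R null_vec (f p)" for k by (simp add: \<psi>_def)
    ultimately show ?thesis unfolding span_singleton by blast
  qed
  fix v show "lor (frechet_derivative \<psi> (at p) v) (frechet_derivative \<psi> (at p) v) = (cmod v)\<^sup>2"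
    using psi_metric[of v p v] by (simp add: dir_def power2_norm_eq_inner)
qed (rule smooth_psi)

text \<open>
  A positive multiple of the null vector of \<open>f\<close> scales the metric by the square of the factor, so
  the normalization leaves no choice.
\<close>

lemma nlift_eq: "nlift f = \<psi>"
  unfolding nlift_def
proof (rule the_equality, rule is_normalized_lift_psi)
  fix \<phi> assume \<phi>: "is_normalized_lift f \<phi>"
  define h where "h p = \<phi> p $ None" for p
  have eq: "\<phi> p = h p *\<^sub>R null_vec (f p)" for p
  proof -
    have "\<phi> p \<in> span {null_vec (f p)}"
      using \<phi> span_superset[of "{\<phi> p}"] unfolding is_normalized_lift_def by auto
    then obtain c where "\<phi> p = c *\<^sub>R null_vec (f p)" unfolding span_singleton by auto
    then show ?thesis by (simp add: h_def null_vec_def)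
  qed
  have "smooth h" unfolding h_def[abs_def]
    by (rule smooth_on_vec_nth[OF open_UNIV]) (use \<phi> in \<open>simp add: is_normalized_lift_def\<close>)
  have "\<phi> = (\<lambda>p. h p *\<^sub>R null_vec (f p))" using eq by auto
  then have "(h p)\<^sup>2 * rr p = 1" for p
    using \<phi> scaled_null_vec(2)[OF smooth_differentiable[OF \<open>smooth h\<close>], of 1 p 1]
    unfolding is_normalized_lift_def dir_def by (simp add: inner_complex_def)
  then have "(h p)\<^sup>2 = (\<rho> p)\<^sup>2" for p
    using rho_sq[of p] rr_pos[of p] mult_right_cancel[of "rr p" "(h p)\<^sup>2" "(\<rho> p)\<^sup>2"] by simp
  moreover have "h p > 0" for p using \<phi> by (simp add: is_normalized_lift_def light_cone_def h_def)
  ultimately have "h p = \<rho> p" for p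
    using rho_pos[of p] by (metis less_imp_le power2_eq_imp_eq)
  then show "\<phi> = \<psi>" using eq by (auto simp: \<psi>_def)
qed

lemma clift_eq: "clift f = (\<lambda>p. cvec (\<psi> p))"
  by (auto simp: clift_def nlift_eq)

lemma smooth_clift: "smooth (clift f)"
  unfolding clift_eq by (rule smooth_cvec[OF smooth_psi])

lemma dir_clift: "dir v (clift f) p = cvec (dir v \<psi> p)"
  unfolding clift_eq by (rule dir_bounded_linear[OF bounded_linear_cvec smooth_differentiable[OF smooth_psi]])

lemma vdz_clift: "vdz (clift f) p = (1 / 2) *s (cvec (dir 1 \<psi> p) - \<i> *s cvec (dir \<i> \<psi> p))"
  and vdzbar_clift: "vdzbar (clift f) p = (1 / 2) *s (cvec (dir 1 \<psi> p) + \<i> *s cvec (dir \<i> \<psi> p))"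
  by (simp_all add: vdz_dir vdzbar_dir smooth_differentiable[OF smooth_clift] dir_clift)

sublocale lift "clift f"
proof
  show "smooth (clift f)" by (rule smooth_clift)
  fix p
  show "vcnj (clift f p) = clift f p" "lor (clift f p) (clift f p) = 0"
    by (simp_all add: clift_eq lor_cvec psi_null)
  show "lor (vdz (clift f) p) (vdz (clift f) p) = 0" "lor (vdz (clift f) p) (vdzbar (clift f) p) = 1 / 2"
    unfolding vdz_clift vdzbar_clift by (simp_all add: lor_simps lor_cvec psi_metric inner_complex_def)
qed

abbreviation mixed where "mixed \<equiv> mixed_deriv f"

lemma cvec_mixed: "cvec (mixed p) = Y12 p"
proof -
  have "mixed p = vRe (Y12 p)"
    unfolding mixed_deriv_def Y12_def Y2_def by (simp add: vdz_vdzbar[OF smooth_clift])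
  moreover have "vcnj (Y12 p) = Y12 p" by (rule Y_conj)
  ultimately show ?thesis
    by (auto simp: cvec_def vRe_def vcnj_def vec_eq_iff complex_eq_iff)
qed

lemma smooth_mixed: "smooth mixed"
proof -
  have "mixed = (\<lambda>p. vRe (Y12 p))" by (metis cvec_mixed vRe_cvec)
  then show ?thesis using smooth_vRe[OF smooth_Y(4)] by simp
qed

lemma dir_psi_decomp: "dir v \<psi> p = Re v *\<^sub>R dir 1 \<psi> p + Im v *\<^sub>R dir \<i> \<psi> p"
proof -
  have "Re v *\<^sub>R 1 + Im v *\<^sub>R \<i> = v" by (simp add: complex_eq_iff)
  then show ?thesis
    using dir_add_dir[OF smooth_differentiable[OF smooth_psi], of "Re v *\<^sub>R 1" "Im v *\<^sub>R \<i>" p]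
      dir_scaleR_dir[OF smooth_differentiable[OF smooth_psi]] by simp
qed

lemma lor_mixed: "lor (mixed p) (\<psi> p) = - 1 / 2" "lor (mixed p) (dir v \<psi> p) = 0"
proof -
  have "of_real (lor (mixed p) (\<psi> p)) = (- 1 / 2 :: complex)"
    using gram2(3)[of p] by (simp only: lor_cvec[symmetric] cvec_mixed clift_eq)
  then have "complex_of_real (lor (mixed p) (\<psi> p)) = complex_of_real (- 1 / 2)" by simp
  then show "lor (mixed p) (\<psi> p) = - 1 / 2" using of_real_eq_iff by blast
  have x: "cvec (dir 1 \<psi> p) = Y1 p + Y2 p" "\<i> *s cvec (dir \<i> \<psi> p) = Y2 p - Y1 p"
    unfolding Y1_def Y2_def vdz_clift vdzbar_clift by (auto simp: vec_eq_iff)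
  have "complex_of_real (lor (mixed p) (dir 1 \<psi> p)) = 0" "\<i> * complex_of_real (lor (mixed p) (dir \<i> \<psi> p)) = 0"
    unfolding lor_cvec[symmetric] lor_smult_right[symmetric] x cvec_mixed
    by (simp_all add: lor_simps gram2)
  then have 0: "lor (mixed p) (dir 1 \<psi> p) = 0" "lor (mixed p) (dir \<i> \<psi> p) = 0" by simp_all
  show "lor (mixed p) (dir v \<psi> p) = 0"
    by (subst dir_psi_decomp) (simp add: lor_simps lor_scaleR_right 0)
qed

lemma V_fib_eq: "V_fib f p = span ({\<psi> p} \<union> range (\<lambda>v. dir v \<psi> p) \<union> {mixed p})"
  by (simp add: V_fib_def nlift_eq dir_def[abs_def])

lemma V_perp_iff: "v \<in> V_perp f p \<longleftrightarrow> lor v (\<psi> p) = 0 \<and> (\<forall>w. lor v (dir w \<psi> p) = 0) \<and> lor v (mixed p) = 0"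
proof
  assume "v \<in> V_perp f p"
  then have "lor v w = 0" if "w \<in> {\<psi> p} \<union> range (\<lambda>v. dir v \<psi> p) \<union> {mixed p}" for w
    using span_base[OF that] by (simp only: V_perp_def V_fib_eq mem_Collect_eq)
  then show "lor v (\<psi> p) = 0 \<and> (\<forall>w. lor v (dir w \<psi> p) = 0) \<and> lor v (mixed p) = 0" by simp
next
  assume *: "lor v (\<psi> p) = 0 \<and> (\<forall>w. lor v (dir w \<psi> p) = 0) \<and> lor v (mixed p) = 0"
  have "lor v w = 0" if "w \<in> V_fib f p" for w
    using that unfolding V_fib_eq
  proof (induction w rule: span_induct_alt)
    case (step c x y)
    then show ?case using * by (auto simp: lor_simps lor_scaleR_right)
  qed (simp add: lor_simps)
  then show "v \<in> V_perp f p" by (simp add: V_perp_def)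
qed

lemma V_perp_iff2: "v \<in> V_perp f p \<longleftrightarrow>
    lor v (\<psi> p) = 0 \<and> lor v (dir 1 \<psi> p) = 0 \<and> lor v (dir \<i> \<psi> p) = 0 \<and> lor v (mixed p) = 0"
proof -
  have "lor v (dir w \<psi> p) = Re w * lor v (dir 1 \<psi> p) + Im w * lor v (dir \<i> \<psi> p)" for w
    by (subst dir_psi_decomp) (simp add: lor_simps lor_scaleR_right)
  then show ?thesis unfolding V_perp_iff by (metis add_0 mult_zero_right)
qed

lemma V_perp_add: "v \<in> V_perp f p \<Longrightarrow> w \<in> V_perp f p \<Longrightarrow> v + w \<in> V_perp f p"
  and V_perp_diff: "v \<in> V_perp f p \<Longrightarrow> w \<in> V_perp f p \<Longrightarrow> v - w \<in> V_perp f p"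
  and V_perp_scale: "v \<in> V_perp f p \<Longrightarrow> c *\<^sub>R v \<in> V_perp f p"
  and V_perp_0: "0 \<in> V_perp f p"
  by (simp_all add: V_perp_iff2 lor_simps lor_scaleR_left)

lemma perp_iff: "perp p v \<longleftrightarrow> vRe v \<in> V_perp f p \<and> vIm v \<in> V_perp f p"
proof -
  have Y12: "Y1 p = (1 / 2) *s (cvec (dir 1 \<psi> p) - \<i> *s cvec (dir \<i> \<psi> p))"
    "Y2 p = (1 / 2) *s (cvec (dir 1 \<psi> p) + \<i> *s cvec (dir \<i> \<psi> p))"
    unfolding Y1_def Y2_def vdz_clift vdzbar_clift by auto
  have cl: "clift f p = cvec (\<psi> p)" by (simp add: clift_eq)
  let ?l = "\<lambda>w. lor v (cvec w)"
  have l: "?l w = Complex (lor (vRe v) w) (lor (vIm v) w)" for w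
    by (subst vec_Re_Im[of v]) (simp add: lor_simps lor_cvec complex_eq_iff)
  have "?l (dir 1 \<psi> p) - \<i> * ?l (dir \<i> \<psi> p) = 0 \<and> ?l (dir 1 \<psi> p) + \<i> * ?l (dir \<i> \<psi> p) = 0 \<longleftrightarrow>
      ?l (dir 1 \<psi> p) = 0 \<and> ?l (dir \<i> \<psi> p) = 0"
    by (auto simp: complex_eq_iff)
  then have "perp p v \<longleftrightarrow> ?l (\<psi> p) = 0 \<and> ?l (dir 1 \<psi> p) = 0 \<and> ?l (dir \<i> \<psi> p) = 0 \<and> ?l (mixed p) = 0"
    unfolding perp_def Y12 cvec_mixed[symmetric] unfolding cl
    by (simp only: lor_smult_right lor_diff_right lor_add_right mult_eq_0_iff) auto
  then show ?thesis by (auto simp: l V_perp_iff2 complex_eq_iff)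
qed

lemma V_perp_complex_iff: "v \<in> V_perp_complex f p \<longleftrightarrow> perp p v"
  by (simp add: V_perp_complex_def perp_iff)

lemma hopf_eq: "hopf f = \<kappa>"
proof -
  have "schwarzian f = Sc"
    by (rule ext) (simp add: schwarzian_def V_perp_complex_iff perp_scale[unfolded Y11_def Y1_def])
  then show ?thesis
    by (intro ext) (simp add: hopf_def \<kappa>_def Y11_def Y1_def)
qed

lemma willmore_eq: "willmore \<omega>1 \<omega>2 f = torus_integral \<omega>1 \<omega>2 (\<lambda>p. Re (L p))"
  by (simp add: willmore_def hopf_eq lor_\<kappa>_cnj)

end

lemma conformal_immersionD:
  assumes "conformal_immersion \<omega>1 \<omega>2 f"
  shows "conformal f" and "on_torus \<omega>1 \<omega>2 f"
proof -
  have "f p \<in> range f" for p by (rule rangeI)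
  then have "norm (f p) = 1" for p using assms unfolding conformal_immersion_def by force
  then have "f p \<bullet> f p = 1" for p by (simp add: norm_eq_1)
  then show "conformal f" "on_torus \<omega>1 \<omega>2 f"
    using assms by (auto simp: conformal_immersion_def conformal_def smooth_on_torus_def dir_def)
qed


section \<open>Determinants and orthogonality in \<open>\<real>\<^sup>5\<close>\<close>

lemma exhaust_5:
  fixes x :: 5
  shows "x = 1 \<or> x = 2 \<or> x = 3 \<or> x = 4 \<or> x = 5"
proof (induct x)
  case (of_int z)
  then have "0 \<le> z" and "z < 5" by simp_all
  then have "z = 0 \<or> z = 1 \<or> z = 2 \<or> z = 3 \<or> z = 4" by arith
  then show ?case by auto
qed

lemma forall_5: "(\<forall>i::5. P i) \<longleftrightarrow> P 1 \<and> P 2 \<and> P 3 \<and> P 4 \<and> P 5"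
  by (metis exhaust_5)

lemma UNIV_5: "UNIV = {1, 2, 3, 4, 5 :: 5}"
  using exhaust_5 by auto

lemma vector_5 [simp]:
  "(vector [a, b, c, d, e] :: 'a::zero ^ 5) $ 1 = a"
  "(vector [a, b, c, d, e] :: 'a ^ 5) $ 2 = b"
  "(vector [a, b, c, d, e] :: 'a ^ 5) $ 3 = c"
  "(vector [a, b, c, d, e] :: 'a ^ 5) $ 4 = d"
  "(vector [a, b, c, d, e] :: 'a ^ 5) $ 5 = e"
  unfolding vector_def by simp_all

definition det5 :: "real ^ 5 \<Rightarrow> real ^ 5 \<Rightarrow> real ^ 5 \<Rightarrow> real ^ 5 \<Rightarrow> real ^ 5 \<Rightarrow> real" where
  "det5 a b c d e = det (vector [a, b, c, d, e] :: real ^ 5 ^ 5)"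

lemma det5_add: "det5 a b c d (x + y) = det5 a b c d x + det5 a b c d y"
  "det5 a b c (x + y) e = det5 a b c x e + det5 a b c y e"
proof -
  define R where "R i = (vector [a, b, c, d, e] :: real ^ 5 ^ 5) $ i" for i
  have *: "(vector [a, b, c, d, x] :: real ^ 5 ^ 5) = (\<chi> i. if i = 5 then x else R i)"
    "(vector [a, b, c, x, e] :: real ^ 5 ^ 5) = (\<chi> i. if i = 4 then x else R i)" for x
    by (simp_all add: vec_eq_iff[of _ "vec_lambda _"] forall_5 R_def)
  show "det5 a b c d (x + y) = det5 a b c d x + det5 a b c d y"
    "det5 a b c (x + y) e = det5 a b c x e + det5 a b c y e"
    unfolding det5_def * by (rule det_row_add)+
qed

lemma det5_scale: "det5 a b c d (k *\<^sub>R x) = k * det5 a b c d x"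
proof -
  define R where "R i = (vector [a, b, c, d, 0] :: real ^ 5 ^ 5) $ i" for i
  have *: "(vector [a, b, c, d, x] :: real ^ 5 ^ 5) = (\<chi> i. if i = 5 then x else R i)" for x
    by (simp add: vec_eq_iff[of _ "vec_lambda _"] forall_5 R_def)
  show ?thesis
    unfolding det5_def * scalar_mult_eq_scaleR[symmetric] by (rule det_row_mul)
qed

lemma det5_eq_0: "det5 a b c d a = 0" "det5 a b c d b = 0" "det5 a b c d c = 0" "det5 a b c d d = 0"
proof -
  show "det5 a b c d a = 0" unfolding det5_def by (rule det_identical_rows[of 1 5]) (simp_all add: row_def vec_eq_iff)
  show "det5 a b c d b = 0" unfolding det5_def by (rule det_identical_rows[of 2 5]) (simp_all add: row_def vec_eq_iff)
  show "det5 a b c d c = 0" unfolding det5_def by (rule det_identical_rows[of 3 5]) (simp_all add: row_def vec_eq_iff)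
  show "det5 a b c d d = 0" unfolding det5_def by (rule det_identical_rows[of 4 5]) (simp_all add: row_def vec_eq_iff)
qed

lemma det5_skew: "det5 a b c e d = - det5 a b c d e"
proof -
  have "0 = det5 a b c (d + e) (d + e)" by (simp add: det5_eq_0)
  also have "\<dots> = det5 a b c e d + det5 a b c d e" unfolding det5_add by (simp add: det5_eq_0)
  finally show ?thesis by linarith
qed

definition orth5 :: "real ^ 5 \<Rightarrow> real ^ 5 \<Rightarrow> real ^ 5 \<Rightarrow> real ^ 5 \<Rightarrow> real ^ 5 \<Rightarrow> bool" where
  "orth5 a b c d e \<longleftrightarrow> a \<bullet> b = 0 \<and> a \<bullet> c = 0 \<and> a \<bullet> d = 0 \<and> a \<bullet> e = 0 \<and> b \<bullet> c = 0 \<and> b \<bullet> d = 0 \<and>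
     b \<bullet> e = 0 \<and> c \<bullet> d = 0 \<and> c \<bullet> e = 0 \<and> d \<bullet> e = 0"

lemma det5_orth:
  assumes "orth5 a b c d e"
  shows "(det5 a b c d e)\<^sup>2 = (a \<bullet> a) * (b \<bullet> b) * (c \<bullet> c) * (d \<bullet> d) * (e \<bullet> e)"
proof -
  let ?A = "vector [a, b, c, d, e] :: real ^ 5 ^ 5"
  have G: "(?A ** transpose ?A) $ i $ j = ?A $ i \<bullet> ?A $ j" for i j
    by (simp add: matrix_matrix_mult_def transpose_def inner_vec_def)
  have "(det5 a b c d e)\<^sup>2 = det (?A ** transpose ?A)"
    by (simp add: det5_def det_mul det_transpose power2_eq_square)
  also have "\<dots> = prod (\<lambda>i. (?A ** transpose ?A) $ i $ i) UNIV"
  proof (rule det_diagonal)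
    fix i j :: 5 assume "i \<noteq> j"
    then show "(?A ** transpose ?A) $ i $ j = 0"
      unfolding G using assms exhaust_5[of i] exhaust_5[of j]
      by (auto simp: orth5_def inner_commute)
  qed
  also have "\<dots> = (a \<bullet> a) * (b \<bullet> b) * (c \<bullet> c) * (d \<bullet> d) * (e \<bullet> e)"
    unfolding G UNIV_5 by (simp add: mult.assoc)
  finally show ?thesis .
qed

lemma orth5_complete:
  assumes "orth5 a b c d e" "a \<noteq> 0" "b \<noteq> 0" "c \<noteq> 0" "d \<noteq> 0" "e \<noteq> 0"
    and "a \<bullet> u = 0" "b \<bullet> u = 0" "c \<bullet> u = 0" "d \<bullet> u = 0" "e \<bullet> u = 0"
  shows "u = 0"
proof -
  let ?A = "vector [a, b, c, d, e] :: real ^ 5 ^ 5"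
  have "(det ?A)\<^sup>2 \<noteq> 0" using det5_orth[OF assms(1)] assms(2-6) by (simp add: det5_def)
  then have "invertible ?A" by (simp add: invertible_det_nz)
  then obtain A' where "A' ** ?A = mat 1" unfolding invertible_def by blast
  moreover have "?A *v u = 0"
  proof -
    have "(?A *v u) $ i = ?A $ i \<bullet> u" for i by (simp add: matrix_vector_mult_def inner_vec_def)
    then show ?thesis using assms(7-11) by (simp add: vec_eq_iff forall_5)
  qed
  ultimately show ?thesis
    by (metis matrix_vector_mul_assoc matrix_vector_mul_lid matrix_vector_mult_0_right)
qed

text \<open>The vector product of four vectors in dimension five.\<close>

definition cross5 :: "real ^ 5 \<Rightarrow> real ^ 5 \<Rightarrow> real ^ 5 \<Rightarrow> real ^ 5 \<Rightarrow> real ^ 5" where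
  "cross5 a b c d = (\<chi> i. det5 a b c d (axis i 1))"

lemma det5_sum: "finite X \<Longrightarrow> det5 a b c d (\<Sum>i\<in>X. h i) = (\<Sum>i\<in>X. det5 a b c d (h i))"
  by (induct rule: finite_induct) (use det5_scale[of a b c d 0 0] in \<open>auto simp: det5_add\<close>)

lemma inner_cross5: "cross5 a b c d \<bullet> w = det5 a b c d w"
proof -
  have "w = (\<Sum>i\<in>UNIV. w $ i *\<^sub>R axis i 1)"
    by (simp add: vec_eq_iff axis_def if_distrib cong: if_cong)
  then have "det5 a b c d w = (\<Sum>i\<in>UNIV. w $ i * det5 a b c d (axis i 1))"
    by (metis (no_types, lifting) det5_sum det5_scale finite_class.finite_UNIV sum.cong)
  then show ?thesis by (simp add: cross5_def inner_vec_def mult.commute)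
qed

lemma cross5_orth:
  assumes "a \<bullet> b = 0" "a \<bullet> c = 0" "a \<bullet> d = 0" "b \<bullet> c = 0" "b \<bullet> d = 0" "c \<bullet> d = 0"
  shows "orth5 a b c d (cross5 a b c d)"
  using assms by (simp add: orth5_def inner_commute[of _ "cross5 _ _ _ _"] inner_cross5 det5_eq_0)

text \<open>
  The squared determinant of five orthogonal rows is the product of their squared lengths, and the determinant of
  the four vectors and their vector product is the squared length of the latter. This leaves the
  case that the vector product vanishes; then the determinant with a nonzero vector orthogonal to
  the four shows that one of them is 0.
\<close>

lemma norm_cross5:
  assumes o: "a \<bullet> b = 0" "a \<bullet> c = 0" "a \<bullet> d = 0" "b \<bullet> c = 0" "b \<bullet> d = 0" "c \<bullet> d = 0"
  shows "cross5 a b c d \<bullet> cross5 a b c d = (a \<bullet> a) * (b \<bullet> b) * (c \<bullet> c) * (d \<bullet> d)"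
proof (cases "cross5 a b c d = 0")
  case False
  let ?e = "cross5 a b c d"
  have "(?e \<bullet> ?e) * (?e \<bullet> ?e) = ((a \<bullet> a) * (b \<bullet> b) * (c \<bullet> c) * (d \<bullet> d)) * (?e \<bullet> ?e)"
    using det5_orth[OF cross5_orth[OF o]] by (simp add: inner_cross5 power2_eq_square)
  then show ?thesis using False by simp
next
  case True
  obtain w where w: "w \<noteq> 0" "\<And>y. y \<in> span {a, b, c, d} \<Longrightarrow> orthogonal w y"
  proof (rule orthogonal_to_subspace_exists[of "{a, b, c, d}"])
    have "dim {a, b, c, d} \<le> card {a, b, c, d}" by (rule dim_le_card') simp
    also have "\<dots> \<le> 4" by (simp add: card_insert_if)
    finally show "dim {a, b, c, d} < DIM(real ^ 5)" by simp
  qed blast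
  then have "orthogonal w a" "orthogonal w b" "orthogonal w c" "orthogonal w d" by (simp_all add: span_base)
  then have "orth5 a b c d w" using o by (simp add: orth5_def orthogonal_def inner_commute)
  then have "(a \<bullet> a) * (b \<bullet> b) * (c \<bullet> c) * (d \<bullet> d) * (w \<bullet> w) = 0"
    using det5_orth[of a b c d w] inner_cross5[of a b c d w] True by simp
  then show ?thesis using True w(1) by auto
qed


section \<open>The rotation of the normal bundle\<close>

context conformal
begin

lemma perp_frame: "f p \<bullet> dx f p = 0" "f p \<bullet> dy f p = 0" "dx f p \<bullet> dy f p = 0"
  "dx f p \<bullet> dx f p = rr p" "dy f p \<bullet> dy f p = rr p"
  unfolding dx_dir dy_dir using f_perp_df by (simp_all add: conf_rr inner_complex_def)

definition normal :: "complex \<Rightarrow> real ^ 5 \<Rightarrow> bool" where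
  "normal p n \<longleftrightarrow> n \<bullet> f p = 0 \<and> n \<bullet> dx f p = 0 \<and> n \<bullet> dy f p = 0"

definition JN :: "complex \<Rightarrow> real ^ 5 \<Rightarrow> real ^ 5" where
  "JN p n = (1 / rr p) *\<^sub>R cross5 (f p) (dx f p) (dy f p) n"

lemma inner_JN: "JN p n \<bullet> w = det5 (f p) (dx f p) (dy f p) n w / rr p"
  by (simp add: JN_def inner_cross5)

lemma normal_JN: "normal p (JN p n)" and JN_orth: "JN p n \<bullet> n = 0"
  by (simp_all add: normal_def inner_JN det5_eq_0)

lemma norm_JN: assumes "normal p n" shows "JN p n \<bullet> JN p n = n \<bullet> n"
proof -
  have "cross5 (f p) (dx f p) (dy f p) n \<bullet> cross5 (f p) (dx f p) (dy f p) n = 1 * rr p * rr p * (n \<bullet> n)"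
    using norm_cross5[of "f p" "dx f p" "dy f p" n] assms perp_frame[of p] sphere[of p]
    by (simp add: normal_def inner_commute)
  then show ?thesis using rr_pos[of p] by (simp add: JN_def)
qed

lemma normal_rank2:
  assumes "normal p n" "n \<noteq> 0" "normal p u" "u \<bullet> n = 0" "u \<bullet> JN p n = 0"
  shows "u = 0"
proof (rule orth5_complete[of "f p" "dx f p" "dy f p" n "JN p n"])
  show "orth5 (f p) (dx f p) (dy f p) n (JN p n)"
    using perp_frame[of p] assms(1) normal_JN[of p n] JN_orth[of p n]
    by (simp add: orth5_def normal_def inner_commute)
  show "f p \<noteq> 0" "dx f p \<noteq> 0" "dy f p \<noteq> 0"
    using sphere[of p] perp_frame(4,5)[of p] rr_pos[of p] by (metis inner_zero_left less_irrefl zero_neq_one)+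
  show "JN p n \<noteq> 0" using norm_JN[OF assms(1)] assms(2) by (metis inner_eq_zero_iff)
qed (use assms in \<open>auto simp: normal_def inner_commute\<close>)

lemma to_normal_decomp: "v = space_part (to_normal f p v) + (v $ None) *\<^sub>R null_vec (f p)"
  by (auto simp: vec_eq_iff space_part_def to_normal_def null_vec_def split: option.splits)

lemma lor_nv_mixed: "lor (null_vec (f p)) (mixed p) = - 1 / (2 * \<rho> p)"
proof -
  have "\<rho> p * lor (null_vec (f p)) (mixed p) = - 1 / 2"
    using lor_mixed(1)[of p] by (simp add: \<psi>_def lor_scaleR_right lor_commute)
  then show ?thesis using rho_pos[of p] by (simp add: field_simps)
qed

lemma lor_nv: "v \<in> V_perp f p \<Longrightarrow> lor v (null_vec (f p)) = 0"
  using rho_pos[of p] by (simp add: V_perp_iff \<psi>_def lor_scaleR_right)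

lemma lor_df: "v \<in> V_perp f p \<Longrightarrow> lor v (space_part (dir w f p)) = 0"
proof -
  assume v: "v \<in> V_perp f p"
  have "dir w \<psi> p = \<rho> p *\<^sub>R space_part (dir w f p) + dir w \<rho> p *\<^sub>R null_vec (f p)"
    unfolding \<psi>_def[abs_def] by (rule scaled_null_vec) (rule smooth_differentiable[OF smooth_rho])
  moreover have "lor v (dir w \<psi> p) = 0" using v by (simp add: V_perp_iff)
  ultimately show ?thesis
    using lor_nv[OF v] rho_pos[of p] by (simp add: lor_simps lor_scaleR_right)
qed

lemma normal_to_normal: assumes "v \<in> V_perp f p" shows "normal p (to_normal f p v)"
proof -
  have "to_normal f p v \<bullet> f p = lor v (null_vec (f p))"
    "to_normal f p v \<bullet> dir w f p = lor v (space_part (dir w f p))" for w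
    by (subst (2) to_normal_decomp[of v p],
        simp add: lor_simps lor_scaleR_left lor_space_null_vec lor_null_vec lor_space_space lor_null_vec_space sphere f_perp_df)+
  then show ?thesis using lor_nv[OF assms] lor_df[OF assms] by (simp add: normal_def dx_dir dy_dir)
qed

lemma lor_to_normal:
  assumes "v \<in> V_perp f p" "w \<in> V_perp f p"
  shows "lor v w = to_normal f p v \<bullet> to_normal f p w"
proof -
  have n: "f p \<bullet> to_normal f p w = 0" using normal_to_normal[OF assms(2)] by (simp add: normal_def inner_commute)
  have "lor v w = lor v (space_part (to_normal f p w)) + (w $ None) * lor v (null_vec (f p))"
    by (subst to_normal_decomp[of w p]) (simp add: lor_simps lor_scaleR_right)
  also have "\<dots> = lor v (space_part (to_normal f p w))" by (simp add: lor_nv[OF assms(1)])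
  also have "\<dots> = to_normal f p v \<bullet> to_normal f p w"
    by (subst to_normal_decomp[of v p]) (simp add: lor_simps lor_scaleR_left lor_space_space lor_null_vec_space n)
  finally show ?thesis .
qed

lemma to_normal_eq_0: assumes "v \<in> V_perp f p" "to_normal f p v = 0" shows "v = 0"
proof -
  have v: "v = (v $ None) *\<^sub>R null_vec (f p)"
    using to_normal_decomp[of v p] assms(2) linear_0[OF bounded_linear.linear[OF bounded_linear_space_part]] by simp
  have "lor v (mixed p) = 0" using assms(1) by (simp add: V_perp_iff)
  then have "(v $ None) * lor (null_vec (f p)) (mixed p) = 0"
    using lor_scaleR_left[of "v $ None" "null_vec (f p)" "mixed p"] v by simp
  then have "v $ None = 0" using lor_nv_mixed[of p] rho_pos[of p] by simp
  then show ?thesis using v by simp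
qed

lemma V_perp_pos: assumes "v \<in> V_perp f p" shows "lor v v \<ge> 0" "lor v v = 0 \<Longrightarrow> v = 0"
  using lor_to_normal[OF assms assms] to_normal_eq_0[OF assms] by auto

lemma V_perp_eqI:
  assumes "v \<in> V_perp f p" "w \<in> V_perp f p" "\<And>u. u \<in> V_perp f p \<Longrightarrow> lor v u = lor w u"
  shows "v = w"
  using V_perp_pos(2)[OF V_perp_diff[OF assms(1,2)]] assms(3)[OF V_perp_diff[OF assms(1,2)]]
  by (simp add: lor_diff_left)

text \<open>
  The inverse of the isometry \<open>to_normal\<close>: adding multiples of the null vector changes no scalar product
  with \<open>\<psi>\<close> and its first derivatives, and the right multiple achieves orthogonality to the mixed derivative.
\<close>

definition from_normal :: "complex \<Rightarrow> real ^ 5 \<Rightarrow> lor_real" where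
  "from_normal p n = space_part n + (2 * \<rho> p * lor (space_part n) (mixed p)) *\<^sub>R null_vec (f p)"

lemma to_from_normal: "to_normal f p (from_normal p n) = n"
  by (simp add: to_normal_def from_normal_def space_part_def null_vec_def vec_eq_iff)

lemma from_normal_in: assumes "normal p n" shows "from_normal p n \<in> V_perp f p"
proof -
  have nv: "lor (from_normal p n) (null_vec (f p)) = 0"
    using assms by (simp add: from_normal_def lor_simps lor_scaleR_left lor_space_null_vec lor_null_vec sphere normal_def)
  have df: "lor (from_normal p n) (space_part (dir 1 f p)) = 0" "lor (from_normal p n) (space_part (dir \<i> f p)) = 0"
    using assms by (simp_all add: from_normal_def lor_simps lor_scaleR_left lor_space_space lor_null_vec_space f_perp_df normal_def dx_dir dy_dir)
  have dpsi: "dir w \<psi> p = \<rho> p *\<^sub>R space_part (dir w f p) + dir w \<rho> p *\<^sub>R null_vec (f p)" for w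
    unfolding \<psi>_def[abs_def] by (rule scaled_null_vec) (rule smooth_differentiable[OF smooth_rho])
  have "lor (from_normal p n) (mixed p) = 0"
    using rho_pos[of p] by (simp add: from_normal_def lor_simps lor_scaleR_left lor_nv_mixed)
  then show ?thesis
    unfolding V_perp_iff2 dpsi by (simp add: \<psi>_def lor_simps lor_scaleR_right nv df)
qed

lemma to_normal_inject:
  assumes "v \<in> V_perp f p" "w \<in> V_perp f p" "to_normal f p v = to_normal f p w"
  shows "v = w"
proof -
  have "to_normal f p (v - w) = to_normal f p v - to_normal f p w"
    by (simp add: to_normal_def vec_eq_iff algebra_simps)
  then show ?thesis using to_normal_eq_0[OF V_perp_diff[OF assms(1,2)]] assms(3) by simp
qed

abbreviation J where "J \<equiv> rotJ f"

text \<open>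
  Transported to the normal space of \<open>f\<close> in the sphere, the rotation is the normalized vector
  product \<open>JN\<close>. A normal vector orthogonal to \<open>n\<close> is a multiple of \<open>JN p n\<close>, and length and orientation fix the factor.
\<close>

lemma rotJ_eq:
  assumes v: "v \<in> V_perp f p"
  shows "J p v = from_normal p (JN p (to_normal f p v))"
  unfolding rotJ_def
proof (rule the_equality)
  let ?n = "to_normal f p v" and ?w = "from_normal p (JN p (to_normal f p v))"
  note n = normal_to_normal[OF v]
  have w: "?w \<in> V_perp f p" by (rule from_normal_in[OF normal_JN])
  have "det5 (f p) (dx f p) (dy f p) ?n (JN p ?n) > 0" if "v \<noteq> 0"
  proof -
    have "?n \<noteq> 0" using to_normal_eq_0[OF v] that by blast
    then have "0 < JN p ?n \<bullet> JN p ?n" using norm_JN[OF n] by simp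
    then have "0 < det5 (f p) (dx f p) (dy f p) ?n (JN p ?n) / rr p" unfolding inner_JN[of p ?n "JN p ?n"] .
    then show ?thesis using rr_pos[of p] by (simp only: zero_less_divide_iff) auto
  qed
  moreover have "lor ?w ?w = lor v v"
    using lor_to_normal[OF w w] lor_to_normal[OF v v] by (simp add: to_from_normal norm_JN[OF n])
  moreover have "lor v ?w = 0"
    using lor_to_normal[OF v w] JN_orth[of p ?n] inner_commute[of ?n "JN p ?n"] by (simp add: to_from_normal)
  ultimately show "?w \<in> V_perp f p \<and> lor ?w ?w = lor v v \<and> lor v ?w = 0 \<and> (v \<noteq> 0 \<longrightarrow>
      0 < det (vector [f p, dx f p, dy f p, to_normal f p v, to_normal f p ?w] :: real ^ 5 ^ 5))"
    using w by (simp add: to_from_normal det5_def)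
  fix u assume u: "u \<in> V_perp f p \<and> lor u u = lor v v \<and> lor v u = 0 \<and> (v \<noteq> 0 \<longrightarrow>
      0 < det (vector [f p, dx f p, dy f p, to_normal f p v, to_normal f p u] :: real ^ 5 ^ 5))"
  let ?m = "to_normal f p u"
  have m: "normal p ?m" "?m \<bullet> ?m = ?n \<bullet> ?n" "?m \<bullet> ?n = 0"
    using u normal_to_normal[of u p] lor_to_normal[of u p u] lor_to_normal[OF v v] lor_to_normal[of v p u] v
      inner_commute[of ?m ?n] by simp_all
  have "?m = JN p ?n"
  proof (cases "v = 0")
    case True
    then have "?n = 0" by (simp add: to_normal_def vec_eq_iff)
    then show ?thesis using m norm_JN[OF n] by simp
  next
    case False
    have n0: "?n \<noteq> 0" using to_normal_eq_0[OF v] False by blast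
    define c where "c = (?m \<bullet> JN p ?n) / (?n \<bullet> ?n)"
    have "JN p ?n \<bullet> ?m > 0" using u False rr_pos[of p] by (simp add: inner_JN det5_def)
    then have "c > 0" using n0 by (simp add: c_def inner_commute)
    have "?m - c *\<^sub>R JN p ?n = 0"
    proof (rule normal_rank2[OF n n0])
      show "normal p (?m - c *\<^sub>R JN p ?n)" using m(1) normal_JN[of p ?n] by (simp add: normal_def inner_diff_left)
      show "(?m - c *\<^sub>R JN p ?n) \<bullet> ?n = 0" using m by (simp add: inner_diff_left JN_orth)
      show "(?m - c *\<^sub>R JN p ?n) \<bullet> JN p ?n = 0" using n0 by (simp add: inner_diff_left norm_JN[OF n] c_def)
    qed
    then have mc: "?m = c *\<^sub>R JN p ?n" by simp
    then have "c * c * (?n \<bullet> ?n) = ?n \<bullet> ?n" using m(2) norm_JN[OF n] by simp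
    then have "c * c = 1" using n0 by simp
    then have "c = 1" using \<open>c > 0\<close> by (simp add: square_eq_1_iff)
    then show ?thesis using mc by simp
  qed
  then show "u = ?w" using to_normal_inject[of u p ?w] u w by (simp add: to_from_normal)
qed

lemma to_normal_J: "v \<in> V_perp f p \<Longrightarrow> to_normal f p (J p v) = JN p (to_normal f p v)"
  by (simp add: rotJ_eq to_from_normal)

lemma J_in: "v \<in> V_perp f p \<Longrightarrow> J p v \<in> V_perp f p"
  by (simp add: rotJ_eq from_normal_in normal_JN)

lemma lor_J: "v \<in> V_perp f p \<Longrightarrow> w \<in> V_perp f p \<Longrightarrow>
    lor (J p v) w = det5 (f p) (dx f p) (dy f p) (to_normal f p v) (to_normal f p w) / rr p"
  using lor_to_normal[OF J_in] by (simp add: to_normal_J inner_JN)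

lemma J_skew: "v \<in> V_perp f p \<Longrightarrow> w \<in> V_perp f p \<Longrightarrow> lor (J p v) w = - lor (J p w) v"
  by (subst lor_J, assumption+, subst det5_skew) (simp add: lor_J)

lemma J_self: "v \<in> V_perp f p \<Longrightarrow> lor (J p v) v = 0"
  using J_skew[of v p v] by simp

lemma J_isom: "v \<in> V_perp f p \<Longrightarrow> lor (J p v) (J p v) = lor v v"
  using lor_to_normal[OF J_in J_in] lor_to_normal[of v p v] by (simp add: to_normal_J norm_JN normal_to_normal)

text \<open>
  Linearity does not follow from the definition of \<open>rotJ\<close> directly, but \<open>\<langle>J v, u\<rangle> = - \<langle>J u, v\<rangle>\<close> is linear in \<open>v\<close>.
\<close>

lemma J_add: assumes "v \<in> V_perp f p" "w \<in> V_perp f p" shows "J p (v + w) = J p v + J p w"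
proof (rule V_perp_eqI)
  fix u assume u: "u \<in> V_perp f p"
  show "lor (J p (v + w)) u = lor (J p v + J p w) u"
    using J_skew[OF V_perp_add[OF assms] u] J_skew[OF assms(1) u] J_skew[OF assms(2) u] by (simp add: lor_simps)
qed (simp_all add: assms J_in V_perp_add)

lemma J_scale: assumes "v \<in> V_perp f p" shows "J p (c *\<^sub>R v) = c *\<^sub>R J p v"
proof (rule V_perp_eqI)
  fix u assume u: "u \<in> V_perp f p"
  show "lor (J p (c *\<^sub>R v)) u = lor (c *\<^sub>R J p v) u"
    using J_skew[OF V_perp_scale[OF assms] u] J_skew[OF assms(1) u] by (simp add: lor_scaleR_left lor_scaleR_right)
qed (simp_all add: assms J_in V_perp_scale)

lemma J_J: assumes v: "v \<in> V_perp f p" shows "J p (J p v) = - v"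
proof -
  have isom: "lor (J p v) (J p w) = lor v w" if w: "w \<in> V_perp f p" for w
    using J_isom[OF V_perp_add[OF v w]] J_isom[OF v] J_isom[OF w] lor_commute[of w v] lor_commute[of "J p w" "J p v"]
    by (simp add: J_add v w lor_simps)
  have m: "- v \<in> V_perp f p" using V_perp_scale[OF v, of "-1"] by simp
  show ?thesis
  proof (rule V_perp_eqI[OF J_in[OF J_in[OF v]] m])
    fix u assume u: "u \<in> V_perp f p"
    show "lor (J p (J p v)) u = lor (- v) u"
      using J_skew[OF J_in[OF v] u] isom[OF u] lor_commute[of "J p u"] by (simp add: lor_simps)
  qed
qed

text \<open>
  In \<open>\<real>\<^sup>5\<close> no nonzero vector is orthogonal to \<open>f\<close>, its two derivatives, a normal vector and the
  rotation of that vector.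
\<close>

lemma V_perp_expand:
  assumes e: "e \<in> V_perp f p" "e \<noteq> 0" and v: "v \<in> V_perp f p"
  shows "v = (lor v e / lor e e) *\<^sub>R e + (lor v (J p e) / lor e e) *\<^sub>R J p e"
proof -
  define u where "u = v - ((lor v e / lor e e) *\<^sub>R e + (lor v (J p e) / lor e e) *\<^sub>R J p e)"
  have ee: "lor e e \<noteq> 0" using V_perp_pos(2)[OF e(1)] e(2) by blast
  have u: "u \<in> V_perp f p"
    unfolding u_def by (intro V_perp_diff V_perp_add V_perp_scale e v J_in)
  have "lor u e = 0" "lor u (J p e) = 0"
    using ee J_self[OF e(1)] J_isom[OF e(1)] lor_commute[of e "J p e"]
    by (simp_all add: u_def lor_simps lor_scaleR_left)
  then have "to_normal f p u \<bullet> to_normal f p e = 0" "to_normal f p u \<bullet> JN p (to_normal f p e) = 0"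
    using lor_to_normal[OF u e(1)] lor_to_normal[OF u J_in[OF e(1)]] to_normal_J[OF e(1)] by simp_all
  then have "to_normal f p u = 0"
    using normal_rank2[OF normal_to_normal[OF e(1)], of "to_normal f p u"] to_normal_eq_0[OF e(1)] e normal_to_normal[OF u]
    by auto
  then have "u = 0" by (rule to_normal_eq_0[OF u])
  then show ?thesis by (simp add: u_def)
qed

lemma V_perp_nontrivial: obtains e where "e \<in> V_perp f p" "e \<noteq> 0"
proof -
  obtain n where n: "n \<noteq> 0" "\<And>y. y \<in> span {f p, dx f p, dy f p} \<Longrightarrow> orthogonal n y"
  proof (rule orthogonal_to_subspace_exists[of "{f p, dx f p, dy f p}"])
    have "dim {f p, dx f p, dy f p} \<le> card {f p, dx f p, dy f p}" by (rule dim_le_card') simp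
    also have "\<dots> \<le> 3" by (simp add: card_insert_if)
    finally show "dim {f p, dx f p, dy f p} < DIM(real ^ 5)" by simp
  qed blast
  have "normal p n" using n(2) by (simp add: normal_def span_base orthogonal_def)
  moreover have "from_normal p n \<noteq> 0"
  proof
    assume "from_normal p n = 0"
    then have "n = to_normal f p 0" using to_from_normal[of p n] by simp
    then show False using n(1) by (simp add: to_normal_def vec_eq_iff)
  qed
  ultimately show ?thesis using that from_normal_in by blast
qed

lemma smooth_det5:
  assumes "smooth a" "smooth b" "smooth c" "smooth d" "smooth e"
  shows "smooth (\<lambda>p::complex. det5 (a p) (b p) (c p) (d p) (e p))"
proof -
  have entry: "smooth (\<lambda>p. (vector [a p, b p, c p, d p, e p] :: real ^ 5 ^ 5) $ i $ j)" for i j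
  proof -
    have "smooth (\<lambda>p. a p $ j)" "smooth (\<lambda>p. b p $ j)" "smooth (\<lambda>p. c p $ j)" "smooth (\<lambda>p. d p $ j)" "smooth (\<lambda>p. e p $ j)"
      by (rule smooth_on_vec_nth[OF open_UNIV]; fact)+
    then show ?thesis using exhaust_5[of i] by auto
  qed
  show ?thesis
    unfolding det5_def det_def
    by (intro smooth_on_sum smooth_on_mult smooth_on_const smooth_on_prod open_UNIV entry) simp_all
qed

lemma smooth_J:
  assumes s: "smooth s" "\<And>p. s p \<in> V_perp f p"
  shows "smooth (\<lambda>p. J p (s p))"
proof -
  have n: "smooth (\<lambda>p. to_normal f p (s p))"
    unfolding to_normal_def
    by (intro smooth_on_vec_lambda smooth_on_diff smooth_on_mult open_UNIV smooth_on_vec_nth s smooth_f)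
  have i: "smooth (\<lambda>p. inverse (rr p))" by (rule smooth_on_inverse[OF open_UNIV smooth_rr rr_pos])
  have jn: "smooth (\<lambda>p. JN p (to_normal f p (s p)))"
    unfolding JN_def cross5_def divide_inverse dx_dir dy_dir
    by (intro smooth_on_scaleR smooth_on_mult smooth_on_vec_lambda open_UNIV smooth_on_const i)
      (intro smooth_det5 smooth_f smooth_on_dir n smooth_on_const)
  have sp: "smooth (\<lambda>p. space_part (JN p (to_normal f p (s p))))"
    by (rule smooth_on_bounded_linear[OF open_UNIV bounded_linear_space_part jn])
  have "smooth (\<lambda>p. from_normal p (JN p (to_normal f p (s p))))"
    unfolding from_normal_def
    by (intro smooth_on_add smooth_on_scaleR smooth_on_mult open_UNIV sp smooth_on_const smooth_rho smooth_lor smooth_mixed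
        smooth_on_null_vec smooth_f)
  then show ?thesis using s(2) by (simp add: rotJ_eq)
qed

text \<open>The orthogonal projection to the normal bundle; \<open>nu\<close> is the null vector dual to \<open>\<psi>\<close>.\<close>

definition nu :: "complex \<Rightarrow> lor_real" where
  "nu p = 2 *\<^sub>R mixed p + (2 * lor (mixed p) (mixed p)) *\<^sub>R \<psi> p"

definition proj :: "complex \<Rightarrow> lor_real \<Rightarrow> lor_real" where
  "proj p v = v - lor v (dir 1 \<psi> p) *\<^sub>R dir 1 \<psi> p - lor v (dir \<i> \<psi> p) *\<^sub>R dir \<i> \<psi> p
    + lor v (nu p) *\<^sub>R \<psi> p + lor v (\<psi> p) *\<^sub>R nu p"

lemma psi_dpsi: "lor (\<psi> p) (dir v \<psi> p) = 0"
  using dir_bilinear[OF bounded_bilinear_lor, of \<psi> p \<psi> v] smooth_differentiable[OF smooth_psi] lor_commute[of "dir v \<psi> p"]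
  by (simp add: psi_null dir_const)

lemma nu: "lor (nu p) (\<psi> p) = - 1" "lor (nu p) (dir v \<psi> p) = 0" "lor (nu p) (nu p) = 0"
  using lor_mixed[of p] lor_commute[of "\<psi> p" "mixed p"]
  by (simp_all add: nu_def lor_simps lor_scaleR_left lor_scaleR_right psi_null psi_dpsi)

lemma V_perp_iff_nu: "v \<in> V_perp f p \<longleftrightarrow>
    lor v (\<psi> p) = 0 \<and> lor v (dir 1 \<psi> p) = 0 \<and> lor v (dir \<i> \<psi> p) = 0 \<and> lor v (nu p) = 0"
  by (auto simp: V_perp_iff2 nu_def lor_simps lor_scaleR_right)

lemma proj_in: "proj p v \<in> V_perp f p"
proof -
  have c: "lor (\<psi> p) (nu p) = - 1" "lor (dir w \<psi> p) (nu p) = 0" "lor (dir w \<psi> p) (\<psi> p) = 0" for w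
    using nu[of p] psi_dpsi[of p] by (simp_all add: lor_commute[of "\<psi> p" "nu p"] lor_commute[of "dir w \<psi> p"])
  show ?thesis
    unfolding V_perp_iff_nu proj_def
    by (simp add: lor_simps lor_scaleR_left c nu psi_null psi_dpsi psi_metric inner_complex_def)
qed

lemma proj_id: "v \<in> V_perp f p \<Longrightarrow> proj p v = v"
  by (simp add: proj_def V_perp_iff_nu)

lemma proj_diff_in: "v - proj p v \<in> V_fib f p"
proof -
  have "\<psi> p \<in> V_fib f p" "dir w \<psi> p \<in> V_fib f p" "mixed p \<in> V_fib f p" for w
    unfolding V_fib_eq by (auto intro: span_base)
  moreover have "subspace (V_fib f p)" unfolding V_fib_eq by (rule subspace_span)
  moreover have "v - proj p v = lor v (dir 1 \<psi> p) *\<^sub>R dir 1 \<psi> p + lor v (dir \<i> \<psi> p) *\<^sub>R dir \<i> \<psi> p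
    - lor v (nu p) *\<^sub>R \<psi> p - lor v (\<psi> p) *\<^sub>R nu p" by (simp add: proj_def)
  ultimately show ?thesis
    unfolding nu_def by (simp add: subspace_add subspace_diff subspace_scale)
qed

lemma perp_proj_eq: "perp_proj f p v = proj p v"
  unfolding perp_proj_def
proof (rule the_equality)
  show "proj p v \<in> V_perp f p \<and> v - proj p v \<in> V_fib f p" by (simp add: proj_in proj_diff_in)
  fix n assume n: "n \<in> V_perp f p \<and> v - n \<in> V_fib f p"
  have "subspace (V_fib f p)" unfolding V_fib_eq by (rule subspace_span)
  then have "(v - proj p v) - (v - n) \<in> V_fib f p" using n proj_diff_in by (metis subspace_diff)
  then have "n - proj p v \<in> V_fib f p" by simp
  moreover have d: "n - proj p v \<in> V_perp f p" using n proj_in V_perp_diff by blast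
  ultimately have "lor (n - proj p v) (n - proj p v) = 0" unfolding V_perp_def by blast
  then show "n = proj p v" using V_perp_pos(2)[OF d] by simp
qed

lemma lor_proj: "n \<in> V_perp f p \<Longrightarrow> lor (proj p v) n = lor v n"
  unfolding proj_def lor_commute[of _ n] by (simp add: V_perp_iff_nu lor_simps lor_scaleR_right)

lemma smooth_nu: "smooth nu"
  unfolding nu_def[abs_def]
  by (intro smooth_on_add smooth_on_scaleR smooth_on_mult open_UNIV smooth_on_const smooth_lor smooth_mixed smooth_psi)

lemma smooth_proj: "smooth s \<Longrightarrow> smooth (\<lambda>p. proj p (s p))"
  unfolding proj_def
  by (intro smooth_on_add smooth_on_diff smooth_on_scaleR open_UNIV smooth_lor smooth_on_dir smooth_psi smooth_nu)

text \<open>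
  A constant vector that is normal at \<open>p\<close> projects to a global section without zero at \<open>p\<close>.
\<close>

lemma section_through: obtains e where "smooth e" "\<And>q. e q \<in> V_perp f q" "e p \<noteq> 0"
proof -
  obtain a where a: "a \<in> V_perp f p" "a \<noteq> 0" by (rule V_perp_nontrivial)
  show ?thesis
    by (rule that[of "\<lambda>q. proj q a"]) (use a in \<open>simp_all add: smooth_proj proj_in proj_id\<close>)
qed

text \<open>
  \<open>J\<close> is parallel: a section \<open>s\<close> without zero at \<open>p\<close> and \<open>J s\<close> form a frame there, and in this frame
  the claim amounts to differentiating \<open>\<langle>J s, s\<rangle> = 0\<close> and \<open>\<langle>J s, J s\<rangle> = \<langle>s, s\<rangle>\<close>.
\<close>

lemma J_parallel:
  assumes s: "smooth s" "\<And>q. s q \<in> V_perp f q" and n: "n \<in> V_perp f p"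
  shows "lor (dir v (\<lambda>q. J q (s q)) p) n = - lor (dir v s p) (J p n)"
proof -
  have nonzero: "lor (dir v (\<lambda>q. J q (s q)) p) n = - lor (dir v s p) (J p n)"
    if s: "smooth s" "\<And>q. s q \<in> V_perp f q" "s p \<noteq> 0" for s
  proof -
    define K where "K q = J q (s q)" for q
    have K: "smooth K" "\<And>q. K q \<in> V_perp f q"
      unfolding K_def[abs_def] using smooth_J[OF s(1,2)] J_in[OF s(2)] by auto
    note d = smooth_differentiable[OF s(1)] smooth_differentiable[OF K(1)]
    have "(\<lambda>q. lor (K q) (s q)) = (\<lambda>q. 0)" using J_self[OF s(2)] by (simp add: K_def)
    then have "dir v (\<lambda>q. lor (K q) (s q)) p = 0" by (simp add: dir_const)
    then have 1: "lor (dir v K p) (s p) = - lor (dir v s p) (K p)"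
      using lor_commute[of "K p" "dir v s p"]
      by (simp add: dir_bilinear[OF bounded_bilinear_lor] d eq_neg_iff_add_eq_0 add.commute)
    have "(\<lambda>q. lor (K q) (K q)) = (\<lambda>q. lor (s q) (s q))" using J_isom[OF s(2)] by (simp add: K_def)
    then have "dir v (\<lambda>q. lor (K q) (K q)) p = dir v (\<lambda>q. lor (s q) (s q)) p" by simp
    then have 2: "lor (dir v K p) (K p) = lor (dir v s p) (s p)"
      using lor_commute[of "K p" "dir v K p"] lor_commute[of "s p" "dir v s p"]
      by (simp add: dir_bilinear[OF bounded_bilinear_lor] d)
    obtain \<alpha> \<beta> where n_eq: "n = \<alpha> *\<^sub>R s p + \<beta> *\<^sub>R K p"
      using V_perp_expand[OF s(2) s(3) n] unfolding K_def by blast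
    have "J p n = \<alpha> *\<^sub>R K p - \<beta> *\<^sub>R s p"
      unfolding n_eq using s(2)[of p] K(2)[of p]
      by (simp add: J_add J_scale V_perp_scale) (simp add: K_def J_J)
    then show ?thesis
      unfolding K_def[symmetric] by (simp add: n_eq lor_simps lor_scaleR_right 1 2)
  qed
  show ?thesis
  proof (cases "s p = 0")
    case False
    then show ?thesis by (rule nonzero[OF s])
  next
    case True
    \<comment> \<open>Both \<open>e\<close> and \<open>s + e\<close> are nonzero at \<open>p\<close>, and the claim is additive in the section.\<close>
    obtain e where e: "smooth e" "\<And>q. e q \<in> V_perp f q" "e p \<noteq> 0" by (rule section_through[of p]) blast
    have se: "smooth (\<lambda>q. s q + e q)" by (rule smooth_on_add[OF open_UNIV s(1) e(1)])
    have "lor (dir v (\<lambda>q. J q (s q + e q)) p) n = - lor (dir v (\<lambda>q. s q + e q) p) (J p n)"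
      by (rule nonzero[OF se]) (use s e True in \<open>auto simp: V_perp_add\<close>)
    moreover have "(\<lambda>q. J q (s q + e q)) = (\<lambda>q. J q (s q) + J q (e q))"
      using J_add[OF s(2) e(2)] by auto
    ultimately show ?thesis
      using nonzero[OF e] smooth_differentiable[OF s(1)] smooth_differentiable[OF e(1)]
        smooth_differentiable[OF smooth_J[OF s]] smooth_differentiable[OF smooth_J[OF e(1,2)]]
      by (simp add: dir_add lor_simps)
  qed
qed

end


section \<open>The curvature of the normal bundle\<close>

context conformal
begin

text \<open>On a plane every 2-form is a multiple of the area form \<open>\<langle>J \<cdot>, \<cdot>\<rangle>\<close>.\<close>

lemma V_perp_two_form:
  assumes "k \<in> V_perp f p" "l \<in> V_perp f p" "s \<in> V_perp f p" "n \<in> V_perp f p"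
  shows "lor k s * lor l n - lor l s * lor k n = lor (J p k) l * lor (J p s) n"
proof (cases "s = 0")
  case True
  then show ?thesis using J_scale[OF V_perp_0, of p 0] by (simp add: lor_simps)
next
  case False
  have ex: "\<exists>\<alpha> \<beta>. v = \<alpha> *\<^sub>R s + \<beta> *\<^sub>R J p s" if "v \<in> V_perp f p" for v
    using V_perp_expand[OF assms(3) False that] by blast
  obtain \<alpha>1 \<beta>1 where k: "k = \<alpha>1 *\<^sub>R s + \<beta>1 *\<^sub>R J p s" using ex[OF assms(1)] by blast
  obtain \<alpha>2 \<beta>2 where l: "l = \<alpha>2 *\<^sub>R s + \<beta>2 *\<^sub>R J p s" using ex[OF assms(2)] by blast
  obtain \<gamma> \<delta> where n: "n = \<gamma> *\<^sub>R s + \<delta> *\<^sub>R J p s" using ex[OF assms(4)] by blast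
  have Jk: "J p k = \<alpha>1 *\<^sub>R J p s - \<beta>1 *\<^sub>R s"
    unfolding k using assms(3) by (simp add: J_add J_scale J_J J_in V_perp_scale)
  show ?thesis
    unfolding Jk unfolding k l n using J_self[OF assms(3)] J_isom[OF assms(3)] lor_commute[of s "J p s"]
    by (simp add: lor_simps lor_scaleR_left lor_scaleR_right algebra_simps)
qed

definition k1 :: "complex \<Rightarrow> lor_real" where "k1 p = vRe (\<kappa> p)"
definition k2 :: "complex \<Rightarrow> lor_real" where "k2 p = vIm (\<kappa> p)"

lemma k_in: "k1 p \<in> V_perp f p" "k2 p \<in> V_perp f p"
  using perp_\<kappa>[of p] by (simp_all add: perp_iff k1_def k2_def)

lemma smooth_k: "smooth k1" "smooth k2"
  unfolding k1_def[abs_def] k2_def[abs_def] by (intro smooth_vRe smooth_vIm smooth_\<kappa>)+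

lemma \<kappa>_k: "\<kappa> p = cvec (k1 p) + \<i> *s cvec (k2 p)"
  unfolding k1_def k2_def by (rule vec_Re_Im)

lemma lor_k:
  assumes n: "n \<in> V_perp f p"
  shows "4 * lor (k1 p) n = lor (dir 1 (dir 1 \<psi>) p) n - lor (dir \<i> (dir \<i> \<psi>) p) n"
    and "2 * lor (k2 p) n = - lor (dir 1 (dir \<i> \<psi>) p) n"
proof -
  note d = smooth_differentiable[OF smooth_on_dir[OF smooth_psi]]
  have c: "(\<lambda>q. cvec (dir v \<psi> q)) differentiable (at p)" for v
    by (rule differentiable_bounded_linear[OF bounded_linear_cvec d])
  have sc: "smooth (\<lambda>q. a *s cvec (dir v \<psi> q))" for a v
    by (intro smooth_smult smooth_on_const smooth_cvec smooth_on_dir smooth_psi)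
  have Y1_eq: "Y1 = (\<lambda>q. (1 / 2) *s cvec (dir 1 \<psi> q) + (- \<i> / 2) *s cvec (dir \<i> \<psi> q))"
    by (auto simp: fun_eq_iff Y1_def vdz_clift vec_eq_iff field_simps)
  have dY1: "dir w Y1 p = (1 / 2) *s cvec (dir w (dir 1 \<psi>) p) + (- \<i> / 2) *s cvec (dir w (dir \<i> \<psi>) p)" for w
    unfolding Y1_eq
    by (simp only: dir_add smooth_differentiable[OF sc] dir_smult c dir_bounded_linear[OF bounded_linear_cvec d])
  have cl: "clift f p = cvec (\<psi> p)" by (simp add: clift_eq)
  have "lor (\<kappa> p) (cvec n) = lor (Y11 p) (cvec n)"
    using n lor_commute[of "\<psi> p" n] by (simp add: \<kappa>_def lor_simps cl lor_cvec V_perp_iff)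
  also have "Y11 p = (1 / 2) *s (dir 1 Y1 p - \<i> *s dir \<i> Y1 p)"
    unfolding Y11_def by (rule vdz_dir[OF smooth_differentiable[OF smooth_Y(1)]])
  also have "lor \<dots> (cvec n) = (of_real (lor (dir 1 (dir 1 \<psi>) p) n) - of_real (lor (dir \<i> (dir \<i> \<psi>) p) n)
      - 2 * \<i> * of_real (lor (dir 1 (dir \<i> \<psi>) p) n)) / 4"
    unfolding dY1 dir_commute[OF open_UNIV UNIV_I smooth_psi, of \<i> 1]
    by (simp only: lor_simps lor_cvec) (simp add: field_simps)
  finally have "of_real (lor (k1 p) n) + \<i> * of_real (lor (k2 p) n) =
      (of_real (lor (dir 1 (dir 1 \<psi>) p) n) - of_real (lor (dir \<i> (dir \<i> \<psi>) p) n)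
      - 2 * \<i> * complex_of_real (lor (dir 1 (dir \<i> \<psi>) p) n)) / 4"
    by (simp add: \<kappa>_k lor_simps lor_cvec)
  then show "4 * lor (k1 p) n = lor (dir 1 (dir 1 \<psi>) p) n - lor (dir \<i> (dir \<i> \<psi>) p) n"
    "2 * lor (k2 p) n = - lor (dir 1 (dir \<i> \<psi>) p) n"
    by (auto simp: complex_eq_iff)
qed

lemma lor_dir_swap:
  assumes "smooth s" "smooth F" "\<And>q. lor (s q) (F q) = (0::real)"
  shows "lor (dir w s q) (F q) = - lor (s q) (dir w F q)"
proof -
  have "dir w (\<lambda>q. lor (s q) (F q)) q = 0" by (simp add: assms(3) dir_const)
  then show ?thesis
    by (simp add: dir_bilinear[OF bounded_bilinear_lor] smooth_differentiable assms(1,2))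
qed

lemma normal_conn_eq: "normal_conn f v s p = proj p (dir v s p)"
  by (simp add: normal_conn_def perp_proj_eq dir_def)

text \<open>
  The inner projection produces terms tangential to the surface, and differentiating these again
  contributes products of second fundamental forms; their part antisymmetric in \<open>v\<close> and \<open>w\<close> is the curvature
  (Ricci equation).
\<close>

lemma lor_conn_conn:
  assumes s: "smooth s" "\<And>q. s q \<in> V_perp f q" and n: "n \<in> V_perp f p"
  shows "lor (normal_conn f v (normal_conn f w s) p) n = lor (dir v (dir w s) p) n
    + lor (s p) (dir w (dir 1 \<psi>) p) * lor (dir v (dir 1 \<psi>) p) n
    + lor (s p) (dir w (dir \<i> \<psi>) p) * lor (dir v (dir \<i> \<psi>) p) n"
proof -
  note sd = smooth_on_dir[OF smooth_psi]
  have o: "lor (s q) (\<psi> q) = 0" "lor (s q) (dir u \<psi> q) = 0" for q u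
    using s(2)[of q] by (simp_all add: V_perp_iff)
  have D: "normal_conn f w s = (\<lambda>q. ((dir w s q + lor (s q) (dir w (dir 1 \<psi>) q) *\<^sub>R dir 1 \<psi> q)
      + lor (s q) (dir w (dir \<i> \<psi>) q) *\<^sub>R dir \<i> \<psi> q) + lor (dir w s q) (nu q) *\<^sub>R \<psi> q)"
    unfolding normal_conn_eq[abs_def] proj_def
      lor_dir_swap[OF s(1) sd o(2)] lor_dir_swap[OF s(1) smooth_psi o(1)] o by simp
  have tm: "smooth (\<lambda>q. g q *\<^sub>R F q)" "lor (dir v (\<lambda>q. g q *\<^sub>R F q) p) n = g p * lor (dir v F p) n"
    if "smooth g" "smooth F" "lor (F p) n = 0" for g :: "complex \<Rightarrow> real" and F :: "complex \<Rightarrow> lor_real"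
    using that by (auto simp: smooth_on_scaleR dir_bilinear[OF bounded_bilinear_scaleR] smooth_differentiable
        lor_simps lor_scaleR_left)
  have sg: "smooth (\<lambda>q. lor (s q) (dir w (dir u \<psi>) q))" "smooth (\<lambda>q. lor (dir w s q) (nu q))" for u
    by (intro smooth_lor s smooth_on_dir smooth_psi smooth_nu)+
  have on: "lor (\<psi> p) n = 0" "lor (dir u \<psi> p) n = 0" for u
    using n lor_commute[of _ n] by (simp_all add: V_perp_iff)
  note t1 = tm[OF sg(1) sd on(2), of 1] and t2 = tm[OF sg(1) sd on(2), of \<i>] and t3 = tm[OF sg(2) smooth_psi on(1)]
  note sw = smooth_on_dir[OF s(1), of w]
  note a1 = smooth_on_add[OF open_UNIV sw t1(1)]
  note a2 = smooth_on_add[OF open_UNIV a1 t2(1)]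
  have "dir v (normal_conn f w s) p = ((dir v (dir w s) p
      + dir v (\<lambda>q. lor (s q) (dir w (dir 1 \<psi>) q) *\<^sub>R dir 1 \<psi> q) p)
      + dir v (\<lambda>q. lor (s q) (dir w (dir \<i> \<psi>) q) *\<^sub>R dir \<i> \<psi> q) p) + dir v (\<lambda>q. lor (dir w s q) (nu q) *\<^sub>R \<psi> q) p"
    unfolding D
    by (simp only: dir_add smooth_differentiable[OF sw] smooth_differentiable[OF t1(1)]
        smooth_differentiable[OF t2(1)] smooth_differentiable[OF t3(1)] smooth_differentiable[OF a1] smooth_differentiable[OF a2])
  then show ?thesis
    unfolding normal_conn_eq[of v "normal_conn f w s"] lor_proj[OF n]
    by (simp add: lor_add_left t1(2) t2(2) t3(2) on)
qed

lemma curvature_eq: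
  assumes s: "smooth s" "\<And>q. s q \<in> V_perp f q"
  shows "normal_conn f 1 (normal_conn f \<i> s) p - normal_conn f \<i> (normal_conn f 1 s) p
    = (8 * lor (J p (k1 p)) (k2 p)) *\<^sub>R J p (s p)" (is "?R = ?S")
proof (rule V_perp_eqI)
  show "?R \<in> V_perp f p" "?S \<in> V_perp f p"
    by (simp_all add: normal_conn_eq V_perp_diff proj_in V_perp_scale J_in s)
  fix n assume n: "n \<in> V_perp f p"
  note sw = dir_commute[OF open_UNIV UNIV_I smooth_psi, of \<i> 1]
  have c: "lor (s p) u = lor u (s p)" for u by (rule lor_commute)
  have "lor ?R n = lor (dir 1 (dir \<i> \<psi>) p) (s p) * (lor (dir 1 (dir 1 \<psi>) p) n - lor (dir \<i> (dir \<i> \<psi>) p) n)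
      - (lor (dir 1 (dir 1 \<psi>) p) (s p) - lor (dir \<i> (dir \<i> \<psi>) p) (s p)) * lor (dir 1 (dir \<i> \<psi>) p) n"
    unfolding lor_diff_left lor_conn_conn[OF s n] dir_commute[OF open_UNIV UNIV_I s(1), of \<i> 1] sw c
    by (simp add: algebra_simps)
  also have "\<dots> = 8 * (lor (k1 p) (s p) * lor (k2 p) n - lor (k2 p) (s p) * lor (k1 p) n)"
  proof -
    have b: "lor (dir 1 (dir \<i> \<psi>) p) n = - 2 * lor (k2 p) n" "lor (dir 1 (dir \<i> \<psi>) p) (s p) = - 2 * lor (k2 p) (s p)"
      using lor_k(2)[OF n] lor_k(2)[OF s(2)[of p]] by simp_all
    show ?thesis
      unfolding b lor_k(1)[OF n, symmetric] lor_k(1)[OF s(2), symmetric] by (simp add: algebra_simps)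
  qed
  also have "\<dots> = lor ?S n"
    unfolding V_perp_two_form[OF k_in s(2) n] by (simp add: lor_scaleR_left)
  finally show "lor ?R n = lor ?S n" .
qed

lemma normal_curvature_eq: "normal_curvature f p = 8 * lor (J p (k1 p)) (k2 p)"
  unfolding normal_curvature_def
proof (rule the_equality)
  show "\<forall>s. perp_section f s \<longrightarrow> normal_conn f 1 (normal_conn f \<i> s) p - normal_conn f \<i> (normal_conn f 1 s) p
      = (8 * lor (J p (k1 p)) (k2 p)) *\<^sub>R J p (s p)"
    using curvature_eq by (simp add: perp_section_def)
  fix k assume k: "\<forall>s. perp_section f s \<longrightarrow> normal_conn f 1 (normal_conn f \<i> s) p - normal_conn f \<i> (normal_conn f 1 s) p
      = k *\<^sub>R J p (s p)"
  obtain e where e: "smooth e" "\<And>q. e q \<in> V_perp f q" "e p \<noteq> 0" by (rule section_through[of p]) blast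
  then have "perp_section f e" by (simp add: perp_section_def)
  then have "k *\<^sub>R J p (e p) = (8 * lor (J p (k1 p)) (k2 p)) *\<^sub>R J p (e p)"
    using k curvature_eq[OF e(1,2)] by metis
  moreover have "J p (e p) \<noteq> 0"
    using J_isom[OF e(2)[of p]] V_perp_pos(2)[OF e(2)[of p]] e(3) by (auto simp: lor_simps)
  ultimately show "k = 8 * lor (J p (k1 p)) (k2 p)" by simp
qed

lemma ds_variation_eq: "ds_variation f p = J p (k1 p)"
  unfolding ds_variation_def rotJ_complex_def hopf_eq k1_def
  by (simp add: vRe_def cvec_def vec_eq_iff)

text \<open>
  The term \<open>\<langle>J Re \<kappa>, Re \<kappa>\<rangle>\<close> vanishes, and the remaining one is the curvature.
\<close>

lemma ds_rhs_eq: "2 * lor (cvec (ds_variation f p)) (hopf f p) = \<i> / 4 * of_real (normal_curvature f p)"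
  unfolding ds_variation_eq hopf_eq normal_curvature_eq \<kappa>_k
  using J_self[OF k_in(1)[of p]] by (simp add: lor_simps lor_cvec)

lemma smooth_Jk: "smooth (\<lambda>p. J p (k1 p))" "smooth (\<lambda>p. J p (k2 p))"
  by (rule smooth_J[OF smooth_k(1) k_in(1)], rule smooth_J[OF smooth_k(2) k_in(2)])

end


section \<open>Solvability of the \<open>\<partial>\<close>-bar problem\<close>

locale torus_immersion = torus \<omega>1 \<omega>2 + conformal f for \<omega>1 \<omega>2 f +
  assumes on_torus_f: "on_torus \<omega>1 \<omega>2 f"
begin

lemma per_f: "per f"
  by (rule perI[OF smooth_f on_torus_f])

lemma per_rr: "per rr"
  unfolding rr_def[abs_def] dx_dir by (rule per_bilinear[OF bounded_bilinear_inner per_dir[OF per_f] per_dir[OF per_f]])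

lemma per_psi: "per \<psi>"
proof (rule perI[OF smooth_psi])
  show "on_torus \<omega>1 \<omega>2 \<psi>"
    using on_torus_f per_on_torus[OF per_rr] by (simp add: on_torus_def \<psi>_def \<rho>_def)
qed

lemma per_lor: "per F \<Longrightarrow> per G \<Longrightarrow> per (\<lambda>p. lor (F p) (G p :: 'a::{real_normed_field, euclidean_space} ^ 5 option))"
  by (rule per_bilinear[OF bounded_bilinear_lor])

lemma per_smult: "per h \<Longrightarrow> per F \<Longrightarrow> per (\<lambda>p. h p *s (F p :: complex ^ 'n))"
  by (rule per_bilinear[OF bounded_bilinear_smult])

lemma per_vdz: "per F \<Longrightarrow> per (vdz F)" and per_vdzbar: "per F \<Longrightarrow> per (vdzbar F)"
proof -
  assume F: "per F"
  have "vdz F = (\<lambda>p. (1 / 2) *s (dir 1 F p - \<i> *s dir \<i> F p))" "vdzbar F = (\<lambda>p. (1 / 2) *s (dir 1 F p + \<i> *s dir \<i> F p))"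
    by (simp_all add: fun_eq_iff vdz_dir vdzbar_dir per_differentiable[OF F])
  then show "per (vdz F)" "per (vdzbar F)"
    by (simp_all only: per_smult per_const per_diff per_add per_dir F)
qed

lemma per_clift: "per (clift f)"
  unfolding clift_eq by (rule per_linear[OF bounded_linear_cvec per_psi])

lemma per_Y: "per Y1" "per Y2" "per Y11" "per Y12" "per Y112"
  unfolding Y1_def Y2_def Y11_def Y12_def Y112_def by (intro per_vdz per_vdzbar per_clift)+

lemma per_L: "per L" and per_Sc: "per Sc"
  unfolding L_def[abs_def] Sc_def[abs_def] by (intro per_mult per_const per_lor per_Y)+

lemma per_\<kappa>: "per \<kappa>"
proof -
  have "\<kappa> = (\<lambda>p. Y11 p + ((1 / 2) * Sc p) *s clift f p)" by (auto simp: \<kappa>_def)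
  then show ?thesis by (simp only: per_add per_Y per_smult per_mult per_const per_Sc per_clift)
qed

lemma per_k: "per k1" "per k2"
  unfolding k1_def[abs_def] k2_def[abs_def]
  by (rule per_linear[OF bounded_linear_vRe per_\<kappa>], rule per_linear[OF bounded_linear_vIm per_\<kappa>])

text \<open>
  The rotation at a point is determined by \<open>f\<close>, its derivatives and the lift there, all of which are periodic.
\<close>

lemma J_periodic: "J (p + \<omega>1) = J p" "J (p + \<omega>2) = J p"
proof -
  have *: "J (p + w) = J p"
    if w: "\<And>F :: complex \<Rightarrow> lor_real. per F \<Longrightarrow> F (p + w) = F p" "\<And>F :: complex \<Rightarrow> real ^ 5. per F \<Longrightarrow> F (p + w) = F p" for w
  proof -
    have "per mixed"
    proof -
      have "mixed = (\<lambda>p. vRe (Y12 p))" by (metis cvec_mixed vRe_cvec)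
      then show ?thesis using per_linear[OF bounded_linear_vRe per_Y(4)] by simp
    qed
    from w(1)[OF this] have "V_perp f (p + w) = V_perp f p"
      by (simp add: set_eq_iff V_perp_iff2 w(1)[OF per_psi] w(1)[OF per_dir[OF per_psi]])
    moreover have "f (p + w) = f p" "dx f (p + w) = dx f p" "dy f (p + w) = dy f p"
      by (simp_all add: dx_dir dy_dir w(2)[OF per_f] w(2)[OF per_dir[OF per_f]])
    ultimately show ?thesis by (intro ext) (simp add: rotJ_def to_normal_def)
  qed
  show "J (p + \<omega>1) = J p" "J (p + \<omega>2) = J p"
    by (rule *; use per_on_torus[unfolded on_torus_def] in blast)+
qed

lemma per_Jk: "per (\<lambda>p. J p (k1 p))" "per (\<lambda>p. J p (k2 p))"
  using per_on_torus[OF per_k(1)] per_on_torus[OF per_k(2)]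
  by (auto intro!: perI smooth_Jk simp: on_torus_def J_periodic)

lemma per_normal_curvature: "per (normal_curvature f)"
proof -
  have "normal_curvature f = (\<lambda>p. 8 * lor (J p (k1 p)) (k2 p))" using normal_curvature_eq by auto
  then show ?thesis using per_mult[OF per_const per_lor[OF per_Jk(1) per_k(2)]] by simp
qed

definition rhs :: "complex \<Rightarrow> complex" where "rhs p = \<i> / 4 * of_real (normal_curvature f p)"

lemma per_rhs: "per rhs"
  unfolding rhs_def[abs_def]
  by (rule per_mult[OF per_const per_linear[OF bounded_linear_of_real per_normal_curvature]])

lemma dbar_solution_iff: "dbar_solution \<omega>1 \<omega>2 f b \<longleftrightarrow> per b \<and> (\<forall>p. dz (\<lambda>q. cnj (b q)) p = rhs p)"
  by (simp add: dbar_solution_def ds_rhs_eq rhs_def)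

lemma degree_eq_0_iff: "normal_degree \<omega>1 \<omega>2 f = 0 \<longleftrightarrow> mean rhs = 0"
proof -
  have c: "continuous_on UNIV (normal_curvature f)" by (rule per_continuous[OF per_normal_curvature])
  have "mean rhs = \<i> / 4 * mean (\<lambda>p. complex_of_real (normal_curvature f p))"
    unfolding rhs_def[abs_def] by (rule mean_cmult) (intro continuous_intros c)
  also have "mean (\<lambda>p. complex_of_real (normal_curvature f p)) = of_real (mean (normal_curvature f))"
    by (rule mean_linear[OF bounded_linear_of_real c])
  finally have e: "mean rhs = \<i> / 4 * of_real (mean (normal_curvature f))" .
  show ?thesis
    unfolding e using \<Delta> by (simp add: normal_degree_def torus_integral_eq_mean[OF c])
qed

lemma dz_diff:
  assumes "per u" "per v"
  shows "dz (\<lambda>p. u p - v p) p = dz u p - dz v p"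
proof -
  have "dir w (\<lambda>p. u p + (- 1) * v p) p = dir w u p + (- 1) * dir w v p" for w
    by (simp only: dir_add per_differentiable per_mult per_const assms
        dir_bounded_linear[OF bounded_linear_mult_right])
  then have d: "dir w (\<lambda>p. u p - v p) p = dir w u p - dir w v p" for w by simp
  show ?thesis by (simp add: dz_dir d algebra_simps diff_divide_distrib add_divide_distrib)
qed

theorem dbar_solvable_iff: "(\<exists>b. dbar_solution \<omega>1 \<omega>2 f b) \<longleftrightarrow> normal_degree \<omega>1 \<omega>2 f = 0"
  unfolding degree_eq_0_iff dbar_solution_iff
proof
  assume "\<exists>b. per b \<and> (\<forall>p. dz (\<lambda>q. cnj (b q)) p = rhs p)"
  then obtain b where b: "per b" "\<And>p. dz (\<lambda>q. cnj (b q)) p = rhs p" by blast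
  have "mean (dz (\<lambda>q. cnj (b q))) = 0" by (rule mean_dz_eq_0[OF per_cnj[OF b(1)]])
  moreover have "dz (\<lambda>q. cnj (b q)) = rhs" using b(2) by auto
  ultimately show "mean rhs = 0" by simp
next
  assume "mean rhs = 0"
  then obtain u where u: "per u" "\<And>p. dz u p = rhs p" using dz_solvable[OF per_rhs] by blast
  then show "\<exists>b. per b \<and> (\<forall>p. dz (\<lambda>q. cnj (b q)) p = rhs p)"
    by (intro exI[of _ "\<lambda>p. cnj (u p)"]) (simp add: per_cnj)
qed

theorem dbar_solution_unique:
  assumes "dbar_solution \<omega>1 \<omega>2 f b"
  shows "\<exists>!b. dbar_solution \<omega>1 \<omega>2 f b \<and> torus_integral \<omega>1 \<omega>2 b = 0"
proof -
  have int: "torus_integral \<omega>1 \<omega>2 b = 0 \<longleftrightarrow> mean b = 0" if "per b" for b :: "complex \<Rightarrow> complex"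
    using \<Delta> by (simp add: torus_integral_eq_mean[OF per_continuous[OF that]])
  have b: "per b" "\<And>p. dz (\<lambda>q. cnj (b q)) p = rhs p" using assms by (auto simp: dbar_solution_iff)
  show ?thesis
  proof (rule ex_ex1I)
    have "per (\<lambda>p. b p - mean b)" by (intro per_diff per_const b)
    moreover have "mean (\<lambda>p. b p - mean b) = 0"
      by (subst mean_diff) (auto intro: per_continuous b)
    moreover have "dz (\<lambda>q. cnj (b q - mean b)) p = rhs p" for p
      using dz_diff[OF per_cnj[OF b(1)] per_const, of "cnj (mean b)" p] b(2) by simp
    ultimately show "\<exists>b. dbar_solution \<omega>1 \<omega>2 f b \<and> torus_integral \<omega>1 \<omega>2 b = 0"
      using int by (intro exI[of _ "\<lambda>p. b p - mean b"]) (simp add: dbar_solution_iff)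
  next
    fix b c assume "dbar_solution \<omega>1 \<omega>2 f b \<and> torus_integral \<omega>1 \<omega>2 b = 0"
      "dbar_solution \<omega>1 \<omega>2 f c \<and> torus_integral \<omega>1 \<omega>2 c = 0"
    then have bc: "per b" "per c" "\<And>p. dz (\<lambda>q. cnj (b q)) p = rhs p" "\<And>p. dz (\<lambda>q. cnj (c q)) p = rhs p"
      "mean b = 0" "mean c = 0"
      using int by (auto simp: dbar_solution_iff)
    have u: "per (\<lambda>p. cnj (b p) - cnj (c p))" by (intro per_diff per_cnj bc)
    have m: "mean (\<lambda>p. cnj (b p) - cnj (c p)) = 0"
      using mean_linear[OF bounded_linear_cnj per_continuous[OF bc(1)]]
        mean_linear[OF bounded_linear_cnj per_continuous[OF bc(2)]]
      by (subst mean_diff) (auto intro: per_continuous per_cnj bc simp: bc(5,6))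
    have "dz (\<lambda>p. cnj (b p) - cnj (c p)) p = 0" for p
      unfolding dz_diff[OF per_cnj[OF bc(1)] per_cnj[OF bc(2)]] bc(3,4) by simp
    from dz_eq_0_imp_const[OF u this, unfolded m] have "cnj (b p - c p) = 0" for p by simp
    then show "b = c" by (simp only: fun_eq_iff complex_cnj_zero_iff right_minus_eq) simp
  qed
qed

end


section \<open>The Willmore energy under the Davey--Stewartson flow\<close>

context conformal
begin

definition \<kappa>J :: "complex \<Rightarrow> lor_complex" where
  "\<kappa>J p = cvec (J p (k1 p)) + \<i> *s cvec (J p (k2 p))"

lemma smooth_\<kappa>J: "smooth \<kappa>J"
  unfolding \<kappa>J_def[abs_def]
  by (intro smooth_on_add open_UNIV smooth_smult smooth_on_const smooth_cvec smooth_Jk)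

lemma perp_complexI: "v \<in> V_perp f p \<Longrightarrow> w \<in> V_perp f p \<Longrightarrow> perp p (cvec v + \<i> *s cvec w)"
proof -
  have "vRe (cvec v + \<i> *s cvec w) = v" "vIm (cvec v + \<i> *s cvec w) = w"
    by (simp_all add: vRe_def vIm_def cvec_def vec_eq_iff)
  then show "v \<in> V_perp f p \<Longrightarrow> w \<in> V_perp f p \<Longrightarrow> perp p (cvec v + \<i> *s cvec w)"
    by (simp add: perp_iff)
qed

lemma perp_\<kappa>J: "perp p (\<kappa>J p)"
  unfolding \<kappa>J_def by (rule perp_complexI) (simp_all add: J_in k_in)

lemma complex_J_skew:
  assumes "v \<in> V_perp f p" "w \<in> V_perp f p"
  shows "lor (cvec (J p v) + \<i> *s cvec (J p w)) (cvec v + \<i> *s cvec w) = 0"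
  using J_self[OF assms(1)] J_self[OF assms(2)] J_skew[OF assms] by (simp add: lor_simps lor_cvec)

lemma lor_\<kappa>J_\<kappa>: "lor (\<kappa>J p) (\<kappa> p) = 0"
  unfolding \<kappa>J_def \<kappa>_k by (rule complex_J_skew[OF k_in])

text \<open>
  As \<open>J\<close> is parallel and skew, \<open>\<langle>D (J \<kappa>), D \<kappa>\<rangle> = \<langle>J D \<kappa>, D \<kappa>\<rangle> = 0\<close> for the derivative with respect
  to the conjugate of \<open>z\<close>; the components tangential to \<open>V\<close> pair to zero.
\<close>

lemma lor_d\<kappa>J_d\<kappa>: "lor (vdzbar \<kappa>J p) (\<kappa>2 p) = 0"
proof -
  define n where "n = \<kappa>2 p + (2 * L p) *s Y1 p + (2 * lor (\<kappa>2 p) (Y12 p)) *s clift f p"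
  have pn: "perp p n" unfolding n_def by (rule \<kappa>2_decomp)
  define n1 n2 where "n1 = vRe n" and "n2 = vIm n"
  have n12: "n1 \<in> V_perp f p" "n2 \<in> V_perp f p" using pn by (simp_all add: perp_iff n1_def n2_def)
  have n_eq: "n = cvec n1 + \<i> *s cvec n2" unfolding n1_def n2_def by (rule vec_Re_Im)
  define Jn where "Jn = cvec (J p n1) + \<i> *s cvec (J p n2)"
  have pJ: "perp p Jn" unfolding Jn_def by (rule perp_complexI) (simp_all add: J_in n12)
  have x: "lor (vdzbar \<kappa>J p) (clift f p) = 0" "lor (vdzbar \<kappa>J p) (Y1 p) = 0"
    using lor_eq_const(2)[OF smooth_\<kappa>J Y, of 0 p] lor_eq_const(2)[OF smooth_\<kappa>J smooth_Y(1), of 0 p] perp_\<kappa>J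
    by (simp_all add: perp_def vd)
  have "lor (vdzbar \<kappa>J p) (\<kappa>2 p) = lor (vdzbar \<kappa>J p) n"
    unfolding n_def by (simp add: lor_simps x)
  also have "\<dots> = - lor (\<kappa>2 p) Jn"
  proof -
    have d\<kappa>: "dir v \<kappa> p = cvec (dir v k1 p) + \<i> *s cvec (dir v k2 p)" for v
    proof -
      note d = smooth_differentiable[OF smooth_k(1)] smooth_differentiable[OF smooth_k(2)]
      have "\<kappa> = (\<lambda>q. cvec (k1 q) + \<i> *s cvec (k2 q))" using \<kappa>_k by auto
      then show ?thesis
        by (simp only: dir_add differentiable_bounded_linear[OF bounded_linear_cvec d(1)]
            smooth_differentiable[OF smooth_smult[OF smooth_on_const smooth_cvec[OF smooth_k(2)]]]
            dir_smult differentiable_bounded_linear[OF bounded_linear_cvec d(2)] dir_bounded_linear[OF bounded_linear_cvec] d)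
    qed
    have d\<kappa>J: "dir v \<kappa>J p = cvec (dir v (\<lambda>q. J q (k1 q)) p) + \<i> *s cvec (dir v (\<lambda>q. J q (k2 q)) p)" for v
    proof -
      note d = smooth_differentiable[OF smooth_Jk(1)] smooth_differentiable[OF smooth_Jk(2)]
      show ?thesis
        unfolding \<kappa>J_def[abs_def]
        by (simp only: dir_add differentiable_bounded_linear[OF bounded_linear_cvec d(1)]
            smooth_differentiable[OF smooth_smult[OF smooth_on_const smooth_cvec[OF smooth_Jk(2)]]]
            dir_smult differentiable_bounded_linear[OF bounded_linear_cvec d(2)] dir_bounded_linear[OF bounded_linear_cvec] d)
    qed
    have "lor (dir v \<kappa>J p) n = - lor (dir v \<kappa> p) Jn" for v
      unfolding d\<kappa> d\<kappa>J n_eq Jn_def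
      by (simp add: lor_simps lor_cvec J_parallel[OF smooth_k(1) k_in(1) n12(1)] J_parallel[OF smooth_k(1) k_in(1) n12(2)]
          J_parallel[OF smooth_k(2) k_in(2) n12(1)] J_parallel[OF smooth_k(2) k_in(2) n12(2)])
        (simp add: algebra_simps)
    then show ?thesis
      unfolding \<kappa>2_def vdzbar_dir[OF smooth_differentiable[OF smooth_\<kappa>]] vdzbar_dir[OF smooth_differentiable[OF smooth_\<kappa>J]]
      by (simp add: lor_simps field_simps)
  qed
  also have "lor (\<kappa>2 p) Jn = lor n Jn"
    using pJ lor_commute[of _ Jn] by (simp add: n_def perp_def lor_simps)
  also have "lor n Jn = 0"
    unfolding lor_commute[of n] unfolding Jn_def n_eq by (rule complex_J_skew[OF n12])
  finally show ?thesis by simp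
qed

text \<open>
  The variation \<open>Re J \<kappa>\<close> pairs with the Willmore gradient to the real part of a divergence; this
  is the reason why the flow preserves the Willmore energy.
\<close>

lemma lor_variation_EL:
  "lor (cvec (J p (k1 p))) (EL p) = of_real (Re (dzbar (\<lambda>p. lor (\<kappa>J p) (\<kappa>2 p)) p))"
proof -
  have "vRe (\<kappa>J p) = J p (k1 p)" by (simp add: \<kappa>J_def vRe_def cvec_def vec_eq_iff)
  then have "lor (cvec (J p (k1 p))) (EL p) = (lor (\<kappa>J p) (EL p) + lor (vcnj (\<kappa>J p)) (EL p)) / 2"
    using lor_vRe[of "\<kappa>J p" "EL p"] by simp
  also have "lor (vcnj (\<kappa>J p)) (EL p) = cnj (lor (\<kappa>J p) (EL p))"
    by (simp add: lor_vcnj[symmetric] EL_real)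
  also have "lor (\<kappa>J p) (EL p) = lor (\<kappa>J p) (\<kappa>22 p)"
    by (simp add: lor_EL_perp[OF perp_\<kappa>J] lor_\<kappa>J_\<kappa>)
  also have "\<dots> = dzbar (\<lambda>p. lor (\<kappa>J p) (\<kappa>2 p)) p"
    by (simp add: dz_lor smooth_\<kappa>J smooth_\<kappa>2 lor_d\<kappa>J_d\<kappa> \<kappa>22_def)
  finally show ?thesis by (simp add: complex_eq_iff)
qed

end

lemma vdz_vdzbar_cvec:
  assumes "smooth h"
  shows "vdz (vdzbar (\<lambda>q. cvec (h q))) p = cvec ((1 / 4) *\<^sub>R (dir 1 (dir 1 h) p + dir \<i> (dir \<i> h) p))"
proof -
  note d = smooth_differentiable[OF smooth_on_dir[OF assms]]
  have "vdzbar (\<lambda>q. cvec (h q)) = (\<lambda>q. (1 / 2) *s cvec (dir 1 h q) + (\<i> / 2) *s cvec (dir \<i> h q))"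
    by (auto simp: fun_eq_iff vdzbar_dir smooth_differentiable[OF smooth_cvec[OF assms]]
        dir_bounded_linear[OF bounded_linear_cvec smooth_differentiable[OF assms]] vec_eq_iff field_simps)
  then have D: "dir v (vdzbar (\<lambda>q. cvec (h q))) p =
      (1 / 2) *s cvec (dir v (dir 1 h) p) + (\<i> / 2) *s cvec (dir v (dir \<i> h) p)" for v
    by (simp only: dir_add dir_smult dir_bounded_linear[OF bounded_linear_cvec d]
        smooth_differentiable[OF smooth_smult[OF smooth_on_const smooth_cvec[OF smooth_on_dir[OF assms]]]]
        differentiable_bounded_linear[OF bounded_linear_cvec d])
  show ?thesis
    unfolding vdz_dir[OF smooth_differentiable[OF smooth_vdzbar[OF smooth_cvec[OF assms]]]] D
      dir_commute[OF open_UNIV UNIV_I assms, of \<i> 1]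
    by (simp add: vec_eq_iff cvec_def complex_eq_iff)
qed

context torus_immersion
begin

lemma per_\<kappa>J: "per \<kappa>J"
  unfolding \<kappa>J_def[abs_def]
  by (intro per_add per_smult per_const per_linear[OF bounded_linear_cvec] per_Jk)

lemma per_\<kappa>2: "per \<kappa>2"
  unfolding \<kappa>2_def by (rule per_vdzbar[OF per_\<kappa>])

text \<open>
  Every term of \<open>first_variation\<close> is a divergence or the real part of one and has mean 0.
\<close>

lemma mean_first_variation:
  fixes h :: "complex \<Rightarrow> lor_real"
  assumes h: "per h"
    and metric: "\<And>v w p. lor (dir v h p) (dir w \<psi> p) + lor (dir w h p) (dir v \<psi> p) = 0"
    and hp: "\<And>p. cvec (h p) = a p *s clift f p + b p *s Y1 p + b' p *s Y2 p + cvec (J p (k1 p))"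
  shows "mean (\<lambda>p. lor ((1 / 4) *\<^sub>R (dir 1 (dir 1 h) p + dir \<i> (dir \<i> h) p)) (mixed p)) = 0"
proof -
  define H where "H p = cvec (h p)" for p
  have H: "per H" unfolding H_def[abs_def] by (rule per_linear[OF bounded_linear_cvec h])
  note sH = per_smooth[OF H]
  have dH: "dir v H p = cvec (dir v h p)" for v p
    unfolding H_def[abs_def] by (rule dir_bounded_linear[OF bounded_linear_cvec per_differentiable[OF h]])
  have vdH: "vdz H p = (1 / 2) *s (cvec (dir 1 h p) - \<i> *s cvec (dir \<i> h p))"
    "vdzbar H p = (1 / 2) *s (cvec (dir 1 h p) + \<i> *s cvec (dir \<i> h p))" for p
    by (simp_all add: vdz_dir vdzbar_dir per_differentiable[OF H] dH)
  have Y12_eq: "Y1 p = (1 / 2) *s (cvec (dir 1 \<psi> p) - \<i> *s cvec (dir \<i> \<psi> p))"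
    "Y2 p = (1 / 2) *s (cvec (dir 1 \<psi> p) + \<i> *s cvec (dir \<i> \<psi> p))" for p
    unfolding Y1_def Y2_def by (rule vdz_clift vdzbar_clift)+
  have m: "lor (dir 1 h p) (dir 1 \<psi> p) = 0" "lor (dir \<i> h p) (dir \<i> \<psi> p) = 0"
    "lor (dir \<i> h p) (dir 1 \<psi> p) = - lor (dir 1 h p) (dir \<i> \<psi> p)" for p
    using metric[of 1 p 1] metric[of \<i> p \<i>] metric[of \<i> p 1] by simp_all
  define q where "q i = [\<lambda>p. lor (\<kappa>J p) (\<kappa>2 p), \<lambda>p. lor (vdzbar H p) (Y12 p), \<lambda>p. lor (H p) (Y112 p),
    \<lambda>p. lor (H p) (L p *s Y1 p), \<lambda>p. lor (H p) (L p *s Y2 p),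
    \<lambda>p. lor (H p) (Sc p *s Y2 p), \<lambda>p. lor (H p) (cnj (Sc p) *s Y1 p)] ! i" for i
  have perq: "per (q 0)" "per (q 1)" "per (q 2)" "per (q 3)" "per (q 4)" "per (q 5)" "per (q 6)"
    unfolding q_def by (simp_all add: per_lor per_smult per_cnj per_vdzbar per_\<kappa>J per_\<kappa>2 H per_Y per_L per_Sc)
  have "lor (vdz (vdzbar H) p) (Y12 p) = of_real (Re (dzbar (q 0) p)) + dz (q 1) p - dzbar (q 2) p
      - dzbar (q 3) p - dz (q 4) p - (1 / 2) * dzbar (q 5) p - (1 / 2) * dz (q 6) p" for p
  proof -
    have "lor (vdz (vdzbar H) p) (Y12 p) =
      lor (cvec (J p (k1 p))) (EL p) + dz (\<lambda>p. lor (vdzbar H p) (Y12 p)) p - dzbar (\<lambda>p. lor (H p) (Y112 p)) p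
      - dzbar (\<lambda>p. lor (H p) (L p *s Y1 p)) p - dz (\<lambda>p. lor (H p) (L p *s Y2 p)) p
      - dzbar (\<lambda>p. lor (H p) (Sc p *s Y2 p)) p / 2 - dz (\<lambda>p. lor (H p) (cnj (Sc p) *s Y1 p)) p / 2"
    proof (rule first_variation[OF sH])
      show "lor (vdz H p) (Y1 p) = 0" "lor (vdzbar H p) (Y2 p) = 0"
        "lor (vdz H p) (Y2 p) + lor (vdzbar H p) (Y1 p) = 0" for p
        unfolding vdH Y12_eq by (simp_all add: lor_simps lor_cvec m)
      show "H p = a p *s clift f p + b p *s Y1 p + b' p *s Y2 p + cvec (J p (k1 p))"
        unfolding H_def by (rule hp)
    qed
    then show ?thesis by (simp add: lor_variation_EL q_def)
  qed
  then have "mean (\<lambda>p. lor (vdz (vdzbar H) p) (Y12 p)) = mean (\<lambda>p. of_real (Re (dzbar (q 0) p)) + dz (q 1) p - dzbar (q 2) p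
      - dzbar (q 3) p - dz (q 4) p - (1 / 2) * dzbar (q 5) p - (1 / 2) * dz (q 6) p)" by simp
  also have "\<dots> = 0"
  proof -
    note c = per_continuous[OF per_dz] per_continuous[OF per_dzbar]
    have c0: "continuous_on UNIV (\<lambda>p. complex_of_real (Re (dzbar (q 0) p)))"
      by (intro continuous_intros c perq)
    have "mean (\<lambda>p. complex_of_real (Re (dzbar (q 0) p))) = 0"
      using mean_linear[OF bounded_linear_compose[OF bounded_linear_of_real bounded_linear_Re] c(2)[OF perq(1)]]
      by (simp add: mean_dzbar_eq_0[OF perq(1)])
    then show ?thesis
      using c0 c(1)[OF perq(2)] c(2)[OF perq(3)] c(2)[OF perq(4)] c(1)[OF perq(5)] c(2)[OF perq(6)] c(1)[OF perq(7)]
      by (simp only: mean_diff mean_add mean_cmult continuous_intros mean_dz_eq_0 mean_dzbar_eq_0 perq) simp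
  qed
  finally have 0: "mean (\<lambda>p. lor (vdz (vdzbar H) p) (Y12 p)) = 0" .
  define u where "u p = lor ((1 / 4) *\<^sub>R (dir 1 (dir 1 h) p + dir \<i> (dir \<i> h) p)) (mixed p)" for p
  have "lor (vdz (vdzbar H) p) (Y12 p) = of_real (u p)" for p
    unfolding H_def[abs_def] vdz_vdzbar_cvec[OF per_smooth[OF h]] cvec_mixed[symmetric] lor_cvec u_def by (rule refl)
  then have uH: "u = (\<lambda>p. Re (lor (vdz (vdzbar H) p) (Y12 p)))" by auto
  have "continuous_on UNIV (\<lambda>p. lor (vdz (vdzbar H) p) (Y12 p))"
    by (intro per_continuous per_lor per_vdz per_vdzbar H per_Y)
  then have "mean u = Re (mean (\<lambda>p. lor (vdz (vdzbar H) p) (Y12 p)))"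
    unfolding uH by (rule mean_linear[OF bounded_linear_Re])
  then have "mean u = 0" using 0 by simp
  then show ?thesis unfolding u_def[abs_def] .
qed

lemma mixed_eq: "mixed p = (1 / 4) *\<^sub>R (dir 1 (dir 1 \<psi>) p + dir \<i> (dir \<i> \<psi>) p)"
proof -
  have "cvec (mixed p) = vdz (vdzbar (clift f)) p" unfolding cvec_mixed Y12_def Y2_def by (rule refl)
  also have "\<dots> = cvec ((1 / 4) *\<^sub>R (dir 1 (dir 1 \<psi>) p + dir \<i> (dir \<i> \<psi>) p))"
    unfolding clift_eq by (rule vdz_vdzbar_cvec[OF smooth_psi])
  finally show ?thesis by (metis vRe_cvec)
qed

lemma willmore_mean: "willmore \<omega>1 \<omega>2 f = \<bar>\<Delta>\<bar> * mean (\<lambda>p. lor (mixed p) (mixed p))"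
proof -
  have "Re (L p) = lor (mixed p) (mixed p)" for p
    unfolding L_def cvec_mixed[symmetric] lor_cvec by simp
  moreover have "continuous_on UNIV (\<lambda>p. lor (mixed p) (mixed p))"
    by (rule smooth_on_continuous[OF smooth_lor[OF smooth_mixed smooth_mixed]])
  ultimately show ?thesis by (simp add: willmore_eq torus_integral_eq_mean)
qed

end

lemma smooth_on_slice:
  assumes "smooth_on (I \<times> UNIV) g" "t \<in> I"
  shows "smooth (\<lambda>p. g (t, p))" and "dir v (\<lambda>p. g (t, p)) p = dir (0, v) g (t, p)"
proof -
  have L: "bounded_linear (\<lambda>p::'b. (0::'a, p))"
    by (intro bounded_linear_Pair bounded_linear_zero bounded_linear_ident)
  have e: "(t, 0) + (0, p) = (t, p)" for p :: 'b by simp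
  show "smooth (\<lambda>p. g (t, p))"
    using smooth_on_affine[OF L assms(1) open_UNIV, of "(t, 0)"] assms(2) unfolding e by simp
  show "dir v (\<lambda>p. g (t, p)) p = dir (0, v) g (t, p)"
    using dir_affine(1)[OF L, of g "(t, 0)" p v] smooth_on_differentiable[OF assms(1)] assms(2) unfolding e by simp
qed

lemma smooth_on_time_derivative:
  fixes g :: "real \<times> 'b::euclidean_space \<Rightarrow> 'c::real_normed_vector"
  assumes "smooth_on (I \<times> UNIV) g" "t \<in> I"
  shows "((\<lambda>\<tau>. g (\<tau>, p)) has_vector_derivative dir (1, 0) g (t, p)) (at t)"
proof -
  have L: "((\<lambda>\<tau>. (\<tau>, p)) has_derivative (\<lambda>h. (h, 0))) (at t)"
    by (intro derivative_eq_intros) auto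
  have d: "g differentiable (at (t, p))" using smooth_on_differentiable[OF assms(1)] assms(2) by simp
  have "((\<lambda>\<tau>. g (\<tau>, p)) has_derivative (\<lambda>h. dir (h, 0) g (t, p))) (at t)"
    by (rule has_derivative_compose[OF L dir_works[OF d]])
  moreover have "(\<lambda>h. dir (h, 0) g (t, p)) = (\<lambda>h. h *\<^sub>R dir (1, 0) g (t, p))"
  proof
    show "dir (h, 0) g (t, p) = h *\<^sub>R dir (1, 0) g (t, p)" for h
      using dir_scaleR_dir[OF d, of h "(1, 0)"] by simp
  qed
  ultimately show ?thesis unfolding has_vector_derivative_def by (rule has_derivative_eq_rhs)
qed

context torus
begin

text \<open>
  The explicit lift \<open>G\<close> is smooth in time and space together, so that the energy may be differentiated under the
  integral and time derivatives commute with space derivatives. Differentiating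
  \<open>\<langle>d\<psi>, d\<psi>\<rangle> = |dz|\<^sup>2\<close> in time gives the constraints on the variation \<open>h\<close> of the lift.
\<close>

theorem willmore_constant:
  assumes I: "open I" "is_interval I" and flow: "ds_flow \<omega>1 \<omega>2 I F"
  shows "\<exists>c. \<forall>t\<in>I. willmore \<omega>1 \<omega>2 (F t) = c"
proof -
  define S where "S = I \<times> (UNIV :: complex set)"
  have S: "open S" unfolding S_def by (intro open_Times I open_UNIV)
  have Sin: "(t, p) \<in> S \<longleftrightarrow> t \<in> I" for t p by (simp add: S_def)
  define Fh where "Fh x = F (fst x) (snd x)" for x
  have Fh: "smooth_on S Fh"
    using flow unfolding ds_flow_def smooth_family_def S_def Fh_def[abs_def] split_beta by blast
  have imm: "torus_immersion \<omega>1 \<omega>2 (F t)" if "t \<in> I" for t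
  proof -
    have "conformal_immersion \<omega>1 \<omega>2 (F t)" using flow that by (auto simp: ds_flow_def smooth_family_def)
    from conformal_immersionD[OF this] show ?thesis
      by (intro torus_immersion.intro torus_immersion_axioms.intro) (auto intro: torus_axioms)
  qed
  define E where "E x = dir (0, 1) Fh x \<bullet> dir (0, 1) Fh x" for x
  define G where "G x = (E x powr (- 1 / 2)) *\<^sub>R null_vec (Fh x)" for x
  have E_rr: "E (t, p) = conformal.rr (F t) p" if "t \<in> I" for t p
  proof -
    interpret torus_immersion \<omega>1 \<omega>2 "F t" by (rule imm[OF that])
    have "dir 1 (F t) p = dir (0, 1) Fh (t, p)"
      using smooth_on_slice(2)[OF Fh[unfolded S_def] that, of 1 p] by (simp add: Fh_def)
    then show ?thesis by (simp add: rr_def E_def dx_dir)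
  qed
  have G_psi: "G (t, p) = conformal.\<psi> (F t) p" if "t \<in> I" for t p
  proof -
    interpret torus_immersion \<omega>1 \<omega>2 "F t" by (rule imm[OF that])
    show ?thesis by (simp add: G_def \<psi>_def \<rho>_def E_rr[OF that] Fh_def)
  qed
  have smE: "smooth_on S E"
    unfolding E_def[abs_def] by (rule smooth_on_bilinear[OF S bounded_bilinear_inner smooth_on_dir[OF Fh] smooth_on_dir[OF Fh]])
  have "E x > 0" if xS: "x \<in> S" for x
  proof -
    obtain t p where x: "x = (t, p)" "t \<in> I" using xS unfolding S_def by (cases x) auto
    interpret torus_immersion \<omega>1 \<omega>2 "F t" by (rule imm[OF x(2)])
    show ?thesis using rr_pos[of p] by (simp add: x E_rr[OF x(2)])
  qed
  then have G: "smooth_on S G"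
    unfolding G_def[abs_def] by (intro smooth_on_scaleR[OF S] smooth_on_powr[OF S smE] smooth_on_null_vec[OF S Fh])
  \<comment> \<open>\<open>M\<close> is the mixed derivative of the lift, whose square is the Willmore density.\<close>
  define M where "M x = (1 / 4) *\<^sub>R (dir (0, 1) (dir (0, 1) G) x + dir (0, \<i>) (dir (0, \<i>) G) x)" for x
  have M: "smooth_on S M"
    unfolding M_def[abs_def]
    by (rule smooth_on_scaleR[OF S smooth_on_const smooth_on_add[OF S]]; intro smooth_on_dir G)
  note slice = smooth_on_slice[OF _, folded S_def]
  have psi_dir: "dir v (conformal.\<psi> (F t)) p = dir (0, v) G (t, p)"
    "dir w (dir v (conformal.\<psi> (F t))) p = dir (0, w) (dir (0, v) G) (t, p)" if "t \<in> I" for t p v w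
  proof -
    have e: "conformal.\<psi> (F t) = (\<lambda>p. G (t, p))" using G_psi[OF that] by auto
    show 1: "dir v (conformal.\<psi> (F t)) p = dir (0, v) G (t, p)" for p
      unfolding e by (rule smooth_on_slice(2)[OF G[unfolded S_def] that])
    have e1: "dir v (conformal.\<psi> (F t)) = (\<lambda>p. dir (0, v) G (t, p))" using 1 by auto
    show "dir w (dir v (conformal.\<psi> (F t))) p = dir (0, w) (dir (0, v) G) (t, p)"
      unfolding e1 by (rule smooth_on_slice(2)[OF smooth_on_dir[OF G[unfolded S_def]] that])
  qed
  have M_mixed: "M (t, p) = mixed_deriv (F t) p" if "t \<in> I" for t p
  proof -
    interpret torus_immersion \<omega>1 \<omega>2 "F t" by (rule imm[OF that])
    show ?thesis by (simp add: M_def mixed_eq psi_dir[OF that])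
  qed
  define w where "w t = integral unit_square (\<lambda>x. lor (M (t, Tor x)) (M (t, Tor x)))" for t
  have will: "willmore \<omega>1 \<omega>2 (F t) = \<bar>\<Delta>\<bar> * w t" if "t \<in> I" for t
  proof -
    interpret torus_immersion \<omega>1 \<omega>2 "F t" by (rule imm[OF that])
    show ?thesis by (simp add: willmore_mean w_def mean_def M_mixed[OF that])
  qed
  define N where "N x = dir (1, 0) M x" for x
  have N: "smooth_on S N" unfolding N_def[abs_def] by (rule smooth_on_dir[OF M])
  have N_zero: "integral unit_square (\<lambda>x. 2 * lor (N (t, Tor x)) (M (t, Tor x))) = 0" if t: "t \<in> I" for t
  proof -
    interpret torus_immersion \<omega>1 \<omega>2 "F t" by (rule imm[OF t])
    define h where "h p = dir (1, 0) G (t, p)" for p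
    have hh: "smooth_on S (dir (1, 0) G)" by (rule smooth_on_dir[OF G])
    have sh: "smooth h" unfolding h_def[abs_def] by (rule smooth_on_slice(1)[OF hh[unfolded S_def] t])
    have vd: "((\<lambda>\<tau>. nlift (F \<tau>) p) has_vector_derivative h p) (at t)" for p
    proof (rule has_vector_derivative_transform_within_open[OF _ I(1) t])
      show "((\<lambda>\<tau>. G (\<tau>, p)) has_vector_derivative h p) (at t)"
        unfolding h_def by (rule smooth_on_time_derivative[OF G[unfolded S_def] t])
      fix \<tau> assume "\<tau> \<in> I"
      then interpret f': torus_immersion \<omega>1 \<omega>2 "F \<tau>" by (rule imm)
      show "G (\<tau>, p) = nlift (F \<tau>) p" by (simp add: G_psi[OF \<open>\<tau> \<in> I\<close>] f'.nlift_eq)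
    qed
    have "on_torus \<omega>1 \<omega>2 h"
    proof -
      have "h (p + z) = h p" if z: "\<And>\<tau>. \<tau> \<in> I \<Longrightarrow> nlift (F \<tau>) (p + z) = nlift (F \<tau>) p" for p z
        by (rule vector_derivative_unique_at[OF vd[of "p + z"]])
          (rule has_vector_derivative_transform_within_open[OF vd[of p] I(1) t], simp add: z)
      moreover have "nlift (F \<tau>) (p + \<omega>1) = nlift (F \<tau>) p" "nlift (F \<tau>) (p + \<omega>2) = nlift (F \<tau>) p"
        if "\<tau> \<in> I" for \<tau> p
      proof -
        interpret f': torus_immersion \<omega>1 \<omega>2 "F \<tau>" by (rule imm[OF that])
        show "nlift (F \<tau>) (p + \<omega>1) = nlift (F \<tau>) p" "nlift (F \<tau>) (p + \<omega>2) = nlift (F \<tau>) p"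
          unfolding f'.nlift_eq using per_on_torus[OF f'.per_psi] by (simp_all add: on_torus_def)
      qed
      ultimately show ?thesis by (simp add: on_torus_def)
    qed
    then have ph: "per h" by (rule perI[OF sh])
    obtain a b where ab: "\<And>p. cvec (vector_derivative (\<lambda>\<tau>. nlift (F \<tau>) p) (at t)) =
               complex_of_real (a p) *s clift (F t) p + b p *s vdz (clift (F t)) p
               + cnj (b p) *s vdzbar (clift (F t)) p + cvec (ds_variation (F t) p)"
      using flow t unfolding ds_flow_def by blast
    have hp: "cvec (h p) = complex_of_real (a p) *s clift (F t) p + b p *s Y1 p + cnj (b p) *s Y2 p + cvec (J p (k1 p))" for p
      using ab[of p] unfolding vector_derivative_at[OF vd] by (simp add: Y1_def Y2_def ds_variation_eq)
    have swap: "dir (1, 0) (dir u K) x = dir u (dir (1, 0) K) x" if "smooth_on S K" "x \<in> S" for K :: "real \<times> complex \<Rightarrow> lor_real" and u x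
      by (rule dir_commute[OF S that(2,1)])
    have hd: "dir v h p = dir (0, v) (dir (1, 0) G) (t, p)" for v p
      unfolding h_def[abs_def] by (rule smooth_on_slice(2)[OF hh[unfolded S_def] t])
    have hd2: "dir u (dir v h) p = dir (0, u) (dir (0, v) (dir (1, 0) G)) (t, p)" for u v p
    proof -
      have "dir v h = (\<lambda>p. dir (0, v) (dir (1, 0) G) (t, p))" using hd by auto
      then show ?thesis
        using smooth_on_slice(2)[OF smooth_on_dir[OF hh, unfolded S_def] t] by simp
    qed
    have metric: "lor (dir v h p) (dir u \<psi> p) + lor (dir u h p) (dir v \<psi> p) = 0" for v u p
    proof -
      have x: "(t, p) \<in> S" by (simp add: Sin t)
      note d = smooth_on_differentiable[OF smooth_on_dir[OF G] x]
      have "dir (1, 0) (\<lambda>x. lor (dir (0, v) G x) (dir (0, u) G x)) (t, p) = dir (1, 0) (\<lambda>x. v \<bullet> u) (t, p)"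
      proof (rule dir_cong_open[OF differentiable_bilinear[OF bounded_bilinear_lor d d] S x])
        fix y assume "y \<in> S"
        then obtain \<tau> r where y: "y = (\<tau>, r)" "\<tau> \<in> I" unfolding S_def by (cases y) auto
        interpret f': torus_immersion \<omega>1 \<omega>2 "F \<tau>" by (rule imm[OF y(2)])
        show "lor (dir (0, v) G y) (dir (0, u) G y) = v \<bullet> u"
          unfolding y psi_dir(1)[OF y(2), symmetric] by (rule f'.psi_metric)
      qed
      then have "lor (dir (0, v) G (t, p)) (dir (1, 0) (dir (0, u) G) (t, p)) + lor (dir (1, 0) (dir (0, v) G) (t, p)) (dir (0, u) G (t, p)) = 0"
        by (simp add: dir_bilinear[OF bounded_bilinear_lor d d] dir_const)
      then show ?thesis
        unfolding hd psi_dir(1)[OF t] swap[OF G x] using lor_commute[of "dir (0, v) G (t, p)"] by simp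
    qed
    have Nh: "N (t, p) = (1 / 4) *\<^sub>R (dir 1 (dir 1 h) p + dir \<i> (dir \<i> h) p)" for p
    proof -
      have x: "(t, p) \<in> S" by (simp add: Sin t)
      have "dir (1, 0) (dir u (dir u G)) (t, p) = dir u (dir u (dir (1, 0) G)) (t, p)" for u
      proof -
        have "dir (1, 0) (dir u (dir u G)) (t, p) = dir u (dir (1, 0) (dir u G)) (t, p)"
          by (rule swap[OF smooth_on_dir[OF G] x])
        also have "\<dots> = dir u (dir u (dir (1, 0) G)) (t, p)"
          by (rule dir_cong_open[OF smooth_on_differentiable[OF smooth_on_dir[OF smooth_on_dir[OF G]] x] S x swap[OF G]])
        finally show ?thesis .
      qed
      moreover have "N (t, p) = (1 / 4) *\<^sub>R (dir (1, 0) (dir (0, 1) (dir (0, 1) G)) (t, p) + dir (1, 0) (dir (0, \<i>) (dir (0, \<i>) G)) (t, p))"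
      proof -
        note d = smooth_on_differentiable[OF smooth_on_dir[OF smooth_on_dir[OF G]] x]
        show ?thesis
          unfolding N_def M_def[abs_def] dir_bounded_linear[OF bounded_linear_scaleR_right differentiable_add[OF d d]]
            dir_add[OF d d] by (rule refl)
      qed
      ultimately show ?thesis by (simp add: hd2)
    qed
    have "mean (\<lambda>p. lor (N (t, p)) (mixed p)) = 0"
      unfolding Nh using mean_first_variation[OF ph metric hp] .
    then have "integral unit_square (\<lambda>x. lor (N (t, Tor x)) (M (t, Tor x))) = 0"
      by (simp add: mean_def M_mixed[OF t])
    then show ?thesis by simp
  qed
  have cont: "continuous_on (I \<times> unit_square) (\<lambda>x. g (fst x, Tor (snd x)))" if "smooth_on S g" for g :: "real \<times> complex \<Rightarrow> lor_real"
    by (rule continuous_on_compose2[OF smooth_on_continuous[OF that]])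
      (auto simp: S_def intro!: continuous_intros continuous_on_compose2[OF linear_continuous_on[OF bounded_linear_Tor]])
  have "(w has_field_derivative 0) (at t within I)" if t: "t \<in> I" for t
  proof -
    have "(w has_field_derivative integral unit_square (\<lambda>x. 2 * lor (N (t, Tor x)) (M (t, Tor x)))) (at t within I)"
      unfolding w_def[abs_def]
    proof (rule leibniz_rule_field_derivative)
      fix t x assume "t \<in> I"
      have "((\<lambda>\<tau>. lor (M (\<tau>, Tor x)) (M (\<tau>, Tor x))) has_derivative
          (\<lambda>r. lor (M (t, Tor x)) (r *\<^sub>R N (t, Tor x)) + lor (r *\<^sub>R N (t, Tor x)) (M (t, Tor x)))) (at t)"
        using smooth_on_time_derivative[OF M[unfolded S_def] \<open>t \<in> I\<close>, of "Tor x"] unfolding has_vector_derivative_def N_def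
        by (rule bounded_bilinear.FDERIV[OF bounded_bilinear_lor]) (rule smooth_on_time_derivative[OF M[unfolded S_def] \<open>t \<in> I\<close>, of "Tor x", unfolded has_vector_derivative_def])
      then have "((\<lambda>\<tau>. lor (M (\<tau>, Tor x)) (M (\<tau>, Tor x))) has_field_derivative 2 * lor (N (t, Tor x)) (M (t, Tor x))) (at t)"
        unfolding has_field_derivative_def
        by (rule has_derivative_eq_rhs) (simp add: fun_eq_iff lor_scaleR_left lor_scaleR_right lor_commute[of "M _"])
      then show "((\<lambda>\<tau>. lor (M (\<tau>, Tor x)) (M (\<tau>, Tor x))) has_field_derivative 2 * lor (N (t, Tor x)) (M (t, Tor x))) (at t within I)"
        by (rule has_field_derivative_at_within)
    next
      fix t assume "t \<in> I"
      show "(\<lambda>x. lor (M (t, Tor x)) (M (t, Tor x))) integrable_on unit_square"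
        using integrable_Tor[OF smooth_on_continuous[OF smooth_lor[OF smooth_on_slice(1)[OF M[unfolded S_def] \<open>t \<in> I\<close>]
          smooth_on_slice(1)[OF M[unfolded S_def] \<open>t \<in> I\<close>]]]] .
    next
      show "continuous_on (I \<times> unit_square) (\<lambda>(t, x). 2 * lor (N (t, Tor x)) (M (t, Tor x)))"
        unfolding split_beta
        by (intro continuous_on_mult continuous_on_const bounded_bilinear.continuous_on[OF bounded_bilinear_lor] cont N M)
      show "convex I" by (rule is_interval_convex[OF I(2)])
    qed (rule t)
    then show ?thesis unfolding N_zero[OF t] .
  qed
  then obtain c where "\<And>t. t \<in> I \<Longrightarrow> w t = c"
    using has_field_derivative_zero_constant[OF is_interval_convex[OF I(2)], of w] by blast
  then show ?thesis using will by auto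
qed

end

theorem mainTheorem7:
  fixes \<omega>1 \<omega>2 :: complex
  assumes "Im (\<omega>2 / \<omega>1) \<noteq> 0"
  shows
    "(\<forall>f. conformal_immersion \<omega>1 \<omega>2 f \<longrightarrow>
        ((\<exists>b. dbar_solution \<omega>1 \<omega>2 f b) \<longleftrightarrow> normal_degree \<omega>1 \<omega>2 f = 0) \<and>
        ((\<exists>b. dbar_solution \<omega>1 \<omega>2 f b) \<longrightarrow>
           (\<exists>!b. dbar_solution \<omega>1 \<omega>2 f b \<and> torus_integral \<omega>1 \<omega>2 b = 0))) \<and>
     (\<forall>I F. open I \<and> is_interval I \<and> ds_flow \<omega>1 \<omega>2 I F \<longrightarrow>
        (\<forall>s\<in>I. \<forall>t\<in>I. willmore \<omega>1 \<omega>2 (F s) = willmore \<omega>1 \<omega>2 (F t)))"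
proof -
  interpret torus \<omega>1 \<omega>2 by standard (rule assms)
  have "torus_immersion \<omega>1 \<omega>2 f" if "conformal_immersion \<omega>1 \<omega>2 f" for f
    using conformal_immersionD[OF that]
    by (intro torus_immersion.intro torus_immersion_axioms.intro) (auto intro: torus_axioms)
  then show ?thesis
    using torus_immersion.dbar_solvable_iff torus_immersion.dbar_solution_unique willmore_constant by metis
qed

end
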